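(* Let $\Omega=B(0,1)\subset\mathbb{R}^2$ be the unit disc. For any $\alpha>0$ there exist a sequence $\sigma_n\in M_{1+\alpha}(\Omega)$ and numbers $\delta_n>0$, $\delta_n\to0$, with $\sigma_n=I$ on $\Omega_{\delta_n}=\{x\in\Omega:d(x,\partial\Omega)<\delta_n\}$, such that $\sigma_n\to I$ in the sense of $G$-convergence, but $$\limsup_{n\to\infty}\|\Lambda_{\sigma_n}-\Lambda_I\|_{H^{1/2}(\partial\Omega)\to H^{-1/2}(\partial\Omega)}>\frac{\alpha}{16(2+\alpha)} .$$
   Context: $M_K(\Omega)$ is the set of measurable real symmetric $2\times2$ matrix fields $\sigma$ on $\Omega$ with $\frac1K|\xi|^2\le\sigma(x)\xi\cdot\xi\le K|\xi|^2$ for a.e. $x$ and all $\xi$; $I$ is the identity matrix. $\sigma_n\in M_K(\Omega)$ $G$-converges to $\sigma\in M_K(\Omega)$ if for every $f\in H^{-1}(\Omega)$ the solutions $u_n\in H^1_0(\Omega)$ of $-\nabla\cdot(\sigma_n\nabla u_n)=f$ converge weakly in $H^1_0(\Omega)$ to the solution $u\in H_0^1(\Omega)$ of $-\nabla\cdot(\sigma\nabla u)=f$. The Dirichlet-to-Neumann map is $\Lambda_\sigma\varphi=\nu\cdot\sigma\nabla u|_{\partial\Omega}$ where $\nabla\cdot(\sigma\nabla u)=0$ in $\Omega$, $u|_{\partial\Omega}=\varphi$, $\nu$ the exterior unit normal (in weak form, $\langle\Lambda_\sigma\varphi,\psi\rangle=\int_\Omega\sigma\nabla u\cdot\overline{\nabla\tilde\psi}$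 for any $H^1$ extension $\tilde\psi$ of $\psi$); e.g. $\Lambda_Ie^{ik\theta}=|k|e^{ik\theta}$. The norms on the circle $\partial\Omega$ are $\|u\|_{H^s}^2=|u_0|^2+\sum_{k\ne0}|k|^{2s}|u_k|^2$ for $u=\sum_ku_ke^{ik\theta}$, with $s=\pm\frac12$. *)

theory Defs
  imports "HOL-Analysis.Analysis"
begin

type_synonym plane = "real ^ 2"

definition disc :: "plane set" where
  "disc = ball 0 1"


definition L2_on :: "'a::euclidean_space set \<Rightarrow> ('a \<Rightarrow> 'b::euclidean_space) set" where
  "L2_on S = {u \<in> borel_measurable (lebesgue_on S). integrable (lebesgue_on S) (\<lambda>x. (norm (u x))\<^sup>2)}"

definition L2_norm_on :: "'a::euclidean_space set \<Rightarrow> ('a \<Rightarrow> 'b::euclidean_space) \<Rightarrow> real" where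
  "L2_norm_on S u = sqrt (LINT x|lebesgue_on S. (norm (u x))\<^sup>2)"


definition partial :: "2 \<Rightarrow> (plane \<Rightarrow> complex) \<Rightarrow> plane \<Rightarrow> complex" where
  "partial i w = (\<lambda>x. frechet_derivative w (at x) (axis i 1))"

primrec Ck :: "nat \<Rightarrow> (plane \<Rightarrow> complex) \<Rightarrow> bool" where
  "Ck 0 w \<longleftrightarrow> continuous_on UNIV w"
| "Ck (Suc k) w \<longleftrightarrow> (\<forall>x. w differentiable (at x)) \<and> (\<forall>i. Ck k (partial i w))"

definition smooth :: "(plane \<Rightarrow> complex) \<Rightarrow> bool" where
  "smooth w \<longleftrightarrow> (\<forall>k. Ck k w)"

definition test_functions :: "plane set \<Rightarrow> (plane \<Rightarrow> complex) set" where
  "test_functions \<Omega> = {w. smooth w \<and> (\<exists>C. compact C \<and> C \<subseteq> \<Omega> \<and> (\<forall>x. x \<notin> C \<longrightarrow> w x = 0))}"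


text \<open>
  Sobolev functions are complex valued and are handled through representatives: two functions that
  agree almost everywhere on \<open>\<Omega>\<close> are the same element of \<open>H\<^sup>1(\<Omega>)\<close>, and the values off \<open>\<Omega>\<close> are irrelevant.
\<close>

definition weak_gradient ::
    "plane set \<Rightarrow> (plane \<Rightarrow> complex) \<Rightarrow> (plane \<Rightarrow> complex ^ 2) \<Rightarrow> bool" where
  "weak_gradient \<Omega> u g \<longleftrightarrow> g \<in> L2_on \<Omega> \<and>
     (\<forall>w \<in> test_functions \<Omega>. \<forall>i.
        (LINT x|lebesgue_on \<Omega>. u x * partial i w x) = - (LINT x|lebesgue_on \<Omega>. g x $ i * w x))"

definition H1 :: "plane set \<Rightarrow> (plane \<Rightarrow> complex) set" where
  "H1 \<Omega> = {u \<in> L2_on \<Omega>. \<exists>g. weak_gradient \<Omega> u g}"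

text \<open>The choice below is immaterial: the weak gradient is unique up to a null set.\<close>

definition grad :: "plane set \<Rightarrow> (plane \<Rightarrow> complex) \<Rightarrow> plane \<Rightarrow> complex ^ 2" where
  "grad \<Omega> u = (SOME g. weak_gradient \<Omega> u g)"

definition H1_norm :: "plane set \<Rightarrow> (plane \<Rightarrow> complex) \<Rightarrow> real" where
  "H1_norm \<Omega> u = sqrt ((L2_norm_on \<Omega> u)\<^sup>2 + (L2_norm_on \<Omega> (grad \<Omega> u))\<^sup>2)"

definition H10 :: "plane set \<Rightarrow> (plane \<Rightarrow> complex) set" where
  "H10 \<Omega> = {u \<in> H1 \<Omega>. \<exists>w :: nat \<Rightarrow> plane \<Rightarrow> complex.
     (\<forall>j. w j \<in> test_functions \<Omega>) \<and> (\<lambda>j. H1_norm \<Omega> (\<lambda>x. w j x - u x)) \<longlonglongrightarrow> 0}"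

text \<open>
  \<open>H\<^sup>-\<^sup>1(\<Omega>)\<close> is the dual of \<open>H\<^sup>1\<^sub>0(\<Omega>)\<close>.  Boundedness forces a functional to take equal values on functions
  that agree almost everywhere.
\<close>

definition Hm1 :: "plane set \<Rightarrow> ((plane \<Rightarrow> complex) \<Rightarrow> complex) set" where
  "Hm1 \<Omega> = {f.
     (\<forall>u \<in> H10 \<Omega>. \<forall>v \<in> H10 \<Omega>. f (\<lambda>x. u x + v x) = f u + f v) \<and>
     (\<forall>c. \<forall>u \<in> H10 \<Omega>. f (\<lambda>x. c * u x) = c * f u) \<and>
     (\<exists>C. \<forall>u \<in> H10 \<Omega>. norm (f u) \<le> C * H1_norm \<Omega> u)}"

definition weakly_converges_H10 ::
    "plane set \<Rightarrow> (nat \<Rightarrow> plane \<Rightarrow> complex) \<Rightarrow> (plane \<Rightarrow> complex) \<Rightarrow> bool" where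
  "weakly_converges_H10 \<Omega> u v \<longleftrightarrow> (\<forall>L \<in> Hm1 \<Omega>. (\<lambda>n. L (u n)) \<longlonglongrightarrow> L v)"


definition M_class :: "real \<Rightarrow> plane set \<Rightarrow> (plane \<Rightarrow> real ^ 2 ^ 2) set" where
  "M_class K \<Omega> = {\<sigma> \<in> borel_measurable (lebesgue_on \<Omega>).
     (\<forall>x \<in> \<Omega>. transpose (\<sigma> x) = \<sigma> x) \<and>
     (AE x in lebesgue_on \<Omega>. \<forall>\<xi>.
        (1 / K) * (norm \<xi>)\<^sup>2 \<le> (\<sigma> x *v \<xi>) \<bullet> \<xi> \<and> (\<sigma> x *v \<xi>) \<bullet> \<xi> \<le> K * (norm \<xi>)\<^sup>2)}"

text \<open>The integral over \<open>\<Omega>\<close> of \<open>\<sigma> g \<cdot> h\<close>, bilinear in \<open>g\<close> and \<open>h\<close> (no conjugation).\<close>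

definition energy ::
    "plane set \<Rightarrow> (plane \<Rightarrow> real ^ 2 ^ 2) \<Rightarrow> (plane \<Rightarrow> complex ^ 2) \<Rightarrow> (plane \<Rightarrow> complex ^ 2) \<Rightarrow> complex" where
  "energy \<Omega> \<sigma> g h =
     (LINT x|lebesgue_on \<Omega>. (\<Sum>i\<in>UNIV. (\<Sum>j\<in>UNIV. of_real (\<sigma> x $ i $ j) * g x $ j) * h x $ i))"

text \<open>The equation \<open>- \<nabla>\<cdot>(\<sigma>\<nabla>u) = f\<close> in \<open>\<Omega>\<close>, without boundary condition.\<close>

definition divergence_equation ::
    "plane set \<Rightarrow> (plane \<Rightarrow> real ^ 2 ^ 2) \<Rightarrow> (plane \<Rightarrow> complex) \<Rightarrow> ((plane \<Rightarrow> complex) \<Rightarrow> complex) \<Rightarrow> bool" where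
  "divergence_equation \<Omega> \<sigma> u f \<longleftrightarrow> (\<forall>v \<in> H10 \<Omega>. energy \<Omega> \<sigma> (grad \<Omega> u) (grad \<Omega> v) = f v)"

text \<open>
  By Lax--Milgram the solutions exist and are unique up to null sets, so quantifying over
  all representatives of the solutions is the same as speaking about the solutions.
\<close>

definition G_converges ::
    "real \<Rightarrow> plane set \<Rightarrow> (nat \<Rightarrow> plane \<Rightarrow> real ^ 2 ^ 2) \<Rightarrow> (plane \<Rightarrow> real ^ 2 ^ 2) \<Rightarrow> bool" where
  "G_converges K \<Omega> \<sigma>n \<sigma> \<longleftrightarrow>
     (\<forall>n. \<sigma>n n \<in> M_class K \<Omega>) \<and> \<sigma> \<in> M_class K \<Omega> \<and>
     (\<forall>f \<in> Hm1 \<Omega>. \<forall>un u.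
        (\<forall>n. un n \<in> H10 \<Omega> \<and> divergence_equation \<Omega> (\<sigma>n n) (un n) f) \<longrightarrow>
        u \<in> H10 \<Omega> \<and> divergence_equation \<Omega> \<sigma> u f \<longrightarrow>
        weakly_converges_H10 \<Omega> un u)"


text \<open>
  Functions on the unit circle are written as functions of the angle \<open>\<theta> \<in> [0, 2\<pi>]\<close>.  The trace is the
  continuous extension to \<open>H\<^sup>1\<close> of the restriction to the circle of functions that are smooth
  up to the boundary.
\<close>

definition circle_point :: "real \<Rightarrow> plane" where
  "circle_point \<theta> = vector [cos \<theta>, sin \<theta>]"

definition has_trace :: "(plane \<Rightarrow> complex) \<Rightarrow> (real \<Rightarrow> complex) \<Rightarrow> bool" where
  "has_trace u \<phi> \<longleftrightarrow> u \<in> H1 disc \<and> \<phi> \<in> L2_on {0..2 * pi} \<and>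
     (\<exists>w :: nat \<Rightarrow> plane \<Rightarrow> complex. (\<forall>j. smooth (w j)) \<and>
        (\<lambda>j. H1_norm disc (\<lambda>x. w j x - u x)) \<longlonglongrightarrow> 0 \<and>
        (\<lambda>j. L2_norm_on {0..2 * pi} (\<lambda>\<theta>. w j (circle_point \<theta>) - \<phi> \<theta>)) \<longlonglongrightarrow> 0)"

definition circle_mode :: "int \<Rightarrow> real \<Rightarrow> complex" where
  "circle_mode k \<theta> = cis (of_int k * \<theta>)"

definition fourier_coeff :: "(real \<Rightarrow> complex) \<Rightarrow> int \<Rightarrow> complex" where
  "fourier_coeff \<phi> k = (LINT \<theta>|lebesgue_on {0..2 * pi}. \<phi> \<theta> * cnj (circle_mode k \<theta>)) / of_real (2 * pi)"

text \<open>
  A distribution \<open>T\<close> on the circle is represented by its antilinear pairing \<open>\<psi> \<mapsto> \<langle>T, \<psi>\<rangle>\<close>, which for a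
  function \<open>T\<close> is the integral of \<open>T\<close> times the conjugate of \<open>\<psi>\<close> with respect to arc length.
\<close>

definition dual_fourier_coeff :: "((real \<Rightarrow> complex) \<Rightarrow> complex) \<Rightarrow> int \<Rightarrow> complex" where
  "dual_fourier_coeff T k = T (circle_mode k) / of_real (2 * pi)"

definition Hs_norm :: "real \<Rightarrow> (int \<Rightarrow> complex) \<Rightarrow> ereal" where
  "Hs_norm s c =
     (if (\<lambda>k. real_of_int \<bar>k\<bar> powr (2 * s) * (norm (c k))\<^sup>2) summable_on (- {0})
      then ereal (sqrt ((norm (c 0))\<^sup>2 + (\<Sum>\<^sub>\<infinity>k\<in>- {0}. real_of_int \<bar>k\<bar> powr (2 * s) * (norm (c k))\<^sup>2)))
      else \<infinity>)"

text \<open>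
  \<open>T\<close> is \<open>\<Lambda>\<^sub>\<sigma> \<phi>\<close> in weak form.  For \<open>\<phi> \<in> H\<^sup>1\<^sup>/\<^sup>2\<close> such a \<open>T\<close> exists, and its values on \<open>H\<^sup>1\<^sup>/\<^sup>2\<close>,
  the space of traces, are uniquely determined.
\<close>

definition is_DN ::
    "(plane \<Rightarrow> real ^ 2 ^ 2) \<Rightarrow> (real \<Rightarrow> complex) \<Rightarrow> ((real \<Rightarrow> complex) \<Rightarrow> complex) \<Rightarrow> bool" where
  "is_DN \<sigma> \<phi> T \<longleftrightarrow>
     (\<exists>u. has_trace u \<phi> \<and> divergence_equation disc \<sigma> u (\<lambda>_. 0) \<and>
        (\<forall>\<psi> v. has_trace v \<psi> \<longrightarrow>
           T \<psi> = energy disc \<sigma> (grad disc u) (\<lambda>x. \<chi> i. cnj (grad disc v x $ i))))"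

definition DN_map ::
    "(plane \<Rightarrow> real ^ 2 ^ 2) \<Rightarrow> (real \<Rightarrow> complex) \<Rightarrow> (real \<Rightarrow> complex) \<Rightarrow> complex" where
  "DN_map \<sigma> \<phi> = (SOME T. is_DN \<sigma> \<phi> T)"

text \<open>The operator norm from \<open>H\<^sup>1\<^sup>/\<^sup>2\<close> to \<open>H\<^sup>-\<^sup>1\<^sup>/\<^sup>2\<close>.\<close>

definition half_operator_norm :: "((real \<Rightarrow> complex) \<Rightarrow> (real \<Rightarrow> complex) \<Rightarrow> complex) \<Rightarrow> ereal" where
  "half_operator_norm A =
     (SUP \<phi> \<in> {\<phi> \<in> L2_on {0..2 * pi}. Hs_norm (1/2) (fourier_coeff \<phi>) \<le> 1}.
        Hs_norm (- 1/2) (dual_fourier_coeff (A \<phi>)))"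

end

theory Submission
  imports Defs
begin

text \<open>
  The coefficients are \<open>\<sigma> = I + \<beta>(\<bar>x\<bar>\<^sup>2) \<tau> \<otimes> \<tau>\<close>, where \<open>\<tau>\<close> is the unit tangent field of the circles around
  the origin and \<open>0 \<le> \<beta> \<le> \<alpha>\<close> is supported in the window \<open>N/(N+1) < \<bar>x\<bar>\<^sup>2 < 1 - 1/(4N)\<close>; the \<open>n\<close>-th
  coefficient has \<open>N = n + 1\<close>.  The window keeps away from the circle, but its distance to the circle
  and its width are both of order \<open>1/N\<close>.

  As \<open>N\<close> grows, the window leaves every compact subset of the disc, so the coefficients converge to
  \<open>I\<close> pointwise.  Since they are uniformly elliptic, solutions with a fixed right-hand side then
  converge even strongly, by an energy estimate, dominated convergence and the Poincare inequality
  (\<open>G_converges_pointwise\<close>).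

  The boundary values \<open>e\<^sup>i\<^sup>N\<^sup>\<theta>\<close>, however, do not forget the window: their harmonic extension \<open>z\<^sup>N\<close> varies
  on the scale \<open>1/N\<close> near the circle.  The function \<open>u = z\<^sup>N h(\<bar>z\<bar>\<^sup>2)\<close> solves the equation if \<open>h\<close> solves an
  ordinary differential equation, and \<open>\<beta>\<close> is chosen such that this equation can be integrated: \<open>h\<close> is
  then a \<open>C\<^sup>1\<close> function, constant on the inner side of the window and of the form \<open>A - B \<bar>z\<bar>\<^sup>-\<^sup>2\<^sup>N\<close> on
  its outer side (\<open>radial_profile\<close>).  So \<open>e\<^sup>i\<^sup>N\<^sup>\<theta>\<close> is an eigenfunction of \<open>\<Lambda>\<^sub>\<sigma>\<close>, with eigenvalue \<open>N + 2 h'(1)/h(1)\<close>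
  instead of \<open>N\<close> (\<open>DN_map_circle_mode\<close>).  On this mode the norm from \<open>H\<^sup>1\<^sup>/\<^sup>2\<close> to \<open>H\<^sup>-\<^sup>1\<^sup>/\<^sup>2\<close> divides by \<open>N\<close>, so the operator
  norm of the difference is at least \<open>2 h'(1)/(N h(1))\<close>, and elementary estimates bound this from below
  by \<open>\<alpha>/(8 + 2\<alpha>)\<close>, for every \<open>N\<close> (\<open>window_profile\<close>).

  What remains is to connect the explicit solution with the weak formulation.  Weak gradients are
  unique because there are enough test functions (\<open>fundamental_lemma\<close>).  The solution has the right
  trace because \<open>h\<close> can be approximated in \<open>C\<^sup>1\<close> by polynomials (\<open>has_trace_radial_mode\<close>).  Green's
  formula in polar coordinates (\<open>green_radial_mode\<close>) shows that the energy pairing of \<open>u\<close> with a smooth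
  function, hence by continuity with any \<open>H\<^sup>1\<close> function, depends on boundary values only; this gives at
  once the weak equation and the Dirichlet-to-Neumann functional.  Finally, the map is defined by
  choosing some functional for each boundary value, and \<open>is_DN_reciprocal\<close> shows that the choice does not
  affect the value at \<open>e\<^sup>i\<^sup>N\<^sup>\<theta>\<close>.
\<close>

section \<open>Square integrable functions\<close>

lemma L2_onD:
  assumes "u \<in> L2_on S"
  shows "u \<in> borel_measurable (lebesgue_on S)" "integrable (lebesgue_on S) (\<lambda>x. (norm (u x))\<^sup>2)"
  using assms by (auto simp: L2_on_def)

lemma L2_norm_on_nonneg [simp]: "0 \<le> L2_norm_on S u"
  by (simp add: L2_norm_on_def)

lemma L2_norm_on_power2:
  "(L2_norm_on S u)\<^sup>2 = (LINT x|lebesgue_on S. (norm (u x))\<^sup>2)"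
  by (simp add: L2_norm_on_def)

lemma L2_norm_on_cong_AE:
  assumes "u \<in> borel_measurable (lebesgue_on S)" "v \<in> borel_measurable (lebesgue_on S)"
    and "AE x in lebesgue_on S. norm (u x) = norm (v x)"
  shows "L2_norm_on S u = L2_norm_on S v"
proof -
  have "(LINT x|lebesgue_on S. (norm (u x))\<^sup>2) = (LINT x|lebesgue_on S. (norm (v x))\<^sup>2)"
    by (rule integral_cong_AE) (use assms in auto)
  then show ?thesis by (simp add: L2_norm_on_def)
qed

lemma L2_norm_on_cong:
  assumes "\<And>x. x \<in> S \<Longrightarrow> norm (u x) = norm (v x)"
  shows "L2_norm_on S u = L2_norm_on S v"
  unfolding L2_norm_on_def by (rule arg_cong[where f=sqrt], rule Bochner_Integration.integral_cong) (auto simp: assms)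

lemma L2_on_dominated:
  assumes "v \<in> L2_on S" "u \<in> borel_measurable (lebesgue_on S)" "0 \<le> C"
    and "AE x in lebesgue_on S. norm (u x) \<le> C * norm (v x)"
  shows "u \<in> L2_on S" "L2_norm_on S u \<le> C * L2_norm_on S v"
proof -
  note v = L2_onD[OF assms(1)]
  have le: "AE x in lebesgue_on S. (norm (u x))\<^sup>2 \<le> C\<^sup>2 * (norm (v x))\<^sup>2"
    using assms(4) by eventually_elim (metis norm_ge_zero power_mono power_mult_distrib)
  have I: "integrable (lebesgue_on S) (\<lambda>x. C\<^sup>2 * (norm (v x))\<^sup>2)"
    using v(2) by simp
  have I': "integrable (lebesgue_on S) (\<lambda>x. (norm (u x))\<^sup>2)"
    by (rule Bochner_Integration.integrable_bound[OF I]) (use assms(2) le in auto)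
  then show "u \<in> L2_on S" using assms(2) by (simp add: L2_on_def)
  have "(L2_norm_on S u)\<^sup>2 \<le> C\<^sup>2 * (L2_norm_on S v)\<^sup>2"
    unfolding L2_norm_on_power2
    using integral_mono_AE[OF I' I le] by simp
  then have "(L2_norm_on S u)\<^sup>2 \<le> (C * L2_norm_on S v)\<^sup>2" by (simp add: power_mult_distrib)
  then show "L2_norm_on S u \<le> C * L2_norm_on S v"
    by (rule power2_le_imp_le) (simp add: assms(3))
qed

lemma L2_on_mono:
  assumes "v \<in> L2_on S" "u \<in> borel_measurable (lebesgue_on S)"
    and "\<And>x. x \<in> S \<Longrightarrow> norm (u x) \<le> norm (v x)"
  shows "u \<in> L2_on S" "L2_norm_on S u \<le> L2_norm_on S v"
proof -
  have "AE x in lebesgue_on S. norm (u x) \<le> 1 * norm (v x)"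
    by (rule AE_I2) (use assms(3) in simp)
  from L2_on_dominated[OF assms(1,2) _ this]
  show "u \<in> L2_on S" "L2_norm_on S u \<le> L2_norm_on S v" by auto
qed

lemma L2_on_Cauchy_Schwarz:
  assumes "u \<in> L2_on S" "v \<in> L2_on S"
  shows "integrable (lebesgue_on S) (\<lambda>x. norm (u x) * norm (v x))"
    and "(LINT x|lebesgue_on S. norm (u x) * norm (v x)) \<le> L2_norm_on S u * L2_norm_on S v"
proof -
  note u = L2_onD[OF assms(1)] and v = L2_onD[OF assms(2)]
  note [measurable] = u(1) v(1)
  have I0: "integrable (lebesgue_on S) (\<lambda>x. (norm (u x))\<^sup>2 + (norm (v x))\<^sup>2)"
    using u(2) v(2) by simp
  show I: "integrable (lebesgue_on S) (\<lambda>x. norm (u x) * norm (v x))"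
  proof (rule Bochner_Integration.integrable_bound[OF I0])
    show "AE x in lebesgue_on S. norm (norm (u x) * norm (v x)) \<le> norm ((norm (u x))\<^sup>2 + (norm (v x))\<^sup>2)"
    proof (rule AE_I2)
      fix x
      have "0 \<le> norm (u x) * norm (v x)" by simp
      moreover have "2 * norm (u x) * norm (v x) \<le> (norm (u x))\<^sup>2 + (norm (v x))\<^sup>2"
        by (rule sum_squares_bound)
      ultimately show "norm (norm (u x) * norm (v x)) \<le> norm ((norm (u x))\<^sup>2 + (norm (v x))\<^sup>2)"
        unfolding real_norm_def by linarith
    qed
  qed measurable
  let ?p = "LINT x|lebesgue_on S. norm (u x) * norm (v x)"
  have eq: "(\<integral>\<^sup>+x. ennreal (norm (u x)) * ennreal (norm (v x)) \<partial>lebesgue_on S) = ennreal ?p"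
    using nn_integral_eq_integral[OF I] by (simp add: ennreal_mult)
  have equ: "(\<integral>\<^sup>+x. (ennreal (norm (u x)))\<^sup>2 \<partial>lebesgue_on S) = ennreal ((L2_norm_on S u)\<^sup>2)"
    using nn_integral_eq_integral[OF u(2)] by (simp add: L2_norm_on_power2 ennreal_power)
  have eqv: "(\<integral>\<^sup>+x. (ennreal (norm (v x)))\<^sup>2 \<partial>lebesgue_on S) = ennreal ((L2_norm_on S v)\<^sup>2)"
    using nn_integral_eq_integral[OF v(2)] by (simp add: L2_norm_on_power2 ennreal_power)
  have p0: "0 \<le> ?p" by (rule integral_nonneg_AE) auto
  have "(ennreal ?p)\<^sup>2 \<le> ennreal ((L2_norm_on S u)\<^sup>2) * ennreal ((L2_norm_on S v)\<^sup>2)"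
    unfolding eq[symmetric] equ[symmetric] eqv[symmetric]
    by (rule Cauchy_Schwarz_nn_integral) measurable
  then have "ennreal (?p\<^sup>2) \<le> ennreal ((L2_norm_on S u)\<^sup>2 * (L2_norm_on S v)\<^sup>2)"
    using p0 by (simp add: ennreal_power ennreal_mult)
  then have "?p\<^sup>2 \<le> (L2_norm_on S u * L2_norm_on S v)\<^sup>2"
    by (simp add: power_mult_distrib)
  then show "?p \<le> L2_norm_on S u * L2_norm_on S v"
    by (rule power2_le_imp_le) simp
qed

lemma L2_on_add:
  assumes "u \<in> L2_on S" "v \<in> L2_on S"
  shows "(\<lambda>x. u x + v x) \<in> L2_on S"
    and "L2_norm_on S (\<lambda>x. u x + v x) \<le> L2_norm_on S u + L2_norm_on S v"
proof -
  note u = L2_onD[OF assms(1)] and v = L2_onD[OF assms(2)]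
  note cs = L2_on_Cauchy_Schwarz[OF assms]
  note [measurable] = u(1) v(1)
  let ?s = "\<lambda>x. (norm (u x))\<^sup>2 + 2 * (norm (u x) * norm (v x)) + (norm (v x))\<^sup>2"
  have le: "(norm (u x + v x))\<^sup>2 \<le> ?s x" for x
  proof -
    have "(norm (u x + v x))\<^sup>2 \<le> (norm (u x) + norm (v x))\<^sup>2"
      by (rule power_mono[OF norm_triangle_ineq]) simp
    then show ?thesis by (simp add: power2_sum algebra_simps)
  qed
  have I: "integrable (lebesgue_on S) ?s"
    using u(2) v(2) cs(1) by simp
  have I': "integrable (lebesgue_on S) (\<lambda>x. (norm (u x + v x))\<^sup>2)"
    by (rule Bochner_Integration.integrable_bound[OF I]) (use le in \<open>auto intro: order_trans abs_ge_self\<close>)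
  then show "(\<lambda>x. u x + v x) \<in> L2_on S" by (simp add: L2_on_def)
  have "(L2_norm_on S (\<lambda>x. u x + v x))\<^sup>2 \<le> (LINT x|lebesgue_on S. ?s x)"
    unfolding L2_norm_on_power2 by (rule integral_mono[OF I' I]) (rule le)
  also have "\<dots> = (L2_norm_on S u)\<^sup>2 + 2 * (LINT x|lebesgue_on S. norm (u x) * norm (v x)) + (L2_norm_on S v)\<^sup>2"
    using u(2) v(2) cs(1) by (simp add: L2_norm_on_power2)
  also have "\<dots> \<le> (L2_norm_on S u + L2_norm_on S v)\<^sup>2"
    using cs(2) by (simp add: power2_sum)
  finally show "L2_norm_on S (\<lambda>x. u x + v x) \<le> L2_norm_on S u + L2_norm_on S v"
    by (rule power2_le_imp_le) simp
qed

lemma L2_on_uminus: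
  assumes "u \<in> L2_on S"
  shows "(\<lambda>x. - u x) \<in> L2_on S"
  using L2_on_mono[OF assms, of "\<lambda>x. - u x"] L2_onD[OF assms] by auto

lemma L2_on_diff:
  assumes "u \<in> L2_on S" "v \<in> L2_on S"
  shows "(\<lambda>x. u x - v x) \<in> L2_on S"
  using L2_on_add(1)[OF assms(1) L2_on_uminus[OF assms(2)]] by simp

lemma L2_norm_on_minus_commute: "L2_norm_on S (\<lambda>x. u x - v x) = L2_norm_on S (\<lambda>x. v x - u x)"
  by (rule L2_norm_on_cong) (rule norm_minus_commute)

lemma bounded_imp_L2_on:
  assumes "S \<in> lmeasurable" "u \<in> borel_measurable (lebesgue_on S)" "0 \<le> B"
    and B: "\<And>x. x \<in> S \<Longrightarrow> norm (u x) \<le> B"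
  shows "u \<in> L2_on S" "L2_norm_on S u \<le> B * sqrt (measure lebesgue S)"
proof -
  interpret finite_measure "lebesgue_on S" using assms(1) by (rule finite_measure_lebesgue_on)
  have le: "(norm (u x))\<^sup>2 \<le> B\<^sup>2" if "x \<in> S" for x
    using B[OF that] by (simp add: power_mono)
  have I: "integrable (lebesgue_on S) (\<lambda>x. (norm (u x))\<^sup>2)"
    by (rule integrable_const_bound[where B="B\<^sup>2"]) (use le assms(2) in auto)
  then show "u \<in> L2_on S" using assms(2) by (simp add: L2_on_def)
  have "(LINT x|lebesgue_on S. (norm (u x))\<^sup>2) \<le> (LINT x|lebesgue_on S. B\<^sup>2)"
    by (rule integral_mono[OF I]) (use le in auto)
  also have "\<dots> = B\<^sup>2 * measure lebesgue S"
    using assms(1) by (simp add: measure_restrict_space fmeasurableD)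
  finally show "L2_norm_on S u \<le> B * sqrt (measure lebesgue S)"
    unfolding L2_norm_on_def using assms(3)
    by (metis real_sqrt_le_mono real_sqrt_mult real_sqrt_abs abs_of_nonneg)
qed

lemma L2_integral_tendsto:
  fixes g :: "'a::euclidean_space \<Rightarrow> complex"
  assumes g: "g \<in> L2_on S" and u: "u \<in> L2_on S" and un: "\<And>n. un n \<in> L2_on S"
    and lim: "(\<lambda>n. L2_norm_on S (\<lambda>x. un n x - u x)) \<longlonglongrightarrow> 0"
  shows "(\<lambda>n. LINT x|lebesgue_on S. un n x * g x) \<longlonglongrightarrow> (LINT x|lebesgue_on S. u x * g x)"
proof -
  have int: "integrable (lebesgue_on S) (\<lambda>x. w x * g x)" if "w \<in> L2_on S" for w
    by (rule Bochner_Integration.integrable_bound[OF L2_on_Cauchy_Schwarz(1)[OF that g]])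
       (use L2_onD(1)[OF that] L2_onD(1)[OF g] in \<open>auto simp: norm_mult\<close>)
  have b: "norm ((LINT x|lebesgue_on S. un n x * g x) - (LINT x|lebesgue_on S. u x * g x))
      \<le> L2_norm_on S (\<lambda>x. un n x - u x) * L2_norm_on S g" for n
  proof -
    have d: "(\<lambda>x. un n x - u x) \<in> L2_on S" using L2_on_diff[OF un u] .
    have "(LINT x|lebesgue_on S. un n x * g x) - (LINT x|lebesgue_on S. u x * g x)
        = (LINT x|lebesgue_on S. (un n x - u x) * g x)"
      using int[OF un] int[OF u] by (simp add: left_diff_distrib)
    also have "norm \<dots> \<le> (LINT x|lebesgue_on S. norm (un n x - u x) * norm (g x))"
      using integral_norm_bound[of "lebesgue_on S" "\<lambda>x. (un n x - u x) * g x"] by (simp add: norm_mult)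
    also have "\<dots> \<le> L2_norm_on S (\<lambda>x. un n x - u x) * L2_norm_on S g"
      by (rule L2_on_Cauchy_Schwarz(2)[OF d g])
    finally show ?thesis .
  qed
  have z: "(\<lambda>n. L2_norm_on S (\<lambda>x. un n x - u x) * L2_norm_on S g) \<longlonglongrightarrow> 0"
    using tendsto_mult_left_zero[OF lim] by simp
  have "(\<lambda>n. (LINT x|lebesgue_on S. un n x * g x) - (LINT x|lebesgue_on S. u x * g x)) \<longlonglongrightarrow> 0"
    by (rule Lim_null_comparison[OF _ z]) (use b in auto)
  then show ?thesis by (rule LIM_zero_cancel)
qed

section \<open>Calculus of the classes \<open>Ck\<close>\<close>

lemma partial_eqI: "(w has_derivative w') (at x) \<Longrightarrow> partial i w x = w' (axis i 1)"
  unfolding partial_def using frechet_derivative_at by metis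

lemma Ck_SucD: "Ck (Suc k) w \<Longrightarrow> Ck k w"
proof (induction k arbitrary: w)
  case 0
  then show ?case
    by (auto simp: continuous_on_eq_continuous_at intro: differentiable_imp_continuous_within)
next
  case (Suc k)
  then show ?case by (metis Ck.simps(2))
qed

lemma Ck_imp_differentiable: "Ck (Suc k) w \<Longrightarrow> (w has_derivative frechet_derivative w (at x)) (at x)"
  by (simp add: frechet_derivative_works)

lemma Ck_continuous: "Ck k w \<Longrightarrow> continuous_on UNIV w"
  by (induction k) (use Ck_SucD Ck.simps(1) in blast)+

lemma partial_add:
  assumes "u differentiable (at x)" "v differentiable (at x)"
  shows "partial i (\<lambda>x. u x + v x) x = partial i u x + partial i v x"
  using has_derivative_add[OF assms[unfolded frechet_derivative_works]]
  by (subst partial_eqI) (auto simp: partial_def)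

lemma partial_mult:
  assumes "u differentiable (at x)" "v differentiable (at x)"
  shows "partial i (\<lambda>x. u x * v x) x = u x * partial i v x + partial i u x * v x"
  using has_derivative_mult[OF assms[unfolded frechet_derivative_works]]
  by (subst partial_eqI) (auto simp: partial_def)

lemma partial_const: "partial i (\<lambda>x. c) = (\<lambda>x. 0)"
  by (rule ext, subst partial_eqI[where w'="\<lambda>_. 0"]) auto

lemma Ck_const: "Ck k (\<lambda>x. c)"
  by (induction k arbitrary: c) (auto simp: partial_const)

lemma Ck_add: "Ck k u \<Longrightarrow> Ck k v \<Longrightarrow> Ck k (\<lambda>x. u x + v x)"
proof (induction k arbitrary: u v)
  case 0
  then show ?case by (auto intro: continuous_on_add)
next
  case (Suc k)
  have "partial i (\<lambda>x. u x + v x) = (\<lambda>x. partial i u x + partial i v x)" for i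
    by (rule ext, rule partial_add) (use Suc.prems in auto)
  with Suc show ?case by auto
qed

lemma Ck_mult: "Ck k u \<Longrightarrow> Ck k v \<Longrightarrow> Ck k (\<lambda>x. u x * v x)"
proof (induction k arbitrary: u v)
  case 0
  then show ?case by (auto intro: continuous_on_mult)
next
  case (Suc k)
  have "partial i (\<lambda>x. u x * v x) = (\<lambda>x. u x * partial i v x + partial i u x * v x)" for i
    by (rule ext, rule partial_mult) (use Suc.prems in auto)
  moreover have "Ck k (\<lambda>x. u x * partial i v x + partial i u x * v x)" for i
  proof (rule Ck_add)
    show "Ck k (\<lambda>x. u x * partial i v x)"
      by (rule Suc.IH) (use Suc.prems Ck_SucD[of k u] in auto)
    show "Ck k (\<lambda>x. partial i u x * v x)"
      by (rule Suc.IH) (use Suc.prems Ck_SucD[of k v] in auto)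
  qed
  ultimately show ?case using Suc.prems by auto
qed

lemma Ck_bounded_linear:
  assumes "bounded_linear L" shows "Ck k L"
proof (cases k)
  case 0
  then show ?thesis by (simp add: linear_continuous_on[OF assms])
next
  case (Suc m)
  have d: "(L has_derivative L) (at x)" for x by (rule bounded_linear_imp_has_derivative[OF assms])
  have "partial i L = (\<lambda>x. L (axis i 1))" for i by (rule ext, rule partial_eqI[OF d])
  moreover have "L differentiable (at x)" for x using d by (rule differentiableI)
  ultimately show ?thesis using Suc by (simp add: Ck_const)
qed

lemma Ck_comp_bounded_linear:
  assumes "bounded_linear (L :: complex \<Rightarrow> complex)" "Ck k w" shows "Ck k (\<lambda>x. L (w x))"
  using assms(2)
proof (induction k arbitrary: w)
  case 0
  then have "continuous_on UNIV w" by simp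
  from bounded_linear.continuous_on[OF assms(1) this] show ?case by simp
next
  case (Suc k)
  have d: "((\<lambda>x. L (w x)) has_derivative (\<lambda>h. L (frechet_derivative w (at x) h))) (at x)" for x
    by (rule bounded_linear.has_derivative[OF assms(1)]) (rule Ck_imp_differentiable[OF Suc.prems])
  have "partial i (\<lambda>x. L (w x)) = (\<lambda>x. L (partial i w x))" for i
    by (rule ext, subst partial_eqI[OF d]) (simp add: partial_def)
  then have "Ck k (partial i (\<lambda>x. L (w x)))" for i
    using Suc.IH[of "partial i w"] Suc.prems by simp
  moreover have "(\<lambda>x. L (w x)) differentiable (at x)" for x
    using d by (rule differentiableI)
  ultimately show ?case by simp
qed

lemma partial_comp_bounded_linear:
  assumes "bounded_linear (L :: complex \<Rightarrow> complex)" "w differentiable (at x)"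
  shows "partial i (\<lambda>x. L (w x)) x = L (partial i w x)"
  using bounded_linear.has_derivative[OF assms(1) assms(2)[unfolded frechet_derivative_works]]
  by (subst partial_eqI) (auto simp: partial_def)

lemma smooth_Ck: "smooth w \<Longrightarrow> Ck k w"
  by (simp add: smooth_def)

lemma smooth_partial: "smooth w \<Longrightarrow> smooth (partial i w)"
  unfolding smooth_def using Ck.simps(2) by blast

lemma smooth_differentiable: "smooth w \<Longrightarrow> w differentiable (at x)"
  using smooth_Ck[of w "Suc 0"] by simp

lemma smooth_const: "smooth (\<lambda>x. c)" by (simp add: smooth_def Ck_const)
lemma smooth_add: "smooth u \<Longrightarrow> smooth v \<Longrightarrow> smooth (\<lambda>x. u x + v x)" by (simp add: smooth_def Ck_add)
lemma smooth_mult: "smooth u \<Longrightarrow> smooth v \<Longrightarrow> smooth (\<lambda>x. u x * v x)" by (simp add: smooth_def Ck_mult)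
lemma smooth_bounded_linear: "bounded_linear L \<Longrightarrow> smooth L" by (simp add: smooth_def Ck_bounded_linear)
lemma smooth_comp_bounded_linear: "bounded_linear (L :: complex \<Rightarrow> complex) \<Longrightarrow> smooth w \<Longrightarrow> smooth (\<lambda>x. L (w x))"
  by (simp add: smooth_def Ck_comp_bounded_linear)
lemma smooth_cnj: "smooth w \<Longrightarrow> smooth (\<lambda>x. cnj (w x))"
  by (rule smooth_comp_bounded_linear) (rule bounded_linear_cnj)
lemma smooth_coordinate: "smooth (\<lambda>x. of_real (x $ i))"
  by (rule smooth_bounded_linear)
     (rule bounded_linear_compose[OF bounded_linear_of_real bounded_linear_vec_nth])

lemma smooth_power: "smooth u \<Longrightarrow> smooth (\<lambda>x. u x ^ n)"
  by (induction n) (auto intro: smooth_const smooth_mult)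

lemma smooth_sum: "(\<And>j. j \<in> J \<Longrightarrow> smooth (u j)) \<Longrightarrow> smooth (\<lambda>x. \<Sum>j\<in>J. u j x)"
  by (induction J rule: infinite_finite_induct) (auto intro: smooth_const smooth_add)

lemma smooth_diff:
  assumes "smooth u" "smooth v" shows "smooth (\<lambda>x. u x - v x)"
  using smooth_add[OF assms(1) smooth_mult[OF smooth_const[of "-1"] assms(2)]] by simp

section \<open>Bump functions\<close>

text \<open>
  The functions \<open>p(1/t) e\<^sup>-\<^sup>1\<^sup>/\<^sup>t\<close>, extended by zero, form a family closed under differentiation; this is
  why \<open>e\<^sup>-\<^sup>1\<^sup>/\<^sup>t\<close> extends smoothly by zero.
\<close>

definition flat_exp :: "real poly \<Rightarrow> real \<Rightarrow> real" where
  "flat_exp p t = (if t \<le> 0 then 0 else poly p (1 / t) * exp (- 1 / t))"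

lemma poly_exp_tendsto_0: "((\<lambda>s. poly p s * exp (- s)) \<longlongrightarrow> 0) (at_top :: real filter)"
proof -
  have "((\<lambda>s. \<Sum>i\<le>degree p. coeff p i * (s ^ i / exp s)) \<longlongrightarrow> (\<Sum>i\<le>degree p. coeff p i * 0)) (at_top :: real filter)"
    by (intro tendsto_intros tendsto_power_div_exp_0)
  moreover have "(\<Sum>i\<le>degree p. coeff p i * (s ^ i / exp s)) = poly p s * exp (- s)" for s :: real
    by (simp add: poly_altdef exp_minus sum_distrib_right divide_inverse mult.assoc)
  ultimately show ?thesis by simp
qed

lemma flat_exp_tendsto_0: "(flat_exp p \<longlongrightarrow> 0) (at 0)"
proof (rule filterlim_split_at)
  show "(flat_exp p \<longlongrightarrow> 0) (at_left 0)"
    by (rule tendsto_eventually) (auto simp: flat_exp_def eventually_at_filter)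
  have "((\<lambda>t. poly p (inverse t) * exp (- inverse t)) \<longlongrightarrow> 0) (at_right 0)"
    by (rule filterlim_compose[OF poly_exp_tendsto_0 filterlim_inverse_at_top_right])
  then show "(flat_exp p \<longlongrightarrow> 0) (at_right 0)"
    by (rule Lim_transform_eventually)
       (auto simp: flat_exp_def eventually_at_filter inverse_eq_divide)
qed

lemma flat_exp_has_derivative:
  "(flat_exp p has_real_derivative flat_exp ([:0, 0, 1:] * (p - pderiv p)) t) (at t)"
proof -
  consider "t < 0" | "t > 0" | "t = 0" by linarith
  then show ?thesis
  proof cases
    case 1
    have "((\<lambda>_. 0) has_real_derivative flat_exp ([:0, 0, 1:] * (p - pderiv p)) t) (at t)"
      using 1 by (simp add: flat_exp_def)
    then show ?thesis
      by (rule has_field_derivative_transform_within[where d="-t"])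
         (use 1 in \<open>auto simp: flat_exp_def dist_real_def\<close>)
  next
    case 2
    have "((\<lambda>t. poly p (1 / t) * exp (- 1 / t)) has_real_derivative flat_exp ([:0, 0, 1:] * (p - pderiv p)) t) (at t)"
    proof -
      have "((\<lambda>t. poly p (1 / t)) has_real_derivative poly (pderiv p) (1 / t) * (- 1 / t\<^sup>2)) (at t)"
        by (rule DERIV_chain'[OF _ poly_DERIV]) (use 2 in \<open>auto intro!: derivative_eq_intros simp: power2_eq_square\<close>)
      moreover have "((\<lambda>t. exp (- 1 / t)) has_real_derivative exp (- 1 / t) * (1 / t\<^sup>2)) (at t)"
        by (rule derivative_eq_intros refl)+ (use 2 in \<open>auto simp: power2_eq_square\<close>)
      ultimately show ?thesis
        by (rule DERIV_mult[THEN DERIV_cong])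
           (use 2 in \<open>simp add: flat_exp_def field_simps power2_eq_square\<close>)
    qed
    then show ?thesis
      by (rule has_field_derivative_transform_within[where d="t"])
         (use 2 in \<open>auto simp: flat_exp_def dist_real_def\<close>)
  next
    case 3
    \<comment> \<open>At the origin the difference quotient is itself a member of the family.\<close>
    have "(flat_exp ([:0, 1:] * p) \<longlongrightarrow> 0) (at 0)" by (rule flat_exp_tendsto_0)
    moreover have "flat_exp ([:0, 1:] * p) h = (flat_exp p (0 + h) - flat_exp p 0) / h" if "h \<noteq> 0" for h
      using that by (auto simp: flat_exp_def)
    ultimately have "((\<lambda>h. (flat_exp p (0 + h) - flat_exp p 0) / h) \<longlongrightarrow> 0) (at 0)"
      using Lim_transform_eventually[of "flat_exp ([:0, 1:] * p)" 0 "at 0" "\<lambda>h. (flat_exp p (0 + h) - flat_exp p 0) / h"]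
      by (simp add: eventually_at_filter)
    then show ?thesis using 3 by (simp add: DERIV_def flat_exp_def)
  qed
qed

lemma Ck_flat_exp:
  assumes "smooth (\<lambda>x. complex_of_real (q x))"
  shows "Ck k (\<lambda>x. complex_of_real (flat_exp p (q x)))"
proof (induction k arbitrary: p)
  case 0
  have "continuous_on UNIV (\<lambda>x. complex_of_real (q x))"
    using smooth_Ck[OF assms, of 0] by simp
  then have "continuous_on UNIV (\<lambda>x. Re (complex_of_real (q x)))" by (rule continuous_on_Re)
  moreover have "continuous_on UNIV (flat_exp p)"
    by (rule continuous_at_imp_continuous_on) (blast intro: DERIV_isCont flat_exp_has_derivative)
  ultimately have "continuous_on UNIV (\<lambda>x. flat_exp p (q x))"
    using continuous_on_compose2[of UNIV "flat_exp p" UNIV q] by simp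
  then show ?case by (simp add: continuous_on_of_real)
next
  case (Suc k)
  let ?p = "[:0, 0, 1:] * (p - pderiv p)" and ?q = "\<lambda>x. complex_of_real (q x)"
  have d: "((\<lambda>x. complex_of_real (flat_exp p (q x))) has_derivative
      (\<lambda>h. of_real (flat_exp ?p (q x)) * frechet_derivative ?q (at x) h)) (at x)" for x
  proof -
    have dq: "(?q has_derivative frechet_derivative ?q (at x)) (at x)"
      using smooth_differentiable[OF assms] by (simp add: frechet_derivative_works)
    have dr: "(q has_derivative (\<lambda>h. Re (frechet_derivative ?q (at x) h))) (at x)"
      using has_derivative_Re[OF dq] by simp
    have eq: "frechet_derivative ?q (at x) h = of_real (Re (frechet_derivative ?q (at x) h))" for h
      using has_derivative_unique[OF dq has_derivative_of_real[OF dr]] by metis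
    have "((\<lambda>x. flat_exp p (q x)) has_derivative (\<lambda>h. Re (frechet_derivative ?q (at x) h) * flat_exp ?p (q x))) (at x)"
      using has_derivative_compose[OF dr flat_exp_has_derivative[of p "q x", unfolded has_field_derivative_def]]
      by (simp add: mult.commute)
    from has_derivative_of_real[OF this] show ?thesis
      by (subst eq) (simp add: mult.commute)
  qed
  have "partial i (\<lambda>x. complex_of_real (flat_exp p (q x))) = (\<lambda>x. of_real (flat_exp ?p (q x)) * partial i ?q x)" for i
    by (rule ext, subst partial_eqI[OF d]) (simp add: partial_def)
  then have "Ck k (partial i (\<lambda>x. complex_of_real (flat_exp p (q x))))" for i
    using Ck_mult[OF Suc.IH[of ?p] smooth_Ck[OF smooth_partial[OF assms]]] by simp
  moreover have "(\<lambda>x. complex_of_real (flat_exp p (q x))) differentiable (at x)" for x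
    using d by (rule differentiableI)
  ultimately show ?case by simp
qed

section \<open>Integration by parts and weak gradients\<close>

lemma disc_eq: "disc = {x. norm x < 1}"
  by (auto simp: disc_def)

lemma disc_lmeasurable [simp]: "disc \<in> lmeasurable"
  by (simp add: disc_def)

lemma disc_sets [simp]: "disc \<in> sets borel" "disc \<in> sets lebesgue" "disc \<in> sets lborel"
  by (auto simp: disc_def)

lemma continuous_imp_measurable_disc:
  "continuous_on UNIV f \<Longrightarrow> f \<in> borel_measurable (lebesgue_on disc)"
  by (rule continuous_imp_measurable_on_sets_lebesgue) (auto intro: continuous_on_subset)

lemma continuous_imp_bounded_disc:
  fixes f :: "plane \<Rightarrow> 'b::euclidean_space"
  assumes "continuous_on UNIV f"
  obtains B where "0 < B" "\<And>x. x \<in> cball 0 1 \<Longrightarrow> norm (f x) \<le> B"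
proof -
  have "compact (f ` cball 0 1)"
    by (rule compact_continuous_image) (use assms in \<open>auto intro: continuous_on_subset\<close>)
  then show ?thesis using that compact_imp_bounded[of "f ` cball 0 1"] by (auto simp: bounded_pos)
qed

lemma disc_subset_cball: "x \<in> disc \<Longrightarrow> x \<in> cball 0 1"
  by (auto simp: disc_def)

lemma continuous_imp_L2_on_disc:
  fixes f :: "plane \<Rightarrow> 'b::euclidean_space"
  assumes "continuous_on UNIV f"
  shows "f \<in> L2_on disc"
proof -
  obtain B where B: "0 < B" "\<And>x. x \<in> cball 0 1 \<Longrightarrow> norm (f x) \<le> B"
    using continuous_imp_bounded_disc[OF assms] by blast
  then show ?thesis
    by (intro bounded_imp_L2_on[where B=B] continuous_imp_measurable_disc assms disc_lmeasurable)
       (use disc_subset_cball in auto)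
qed

lemma L2_on_disc_integrable:
  fixes f :: "plane \<Rightarrow> complex"
  assumes "f \<in> L2_on disc" "continuous_on UNIV w"
  shows "integrable (lebesgue_on disc) (\<lambda>x. f x * w x)"
  by (rule Bochner_Integration.integrable_bound[OF L2_on_Cauchy_Schwarz(1)[OF assms(1) continuous_imp_L2_on_disc[OF assms(2)]]])
     (use L2_onD(1)[OF assms(1)] continuous_imp_measurable_disc[OF assms(2)] in \<open>auto simp: norm_mult\<close>)

lemma integral_lebesgue_on_disc_eq_lborel:
  fixes f :: "plane \<Rightarrow> complex"
  assumes "f \<in> borel_measurable borel" "\<And>x. x \<notin> disc \<Longrightarrow> f x = 0"
  shows "(LINT x|lebesgue_on disc. f x) = (LINT x|lborel. f x)"
proof -
  have "(LINT x|lebesgue_on disc. f x) = (LINT x|lebesgue. indicator disc x *\<^sub>R f x)"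
    by (rule integral_restrict_space) simp
  also have "\<dots> = (LINT x|lebesgue. f x)"
    by (rule Bochner_Integration.integral_cong) (auto simp: indicator_def assms(2))
  also have "\<dots> = (LINT x|lborel. f x)"
    by (rule integral_completion) (use assms(1) in simp)
  finally show ?thesis .
qed

lemma compact_support_derivative:
  fixes F :: "plane \<Rightarrow> complex"
  assumes "compact C" "\<And>x. x \<notin> C \<Longrightarrow> F x = 0" "x \<notin> C"
  shows "partial i F x = 0"
proof -
  have "((\<lambda>_. 0 :: complex) has_derivative (\<lambda>_. 0)) (at x)" by simp
  moreover have "open (- C)" using assms(1) by (simp add: compact_imp_closed open_Compl)
  ultimately have "(F has_derivative (\<lambda>_. 0)) (at x)"
    by (rule has_derivative_transform_within_open[where s="- C"]) (use assms in auto)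
  then show ?thesis by (rule partial_eqI[THEN trans]) simp
qed

lemma integrable_compact_support:
  fixes F :: "plane \<Rightarrow> complex"
  assumes "continuous_on UNIV F" "compact C" "\<And>x. x \<notin> C \<Longrightarrow> F x = 0"
  shows "integrable lborel F"
proof -
  have "integrable lborel (\<lambda>x. indicator C x *\<^sub>R F x)"
    by (rule borel_integrable_compact[OF assms(2)]) (use assms(1) in \<open>auto intro: continuous_on_subset\<close>)
  moreover have "(\<lambda>x. indicator C x *\<^sub>R F x) = F" using assms(3) by (auto simp: indicator_def)
  ultimately show ?thesis by simp
qed

lemma continuous_compact_support_bounded:
  fixes F :: "plane \<Rightarrow> complex"
  assumes "continuous_on UNIV F" "compact C" "\<And>x. x \<notin> C \<Longrightarrow> F x = 0"
  obtains B where "0 < B" "\<And>x. norm (F x) \<le> B"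
proof -
  have "compact (F ` C)"
    by (rule compact_continuous_image) (use assms in \<open>auto intro: continuous_on_subset\<close>)
  then obtain B where "0 < B" "\<And>x. x \<in> C \<Longrightarrow> norm (F x) \<le> B"
    using compact_imp_bounded[of "F ` C"] by (auto simp: bounded_pos)
  then show ?thesis using that assms(3) by (metis norm_zero less_imp_le)
qed

lemma has_vector_derivative_along_axis:
  assumes "F differentiable (at (x + t *\<^sub>R axis i 1))"
  shows "((\<lambda>t. F (x + t *\<^sub>R axis i 1)) has_vector_derivative partial i F (x + t *\<^sub>R axis i 1)) (at t)"
proof -
  let ?D = "frechet_derivative F (at (x + t *\<^sub>R axis i 1))"
  have D: "(F has_derivative ?D) (at (x + t *\<^sub>R axis i 1))"
    using assms by (simp add: frechet_derivative_works)
  have "((\<lambda>t. x + t *\<^sub>R axis i (1::real)) has_derivative (\<lambda>h. h *\<^sub>R axis i 1)) (at t)"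
    by (auto intro!: derivative_eq_intros)
  from has_derivative_compose[OF this D]
  have "((\<lambda>t. F (x + t *\<^sub>R axis i 1)) has_derivative (\<lambda>h. ?D (h *\<^sub>R axis i 1))) (at t)" .
  moreover have "?D (h *\<^sub>R axis i 1) = h *\<^sub>R partial i F (x + t *\<^sub>R axis i 1)" for h
    using linear_scale[OF has_derivative_linear[OF D]] by (simp add: partial_def)
  ultimately show ?thesis by (simp add: has_vector_derivative_def)
qed

text \<open>
  The integral of a partial derivative is the limit of integrals of difference quotients, and these
  vanish because Lebesgue measure is translation invariant.
\<close>

lemma integral_partial_eq_0:
  fixes F :: "plane \<Rightarrow> complex"
  assumes F: "Ck (Suc 0) F" and C: "compact C" "\<And>x. x \<notin> C \<Longrightarrow> F x = 0"
  shows "(LINT x|lborel. partial i F x) = 0"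
proof -
  let ?e = "axis i 1 :: plane"
  have diff: "F differentiable (at x)" for x using F by simp
  have contF: "continuous_on UNIV F" using Ck_continuous[OF F] .
  have contP: "continuous_on UNIV (partial i F)" using F by simp
  have P0: "partial i F x = 0" if "x \<notin> C" for x
    using compact_support_derivative[OF C that] .
  obtain B where B: "0 < B" "\<And>x. norm (partial i F x) \<le> B"
    using continuous_compact_support_bounded[OF contP C(1) P0] by blast
  obtain R where R: "C \<subseteq> cball 0 R"
    using compact_imp_bounded[OF C(1)] by (auto simp: bounded_iff subset_iff)
  have intF: "integrable lborel F" by (rule integrable_compact_support[OF contF C])
  have measF[measurable]: "F \<in> borel_measurable borel" using borel_measurable_continuous_onI[OF contF] .
  have measP[measurable]: "partial i F \<in> borel_measurable borel" using borel_measurable_continuous_onI[OF contP] .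
  \<comment> \<open>difference quotients with step \<open>1/(n+1)\<close>\<close>
  define q where "q n x = real (Suc n) *\<^sub>R (F (inverse (real (Suc n)) *\<^sub>R ?e + x) - F x)" for n x
  have q_meas: "q n \<in> borel_measurable borel" for n unfolding q_def by measurable
  have shift: "integrable lborel (\<lambda>x. F (a + x))" "(LINT x|lborel. F (a + x)) = (LINT x|lborel. F x)" for a
  proof -
    show "integrable lborel (\<lambda>x. F (a + x))"
      using integrable_distr_eq[of "(+) a" lborel borel F] intF by (simp add: lborel_distr_plus)
    show "(LINT x|lborel. F (a + x)) = (LINT x|lborel. F x)"
      using integral_distr[of "(+) a" lborel borel F] by (simp add: lborel_distr_plus)
  qed
  have q_int: "(LINT x|lborel. q n x) = 0" for n
    unfolding q_def using shift intF by simp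
  have q_bound: "norm (q n x) \<le> B * indicator (cball 0 (R + 1)) x" for n x
  proof -
    let ?h = "inverse (real (Suc n))"
    have h: "0 < ?h" "?h \<le> 1" by (auto simp: inverse_le_1_iff)
    show ?thesis
    proof (cases "x \<in> cball 0 (R + 1)")
      case True
      have "\<exists>t\<in>{0<..<?h}. norm (F (x + ?h *\<^sub>R ?e) - F (x + 0 *\<^sub>R ?e)) \<le> norm ((?h - 0) *\<^sub>R partial i F (x + t *\<^sub>R ?e))"
      proof (rule mvt_general[OF h(1)])
        have "continuous_on UNIV (\<lambda>t. F (x + t *\<^sub>R ?e))"
          by (rule continuous_on_compose2[OF contF]) (auto intro!: continuous_intros)
        then show "continuous_on {0..?h} (\<lambda>t. F (x + t *\<^sub>R ?e))" by (rule continuous_on_subset) simp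
        show "((\<lambda>t. F (x + t *\<^sub>R ?e)) has_derivative (\<lambda>s. s *\<^sub>R partial i F (x + t *\<^sub>R ?e))) (at t)" for t
          using has_vector_derivative_along_axis[OF diff] by (simp add: has_vector_derivative_def)
      qed
      then obtain t where "norm (F (x + ?h *\<^sub>R ?e) - F x) \<le> norm (?h *\<^sub>R partial i F (x + t *\<^sub>R ?e))"
        by auto
      also have "\<dots> \<le> ?h * B" using B(2) h(1) by (simp add: mult_left_mono)
      finally have "real (Suc n) * norm (F (x + ?h *\<^sub>R ?e) - F x) \<le> real (Suc n) * (?h * B)"
        by (rule mult_left_mono) simp
      also have "\<dots> = B" by simp
      finally show ?thesis using True by (simp add: q_def add.commute)
    next
      case False
      then have "R + 1 < norm x" by simp
      moreover have "norm x \<le> norm (?h *\<^sub>R ?e + x) + norm (?h *\<^sub>R ?e)"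
        by (metis add_diff_cancel_left' norm_triangle_sub norm_triangle_ineq4 add.commute)
      moreover have "norm (?h *\<^sub>R ?e) \<le> 1" using h by (simp add: norm_axis_1)
      ultimately have "R < norm (?h *\<^sub>R ?e + x)" "R < norm x" by linarith+
      then have "x \<notin> C" "?h *\<^sub>R ?e + x \<notin> C" using R by auto
      then have "q n x = 0" using C(2) by (simp add: q_def)
      then show ?thesis using B(1) by simp
    qed
  qed
  have q_lim: "(\<lambda>n. q n x) \<longlonglongrightarrow> partial i F x" for x
  proof -
    have "((\<lambda>t. F (x + t *\<^sub>R ?e)) has_vector_derivative partial i F x) (at 0)"
      using has_vector_derivative_along_axis[of F x 0 i] diff by simp
    then have "((\<lambda>t. norm (F (x + t *\<^sub>R ?e) - F x - t *\<^sub>R partial i F x) / norm t) \<longlongrightarrow> 0) (at 0)"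
      by (simp add: has_vector_derivative_def has_derivative_at)
    moreover have "filterlim (\<lambda>n. inverse (real (Suc n))) (at 0) sequentially"
      using LIMSEQ_inverse_real_of_nat by (simp add: filterlim_at)
    ultimately have "(\<lambda>n. norm (F (x + inverse (real (Suc n)) *\<^sub>R ?e) - F x - inverse (real (Suc n)) *\<^sub>R partial i F x)
        / norm (inverse (real (Suc n)))) \<longlonglongrightarrow> 0"
      by (rule filterlim_compose)
    moreover have "norm (F (x + inverse (real (Suc n)) *\<^sub>R ?e) - F x - inverse (real (Suc n)) *\<^sub>R partial i F x)
        / norm (inverse (real (Suc n))) = norm (q n x - partial i F x)" for n
    proof -
      have "q n x - partial i F x = real (Suc n) *\<^sub>R
          (F (x + inverse (real (Suc n)) *\<^sub>R ?e) - F x - inverse (real (Suc n)) *\<^sub>R partial i F x)"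
        by (simp add: q_def scaleR_diff_right add.commute)
      then have "norm (q n x - partial i F x) = \<bar>real (Suc n)\<bar> *
          norm (F (x + inverse (real (Suc n)) *\<^sub>R ?e) - F x - inverse (real (Suc n)) *\<^sub>R partial i F x)"
        by (simp only: norm_scaleR)
      moreover have "norm (inverse (real (Suc n))) = inverse \<bar>real (Suc n)\<bar>" by simp
      ultimately show ?thesis by (simp only: divide_inverse inverse_inverse_eq mult.commute)
    qed
    ultimately have "(\<lambda>n. norm (q n x - partial i F x)) \<longlonglongrightarrow> 0" by simp
    then show ?thesis using LIM_zero_cancel tendsto_norm_zero_iff by blast
  qed
  have "(\<lambda>n. LINT x|lborel. q n x) \<longlonglongrightarrow> (LINT x|lborel. partial i F x)"
  proof (rule integral_dominated_convergence[where w="\<lambda>x. B * indicator (cball 0 (R + 1)) x"])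
    have "emeasure lborel (cball 0 (R + 1) :: plane set) < \<infinity>"
      by (rule emeasure_compact_finite) simp
    then show "integrable lborel (\<lambda>x::plane. B * indicator (cball 0 (R + 1)) x)"
      by (intro integrable_mult_right integrable_real_indicator) auto
  qed (use q_meas measP q_lim q_bound in auto)
  then show ?thesis by (simp add: q_int LIMSEQ_const_iff)
qed

definition classical_grad :: "(plane \<Rightarrow> complex) \<Rightarrow> plane \<Rightarrow> complex ^ 2" where
  "classical_grad u x = (\<chi> i. partial i u x)"

lemma classical_grad_nth [simp]: "classical_grad u x $ i = partial i u x"
  by (simp add: classical_grad_def)

lemma continuous_on_classical_grad: "Ck (Suc 0) u \<Longrightarrow> continuous_on UNIV (classical_grad u)"
  unfolding classical_grad_def by (intro continuous_on_vec_lambda) simp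

lemma test_functionD:
  assumes "w \<in> test_functions \<Omega>"
  shows "smooth w" "Ck k w" "w differentiable (at x)" "continuous_on UNIV w" "continuous_on UNIV (partial i w)"
  using assms smooth_Ck[of w] smooth_differentiable[of w] Ck_continuous smooth_Ck[OF smooth_partial[of w i], of 0]
  by (auto simp: test_functions_def) 

lemma test_functionE:
  assumes "w \<in> test_functions \<Omega>"
  obtains C where "compact C" "C \<subseteq> \<Omega>" "\<And>x. x \<notin> C \<Longrightarrow> w x = 0" "\<And>x i. x \<notin> C \<Longrightarrow> partial i w x = 0"
  using assms compact_support_derivative unfolding test_functions_def by blast

lemma test_function_cnj: "w \<in> test_functions \<Omega> \<Longrightarrow> (\<lambda>x. cnj (w x)) \<in> test_functions \<Omega>"
  unfolding test_functions_def by (auto intro: smooth_cnj)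

lemma weak_gradient_classical_grad:
  assumes u: "Ck (Suc 0) u"
  shows "weak_gradient disc u (classical_grad u)"
  unfolding weak_gradient_def
proof (intro conjI ballI allI)
  show "classical_grad u \<in> L2_on disc"
    by (rule continuous_imp_L2_on_disc[OF continuous_on_classical_grad[OF u]])
  fix w i assume w: "w \<in> test_functions disc"
  obtain C where C: "compact C" "C \<subseteq> disc" "\<And>x. x \<notin> C \<Longrightarrow> w x = 0" "\<And>x i. x \<notin> C \<Longrightarrow> partial i w x = 0"
    using test_functionE[OF w] by blast
  have cu: "continuous_on UNIV u" "continuous_on UNIV (partial i u)"
    using Ck_continuous[OF u] u by auto
  note cw = test_functionD(4)[OF w] test_functionD(5)[OF w, of i]
  have c1: "continuous_on UNIV (\<lambda>x. u x * partial i w x)" and c2: "continuous_on UNIV (\<lambda>x. partial i u x * w x)"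
    using cu cw by (auto intro: continuous_on_mult)
  have off: "x \<notin> disc \<Longrightarrow> w x = 0 \<and> partial i w x = 0" for x using C by auto
  have "(LINT x|lborel. partial i (\<lambda>x. u x * w x) x) = 0"
    by (rule integral_partial_eq_0[OF Ck_mult[OF u test_functionD(2)[OF w]] C(1)]) (simp add: C(3))
  moreover have "partial i (\<lambda>x. u x * w x) = (\<lambda>x. u x * partial i w x + partial i u x * w x)"
    by (rule ext, rule partial_mult) (use u test_functionD(3)[OF w] in auto)
  moreover have "integrable lborel (\<lambda>x. u x * partial i w x)" "integrable lborel (\<lambda>x. partial i u x * w x)"
    using integrable_compact_support[OF c1 C(1)] integrable_compact_support[OF c2 C(1)] C by auto
  ultimately have "(LINT x|lborel. u x * partial i w x) = - (LINT x|lborel. partial i u x * w x)"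
    by (simp add: eq_neg_iff_add_eq_0)
  moreover have "(LINT x|lebesgue_on disc. u x * partial i w x) = (LINT x|lborel. u x * partial i w x)"
    by (rule integral_lebesgue_on_disc_eq_lborel) (use c1 off borel_measurable_continuous_onI in auto)
  moreover have "(LINT x|lebesgue_on disc. partial i u x * w x) = (LINT x|lborel. partial i u x * w x)"
    by (rule integral_lebesgue_on_disc_eq_lborel) (use c2 off borel_measurable_continuous_onI in auto)
  ultimately show "(LINT x|lebesgue_on disc. u x * partial i w x) = - (LINT x|lebesgue_on disc. classical_grad u x $ i * w x)"
    by simp
qed

section \<open>Uniqueness of weak gradients\<close>

lemma smooth_prod: "(\<And>j. j \<in> J \<Longrightarrow> smooth (u j)) \<Longrightarrow> smooth (\<lambda>x. \<Prod>j\<in>J. u j x)"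
  by (induction J rule: infinite_finite_induct) (auto intro: smooth_const smooth_mult)

lemma flat_exp_1_bounds: "0 \<le> flat_exp 1 t" "flat_exp 1 t \<le> 1"
  by (auto simp: flat_exp_def)

lemma flat_exp_1_tendsto:
  assumes "t > 0" shows "(\<lambda>n. flat_exp 1 (real n * t - c)) \<longlonglongrightarrow> 1"
proof -
  have "((\<lambda>s. exp (- inverse s)) \<longlongrightarrow> exp (- 0)) (at_top :: real filter)"
    by (intro tendsto_intros tendsto_inverse_0_at_top filterlim_ident)
  then have "(flat_exp 1 \<longlongrightarrow> 1) at_top"
    using Lim_transform_eventually[of "\<lambda>s. exp (- inverse s)" "exp (- 0)" at_top "flat_exp 1"]
      eventually_mono[OF eventually_gt_at_top[of "0::real"], of "\<lambda>s. exp (- inverse s) = flat_exp 1 s"]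
    by (simp add: flat_exp_def inverse_eq_divide)
  moreover have "filterlim (\<lambda>n. real n * t - c) at_top sequentially"
    using filterlim_tendsto_add_at_top[OF tendsto_const[of "- c"]
        filterlim_at_top_mult_tendsto_pos[OF tendsto_const[of t] assms filterlim_real_sequentially]]
    by (simp add: add.commute mult.commute)
  ultimately show ?thesis by (rule filterlim_compose)
qed

text \<open>
  Test functions that converge to the indicator function of a box on the disc.  The last factor vanishes
  for \<open>\<bar>x\<bar>\<^sup>2 \<ge> 1 - 1/n\<close>, which keeps the support compact in the disc.
\<close>

definition box_bump :: "plane \<Rightarrow> plane \<Rightarrow> nat \<Rightarrow> plane \<Rightarrow> real" where
  "box_bump a b n x =
     (\<Prod>j\<in>UNIV. flat_exp 1 (real n * (x $ j - a $ j)) * flat_exp 1 (real n * (b $ j - x $ j)))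
       * flat_exp 1 (real n * (1 - (norm x)\<^sup>2) - 1)"

lemma norm_plane_power2: "(norm (x :: real ^ 2))\<^sup>2 = (x $ 1)\<^sup>2 + (x $ 2)\<^sup>2"
  by (simp add: power2_norm_eq_inner inner_vec_def sum_2 flip: power2_eq_square)

lemma smooth_flat_exp: "smooth (\<lambda>x. complex_of_real (q x)) \<Longrightarrow> smooth (\<lambda>x. complex_of_real (flat_exp p (q x)))"
  by (simp add: smooth_def[of "\<lambda>x. complex_of_real (flat_exp p (q x))"] Ck_flat_exp)

lemma smooth_norm_power2: "smooth (\<lambda>x. complex_of_real ((norm x)\<^sup>2))"
  unfolding norm_plane_power2 of_real_add of_real_power
  by (intro smooth_add smooth_power smooth_coordinate)

lemma box_bump_test_function: "(\<lambda>x. complex_of_real (box_bump a b n x)) \<in> test_functions disc"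
proof -
  have "smooth (\<lambda>x. complex_of_real (box_bump a b n x))"
    unfolding box_bump_def of_real_mult of_real_prod
  proof (intro smooth_mult smooth_prod smooth_flat_exp)
    show "smooth (\<lambda>x. complex_of_real (real n * (x $ j - a $ j)))" for j
      unfolding of_real_mult of_real_diff by (intro smooth_mult smooth_diff smooth_const smooth_coordinate)
    show "smooth (\<lambda>x. complex_of_real (real n * (b $ j - x $ j)))" for j
      unfolding of_real_mult of_real_diff by (intro smooth_mult smooth_diff smooth_const smooth_coordinate)
    show "smooth (\<lambda>x. complex_of_real (real n * (1 - (norm x)\<^sup>2) - 1))"
      unfolding of_real_mult of_real_diff using smooth_norm_power2 by (intro smooth_mult smooth_diff smooth_const)
  qed
  moreover define C :: "plane set" where "C = cball 0 1 \<inter> {x. real n * (1 - (norm x)\<^sup>2) \<ge> 1}"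
  have "closed {x :: plane. real n * (1 - (norm x)\<^sup>2) \<ge> 1}"
    by (intro closed_Collect_le continuous_intros)
  then have "compact C" unfolding C_def by (intro compact_Int_closed) auto
  moreover have "C \<subseteq> disc"
  proof
    fix x assume "x \<in> C"
    then have "norm x \<le> 1" "real n * (1 - (norm x)\<^sup>2) \<ge> 1" by (auto simp: C_def)
    then have "norm x \<noteq> 1" "norm x \<le> 1" by auto
    then show "x \<in> disc" by (simp add: disc_eq)
  qed
  moreover have "box_bump a b n x = 0" if "x \<notin> C" for x
  proof -
    have "real n * (1 - (norm x)\<^sup>2) \<le> 1"
    proof (rule ccontr)
      assume "\<not> ?thesis"
      then have h: "real n * (1 - (norm x)\<^sup>2) > 1" by simp
      then have "0 < real n * (1 - (norm x)\<^sup>2)" by linarith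
      then have "(norm x)\<^sup>2 < 1" by (simp add: zero_less_mult_iff)
      then have "norm x < 1" by (simp add: power_less_one_iff)
      with h that show False by (simp add: C_def)
    qed
    then show ?thesis by (simp add: box_bump_def flat_exp_def)
  qed
  ultimately show ?thesis unfolding test_functions_def by auto
qed

lemma box_bump_bounds: "0 \<le> box_bump a b n x" "box_bump a b n x \<le> 1"
  unfolding box_bump_def
  by (auto intro!: mult_nonneg_nonneg prod_nonneg mult_le_one prod_le_1 simp: flat_exp_1_bounds)

lemma box_bump_tendsto:
  assumes "x \<in> disc" shows "(\<lambda>n. box_bump a b n x) \<longlonglongrightarrow> indicator (box a b) x"
proof (cases "x \<in> box a b")
  case True
  have 1: "(\<lambda>n. flat_exp 1 (real n * (1 - (norm x)\<^sup>2) - 1)) \<longlonglongrightarrow> 1"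
    by (rule flat_exp_1_tendsto) (use assms in \<open>simp add: disc_eq power_less_one_iff\<close>)
  have 2: "(\<lambda>n. flat_exp 1 (real n * (x $ j - a $ j))) \<longlonglongrightarrow> 1" "(\<lambda>n. flat_exp 1 (real n * (b $ j - x $ j))) \<longlonglongrightarrow> 1" for j
    using flat_exp_1_tendsto[of _ 0] True by (auto simp: mem_box_cart)
  have "(\<lambda>n. box_bump a b n x) \<longlonglongrightarrow> (\<Prod>j\<in>(UNIV::2 set). 1 * 1) * 1"
    unfolding box_bump_def by (intro tendsto_intros 1 2)
  then show ?thesis using True by simp
next
  case False
  then obtain j where "\<not> (a $ j < x $ j \<and> x $ j < b $ j)" by (auto simp: mem_box_cart)
  then have "flat_exp 1 (real n * (x $ j - a $ j)) * flat_exp 1 (real n * (b $ j - x $ j)) = 0" for n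
    by (auto simp: flat_exp_def not_less mult_nonneg_nonpos)
  then have "(\<Prod>j\<in>UNIV. flat_exp 1 (real n * (x $ j - a $ j)) * flat_exp 1 (real n * (b $ j - x $ j))) = 0" for n
    by (intro prod_zero) auto
  then have "box_bump a b n x = 0" for n by (simp add: box_bump_def)
  then show ?thesis using False by simp
qed

text \<open>
  The fundamental lemma of the calculus of variations: testing with \<open>box_bump\<close> shows that the
  integrals over boxes vanish, and boxes form an intersection-stable generator of the Borel sets.
\<close>

lemma fundamental_lemma:
  fixes f :: "plane \<Rightarrow> complex"
  assumes f: "f \<in> L2_on disc"
    and test: "\<And>w. w \<in> test_functions disc \<Longrightarrow> (LINT x|lebesgue_on disc. f x * w x) = 0"
  shows "AE x in lebesgue_on disc. f x = 0"
proof -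
  interpret finite_measure "lebesgue_on disc" by (rule finite_measure_lebesgue_on) simp
  have fint: "integrable (lebesgue_on disc) f"
    using L2_on_disc_integrable[OF f, of "\<lambda>_. 1"] by simp
  define F where "F x = indicator disc x *\<^sub>R f x" for x
  have Fint: "integrable lebesgue F"
    unfolding F_def using fint integrable_restrict_space[of disc lebesgue f] by simp
  have F_restrict: "(LINT x:A|lebesgue. F x) = (LINT x|lebesgue_on disc. indicator A x *\<^sub>R f x)" for A
  proof -
    have "(LINT x|lebesgue_on disc. indicator A x *\<^sub>R f x) = (LINT x|lebesgue. indicator disc x *\<^sub>R (indicator A x *\<^sub>R f x))"
      by (rule integral_restrict_space) simp
    then show ?thesis by (simp add: set_lebesgue_integral_def F_def mult.commute)
  qed
  have box: "(LINT x:box a b|lebesgue. F x) = 0" for a b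
  proof -
    have "(\<lambda>n. LINT x|lebesgue_on disc. f x * complex_of_real (box_bump a b n x))
        \<longlonglongrightarrow> (LINT x|lebesgue_on disc. f x * complex_of_real (indicator (box a b) x))"
    proof (rule integral_dominated_convergence[where w="\<lambda>x. norm (f x)"])
      have "indicator (box a b) \<in> borel_measurable (lebesgue_on disc)"
        by (rule measurable_restrict_space1) (auto intro: borel_measurable_indicator)
      then show "(\<lambda>x. f x * complex_of_real (indicator (box a b) x)) \<in> borel_measurable (lebesgue_on disc)"
        using L2_onD(1)[OF f] by measurable
      show "(\<lambda>x. f x * complex_of_real (box_bump a b n x)) \<in> borel_measurable (lebesgue_on disc)" for n
        using L2_onD(1)[OF f] continuous_imp_measurable_disc[OF test_functionD(4)[OF box_bump_test_function]]
        by measurable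
      show "AE x in lebesgue_on disc. (\<lambda>n. f x * complex_of_real (box_bump a b n x)) \<longlonglongrightarrow> f x * complex_of_real (indicator (box a b) x)"
        by (rule AE_I2) (intro tendsto_intros box_bump_tendsto, simp)
      show "AE x in lebesgue_on disc. norm (f x * complex_of_real (box_bump a b n x)) \<le> norm (f x)" for n
        by (rule AE_I2) (use box_bump_bounds[of a b n] in \<open>simp add: norm_mult mult_left_le\<close>)
    qed (use fint in auto)
    then have "(LINT x|lebesgue_on disc. f x * complex_of_real (indicator (box a b) x)) = 0"
      using test[OF box_bump_test_function] by (simp add: LIMSEQ_const_iff)
    moreover have "(\<lambda>x. f x * complex_of_real (indicator (box a b) x)) = (\<lambda>x. indicator (box a b) x *\<^sub>R f x)"
      by (auto simp: indicator_def)
    ultimately show ?thesis by (simp add: F_restrict)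
  qed
  have set_int: "set_integrable lebesgue A F" if "A \<in> sets lebesgue" for A
    unfolding set_integrable_def using integrable_mult_indicator[OF that Fint] .
  have borel: "(LINT x:A|lebesgue. F x) = 0" if "A \<in> sets borel" for A
  proof -
    have sub: "sigma_sets UNIV (range (\<lambda>(a, b). box a b :: plane set)) = sets borel"
      unfolding borel_eq_box by simp
    have "Int_stable (range (\<lambda>(a, b). box a b :: plane set))"
      by (auto simp: Int_stable_def box_Int_box)
    moreover have "range (\<lambda>(a, b). box a b :: plane set) \<subseteq> Pow UNIV" by simp
    moreover have "A \<in> sigma_sets UNIV (range (\<lambda>(a, b). box a b :: plane set))"
      unfolding sub by (rule that)
    ultimately show ?thesis
    proof (induction rule: sigma_sets_induct_disjoint)
      case (basic A)
      then show ?case using box by auto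
    next
      case empty
      then show ?case by (simp add: set_lebesgue_integral_def)
    next
      case (compl A)
      have A: "A \<in> sets lebesgue" using compl(1) sub by auto
      have "disc \<subseteq> box (\<chi> i. - 1) (\<chi> i. 1)"
      proof
        fix x assume "x \<in> disc"
        then have "\<bar>x $ i\<bar> < 1" for i using component_le_norm_cart[of x i] by (simp add: disc_eq)
        then have "- 1 < x $ i \<and> x $ i < 1" for i by (simp add: abs_less_iff minus_less_iff)
        then show "x \<in> box (\<chi> i. - 1) (\<chi> i. 1)" by (simp add: mem_box_cart)
      qed
      then have "(LINT x:UNIV|lebesgue. F x) = (LINT x:box (\<chi> i. - 1) (\<chi> i. 1)|lebesgue. F x)"
        unfolding set_lebesgue_integral_def
        by (intro Bochner_Integration.integral_cong) (auto simp: F_def indicator_def)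
      also have "\<dots> = 0" by (rule box)
      finally have U: "(LINT x:UNIV|lebesgue. F x) = 0" .
      have "(LINT x:UNIV|lebesgue. F x) = (LINT x:A \<union> (UNIV - A)|lebesgue. F x)" by simp
      also have "\<dots> = (LINT x:A|lebesgue. F x) + (LINT x:UNIV - A|lebesgue. F x)"
        using A by (intro set_integral_Un set_int) auto
      finally show ?case using U compl by simp
    next
      case (union A)
      have A: "A i \<in> sets lebesgue" for i using union(2) sub by auto
      have "(LINT x:(\<Union>i. A i)|lebesgue. F x) = (\<Sum>i. LINT x:A i|lebesgue. F x)"
        by (rule lebesgue_integral_countable_add)
           (use A union(1) in \<open>auto simp: disjoint_family_on_def intro!: set_int\<close>)
      then show ?case using union by simp
    qed
  qed
  have leb: "(LINT x:A|lebesgue. F x) = 0" if A: "A \<in> sets lebesgue" for A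
  proof -
    obtain B N where BN: "B \<in> sets borel" "negligible N" "B \<union> N = A"
      using sets_lebesgue_almost_borel[OF A] .
    have "(LINT x:A|lebesgue. F x) = (LINT x:B|lebesgue. F x)"
      unfolding set_lebesgue_integral_def
    proof (rule integral_cong_AE)
      have "AE x in lebesgue. x \<notin> N"
        by (rule AE_not_in) (use BN(2) in \<open>simp add: negligible_iff_null_sets\<close>)
      then show "AE x in lebesgue. indicator A x *\<^sub>R F x = indicator B x *\<^sub>R F x"
        by eventually_elim (use BN(3) in \<open>auto simp: indicator_def\<close>)
      have "B \<in> sets lebesgue" using BN(1) by simp
      with A show "(\<lambda>x. indicator A x *\<^sub>R F x) \<in> borel_measurable lebesgue"
        "(\<lambda>x. indicator B x *\<^sub>R F x) \<in> borel_measurable lebesgue"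
        using set_int[unfolded set_integrable_def] by auto
    qed
    then show ?thesis using borel[OF BN(1)] by simp
  qed
  show ?thesis
  proof (rule density_zero[OF fint])
    fix A assume "A \<in> sets (lebesgue_on disc)"
    then have "A \<in> sets lebesgue" by (auto simp: sets_restrict_space)
    from leb[OF this] show "(LINT x:A|lebesgue_on disc. f x) = 0"
      unfolding F_restrict by (simp add: set_lebesgue_integral_def)
  qed
qed

lemma L2_on_component:
  fixes g :: "plane \<Rightarrow> complex ^ 2"
  assumes "g \<in> L2_on disc" shows "(\<lambda>x. g x $ i) \<in> L2_on disc"
proof (rule L2_on_mono(1)[OF assms])
  have "(\<lambda>y :: complex ^ 2. y $ i) \<in> borel_measurable borel"
    by (rule borel_measurable_continuous_onI) (intro continuous_intros)
  then show "(\<lambda>x. g x $ i) \<in> borel_measurable (lebesgue_on disc)"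
    using measurable_compose[OF L2_onD(1)[OF assms]] by blast
qed (rule Finite_Cartesian_Product.norm_nth_le)

lemma weak_gradientD:
  assumes "weak_gradient \<Omega> u g"
  shows "g \<in> L2_on \<Omega>"
    and "w \<in> test_functions \<Omega> \<Longrightarrow>
      (LINT x|lebesgue_on \<Omega>. u x * partial i w x) = - (LINT x|lebesgue_on \<Omega>. g x $ i * w x)"
  using assms unfolding weak_gradient_def by blast+

text \<open>
  This removes the choice from \<open>grad\<close>: any weak gradient that can be exhibited agrees with it almost
  everywhere.
\<close>

lemma weak_gradient_unique:
  assumes g: "weak_gradient disc u g" and h: "weak_gradient disc u h"
  shows "AE x in lebesgue_on disc. g x = h x"
proof -
  have L2: "(\<lambda>x. g x $ i) \<in> L2_on disc" "(\<lambda>x. h x $ i) \<in> L2_on disc" for i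
    using weak_gradientD(1)[OF g] weak_gradientD(1)[OF h] by (auto intro: L2_on_component)
  have "AE x in lebesgue_on disc. g x $ i - h x $ i = 0" for i
  proof (rule fundamental_lemma)
    show "(\<lambda>x. g x $ i - h x $ i) \<in> L2_on disc" by (rule L2_on_diff[OF L2])
    fix w assume w: "w \<in> test_functions disc"
    have int: "integrable (lebesgue_on disc) (\<lambda>x. g x $ i * w x)" "integrable (lebesgue_on disc) (\<lambda>x. h x $ i * w x)"
      by (rule L2_on_disc_integrable[OF L2(1) test_functionD(4)[OF w]],
          rule L2_on_disc_integrable[OF L2(2) test_functionD(4)[OF w]])
    have "- (LINT x|lebesgue_on disc. g x $ i * w x) = - (LINT x|lebesgue_on disc. h x $ i * w x)"
      using weak_gradientD(2)[OF g w, of i] weak_gradientD(2)[OF h w, of i] by (simp only:)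
    then have eq: "(LINT x|lebesgue_on disc. g x $ i * w x) = (LINT x|lebesgue_on disc. h x $ i * w x)"
      by (simp only: neg_equal_iff_equal)
    show "(LINT x|lebesgue_on disc. (g x $ i - h x $ i) * w x) = 0"
      unfolding left_diff_distrib Bochner_Integration.integral_diff[OF int] eq by simp
  qed
  then have "AE x in lebesgue_on disc. \<forall>i. g x $ i - h x $ i = 0"
    by (simp add: AE_all_countable)
  then show ?thesis by eventually_elim (simp add: vec_eq_iff)
qed

section \<open>The Sobolev spaces on the disc\<close>

lemma H1I: "u \<in> L2_on disc \<Longrightarrow> weak_gradient disc u g \<Longrightarrow> u \<in> H1 disc"
  by (auto simp: H1_def)

lemma H1_L2: "u \<in> H1 disc \<Longrightarrow> u \<in> L2_on disc"
  by (simp add: H1_def)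

lemma grad_eq_AE:
  assumes "weak_gradient disc u g"
  shows "AE x in lebesgue_on disc. grad disc u x = g x"
proof (rule weak_gradient_unique[OF _ assms])
  show "weak_gradient disc u (grad disc u)" unfolding grad_def using someI[of "weak_gradient disc u" g] assms by simp
qed

lemma weak_gradient_grad: "u \<in> H1 disc \<Longrightarrow> weak_gradient disc u (grad disc u)"
  unfolding H1_def grad_def using someI_ex[of "weak_gradient disc u"] by blast

lemma grad_L2: "u \<in> H1 disc \<Longrightarrow> grad disc u \<in> L2_on disc"
  using weak_gradientD(1)[OF weak_gradient_grad] .

lemma L2_norm_grad_eq:
  assumes "u \<in> H1 disc" "weak_gradient disc u g"
  shows "L2_norm_on disc (grad disc u) = L2_norm_on disc g"
proof (rule L2_norm_on_cong_AE)
  show "AE x in lebesgue_on disc. norm (grad disc u x) = norm (g x)"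
    using grad_eq_AE[OF assms(2)] by eventually_elim simp
qed (use L2_onD(1)[OF grad_L2[OF assms(1)]] L2_onD(1)[OF weak_gradientD(1)[OF assms(2)]] in auto)

lemma weak_gradient_diff:
  assumes "u \<in> L2_on disc" "v \<in> L2_on disc" "weak_gradient disc u g" "weak_gradient disc v h"
  shows "weak_gradient disc (\<lambda>x. u x - v x) (\<lambda>x. g x - h x)"
  unfolding weak_gradient_def
proof (intro conjI ballI allI)
  note g = weak_gradientD[OF assms(3)] and h = weak_gradientD[OF assms(4)]
  show "(\<lambda>x. g x - h x) \<in> L2_on disc" by (rule L2_on_diff[OF g(1) h(1)])
  fix w i assume w: "w \<in> test_functions disc"
  note c = test_functionD(4)[OF w] test_functionD(5)[OF w, of i]
  note int = L2_on_disc_integrable[OF assms(1) c(2)] L2_on_disc_integrable[OF assms(2) c(2)]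
    L2_on_disc_integrable[OF L2_on_component[OF g(1)] c(1), of i]
    L2_on_disc_integrable[OF L2_on_component[OF h(1)] c(1), of i]
  show "(LINT x|lebesgue_on disc. (u x - v x) * partial i w x) = - (LINT x|lebesgue_on disc. (g x - h x) $ i * w x)"
    unfolding vector_minus_component left_diff_distrib Bochner_Integration.integral_diff[OF int(1,2)]
      Bochner_Integration.integral_diff[OF int(3,4)] g(2)[OF w] h(2)[OF w] by (rule minus_diff_minus)
qed

definition cnj_vec :: "complex ^ 2 \<Rightarrow> complex ^ 2" where
  "cnj_vec z = (\<chi> i. cnj (z $ i))"

lemma cnj_vec_nth [simp]: "cnj_vec z $ i = cnj (z $ i)"
  by (simp add: cnj_vec_def)

lemma norm_cnj_vec [simp]: "norm (cnj_vec z) = norm z"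
  by (simp add: norm_vec_def)

lemma cnj_vec_diff: "cnj_vec (a - b) = cnj_vec a - cnj_vec b"
  by (simp add: vec_eq_iff)

lemma L2_on_cnj_vec:
  assumes "g \<in> L2_on disc" shows "(\<lambda>x. cnj_vec (g x)) \<in> L2_on disc"
proof (rule L2_on_mono(1)[OF assms])
  have "cnj_vec \<in> borel_measurable borel"
    by (rule borel_measurable_continuous_onI) (unfold cnj_vec_def, intro continuous_intros)
  then show "(\<lambda>x. cnj_vec (g x)) \<in> borel_measurable (lebesgue_on disc)"
    using measurable_compose[OF L2_onD(1)[OF assms]] by blast
qed simp

lemma L2_on_cnj:
  fixes u :: "'a::euclidean_space \<Rightarrow> complex"
  assumes "u \<in> L2_on S" shows "(\<lambda>x. cnj (u x)) \<in> L2_on S"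
proof (rule L2_on_mono(1)[OF assms])
  have "cnj \<in> borel_measurable borel"
    by (rule borel_measurable_continuous_onI) (intro continuous_intros)
  then show "(\<lambda>x. cnj (u x)) \<in> borel_measurable (lebesgue_on S)"
    using measurable_compose[OF L2_onD(1)[OF assms]] by blast
qed simp

lemma partial_cnj: "w differentiable (at x) \<Longrightarrow> partial i (\<lambda>x. cnj (w x)) x = cnj (partial i w x)"
  by (rule partial_comp_bounded_linear[OF bounded_linear_cnj])

lemma weak_gradient_cnj:
  assumes "weak_gradient disc u g"
  shows "weak_gradient disc (\<lambda>x. cnj (u x)) (\<lambda>x. cnj_vec (g x))"
  unfolding weak_gradient_def
proof (intro conjI ballI allI)
  note g = weak_gradientD[OF assms]
  show "(\<lambda>x. cnj_vec (g x)) \<in> L2_on disc" by (rule L2_on_cnj_vec[OF g(1)])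
  fix w i assume w: "w \<in> test_functions disc"
  have "(LINT x|lebesgue_on disc. cnj (u x) * partial i w x)
      = (LINT x|lebesgue_on disc. cnj (u x * partial i (\<lambda>x. cnj (w x)) x))"
    using partial_cnj[OF test_functionD(3)[OF w]] by simp
  also have "\<dots> = cnj (- (LINT x|lebesgue_on disc. g x $ i * cnj (w x)))"
    unfolding Bochner_Integration.integral_cnj g(2)[OF test_function_cnj[OF w]] ..
  also have "\<dots> = - (LINT x|lebesgue_on disc. cnj (g x $ i * cnj (w x)))"
    unfolding Bochner_Integration.integral_cnj by (simp only: complex_cnj_minus)
  finally show "(LINT x|lebesgue_on disc. cnj (u x) * partial i w x) = - (LINT x|lebesgue_on disc. cnj_vec (g x) $ i * w x)"
    by simp
qed

lemma H1_diff:
  assumes "u \<in> H1 disc" "v \<in> H1 disc"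
  shows "(\<lambda>x. u x - v x) \<in> H1 disc"
    and "AE x in lebesgue_on disc. grad disc (\<lambda>x. u x - v x) x = grad disc u x - grad disc v x"
    and "L2_norm_on disc (grad disc (\<lambda>x. u x - v x)) = L2_norm_on disc (\<lambda>x. grad disc u x - grad disc v x)"
proof -
  note w = weak_gradient_diff[OF H1_L2[OF assms(1)] H1_L2[OF assms(2)] weak_gradient_grad[OF assms(1)] weak_gradient_grad[OF assms(2)]]
  show 1: "(\<lambda>x. u x - v x) \<in> H1 disc" by (rule H1I[OF L2_on_diff[OF H1_L2[OF assms(1)] H1_L2[OF assms(2)]] w])
  show "AE x in lebesgue_on disc. grad disc (\<lambda>x. u x - v x) x = grad disc u x - grad disc v x"
    by (rule grad_eq_AE[OF w])
  show "L2_norm_on disc (grad disc (\<lambda>x. u x - v x)) = L2_norm_on disc (\<lambda>x. grad disc u x - grad disc v x)"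
    by (rule L2_norm_grad_eq[OF 1 w])
qed

lemma H1_cnj:
  assumes "u \<in> H1 disc"
  shows "(\<lambda>x. cnj (u x)) \<in> H1 disc"
    and "AE x in lebesgue_on disc. grad disc (\<lambda>x. cnj (u x)) x = cnj_vec (grad disc u x)"
  using H1I[OF L2_on_cnj[OF H1_L2[OF assms]] weak_gradient_cnj[OF weak_gradient_grad[OF assms]]]
    grad_eq_AE[OF weak_gradient_cnj[OF weak_gradient_grad[OF assms]]] .

lemma H1_classical:
  assumes "Ck (Suc 0) u"
  shows "u \<in> H1 disc" "AE x in lebesgue_on disc. grad disc u x = classical_grad u x"
    "L2_norm_on disc (grad disc u) = L2_norm_on disc (classical_grad u)"
proof -
  note w = weak_gradient_classical_grad[OF assms]
  show 1: "u \<in> H1 disc" by (rule H1I[OF continuous_imp_L2_on_disc[OF Ck_continuous[OF assms]] w])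
  show "AE x in lebesgue_on disc. grad disc u x = classical_grad u x" by (rule grad_eq_AE[OF w])
  show "L2_norm_on disc (grad disc u) = L2_norm_on disc (classical_grad u)" by (rule L2_norm_grad_eq[OF 1 w])
qed

lemma H1_smooth: "smooth u \<Longrightarrow> u \<in> H1 disc"
  by (rule H1_classical(1)[OF smooth_Ck])

lemma H1_test_function: "w \<in> test_functions disc \<Longrightarrow> w \<in> H1 disc"
  by (rule H1_classical(1)[OF test_functionD(2)])

lemma H1_norm_nonneg [simp]: "0 \<le> H1_norm \<Omega> u"
  by (simp add: H1_norm_def)

lemma L2_norm_le_H1_norm: "L2_norm_on \<Omega> u \<le> H1_norm \<Omega> u"
  unfolding H1_norm_def by (rule real_le_rsqrt) simp

lemma grad_norm_le_H1_norm: "L2_norm_on \<Omega> (grad \<Omega> u) \<le> H1_norm \<Omega> u"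
  unfolding H1_norm_def by (rule real_le_rsqrt) simp

lemma H1_norm_le: "H1_norm \<Omega> u \<le> L2_norm_on \<Omega> u + L2_norm_on \<Omega> (grad \<Omega> u)"
  unfolding H1_norm_def by (rule sqrt_sum_squares_le_sum) auto

lemma L2_norm_diff_le:
  assumes "u \<in> L2_on S" "v \<in> L2_on S"
  shows "L2_norm_on S (\<lambda>x. u x - v x) \<le> L2_norm_on S u + L2_norm_on S v"
  using L2_on_add(2)[OF assms(1) L2_on_uminus[OF assms(2)]] L2_norm_on_cong[of S "\<lambda>x. - v x" v] by simp

lemma H1_norm_diff_le:
  assumes "u \<in> H1 disc" "v \<in> H1 disc"
  shows "H1_norm disc (\<lambda>x. u x - v x) \<le> H1_norm disc u + H1_norm disc v"
proof -
  have "H1_norm disc (\<lambda>x. u x - v x) \<le>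
      sqrt ((L2_norm_on disc u + L2_norm_on disc v)\<^sup>2 + (L2_norm_on disc (grad disc u) + L2_norm_on disc (grad disc v))\<^sup>2)"
    unfolding H1_norm_def H1_diff(3)[OF assms]
    by (intro real_sqrt_le_mono add_mono power_mono L2_norm_on_nonneg
        L2_norm_diff_le H1_L2[OF assms(1)] H1_L2[OF assms(2)] grad_L2[OF assms(1)] grad_L2[OF assms(2)])
  also have "\<dots> \<le> H1_norm disc u + H1_norm disc v"
    unfolding H1_norm_def by (rule real_sqrt_sum_squares_triangle_ineq)
  finally show ?thesis .
qed

lemma L2_norm_tendsto:
  assumes "\<And>n. un n \<in> L2_on S" "u \<in> L2_on S"
    and "(\<lambda>n. L2_norm_on S (\<lambda>x. un n x - u x)) \<longlonglongrightarrow> 0"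
  shows "(\<lambda>n. L2_norm_on S (un n)) \<longlonglongrightarrow> L2_norm_on S u"
proof -
  have "norm (L2_norm_on S (un n) - L2_norm_on S u) \<le> L2_norm_on S (\<lambda>x. un n x - u x)" for n
  proof -
    have "L2_norm_on S (un n) \<le> L2_norm_on S (\<lambda>x. un n x - u x) + L2_norm_on S u"
      using L2_on_add(2)[OF L2_on_diff[OF assms(1)[of n] assms(2)] assms(2)] by simp
    moreover have "L2_norm_on S u \<le> L2_norm_on S (\<lambda>x. un n x - u x) + L2_norm_on S (un n)"
      using L2_on_add(2)[OF L2_on_diff[OF assms(2) assms(1)[of n]] assms(1)[of n]] by (simp add: L2_norm_on_minus_commute[of S "un n" u])
    ultimately show ?thesis by simp
  qed
  then have "(\<lambda>n. L2_norm_on S (un n) - L2_norm_on S u) \<longlonglongrightarrow> 0"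
    by (intro Lim_null_comparison[OF _ assms(3)]) auto
  then show ?thesis by (rule LIM_zero_cancel)
qed

text \<open>
  Convergence in the \<open>H\<^sup>1\<close> norm involves the gradient of a difference, which agrees with the difference
  of the gradients only almost everywhere.
\<close>

lemma H1_tendstoD:
  assumes "\<And>n. un n \<in> H1 disc" "u \<in> H1 disc"
    and lim: "(\<lambda>n. H1_norm disc (\<lambda>x. un n x - u x)) \<longlonglongrightarrow> 0"
  shows "(\<lambda>n. L2_norm_on disc (\<lambda>x. un n x - u x)) \<longlonglongrightarrow> 0"
    and "(\<lambda>n. L2_norm_on disc (\<lambda>x. grad disc (un n) x - grad disc u x)) \<longlonglongrightarrow> 0"
proof -
  show "(\<lambda>n. L2_norm_on disc (\<lambda>x. un n x - u x)) \<longlonglongrightarrow> 0"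
    by (rule Lim_null_comparison[OF _ lim]) (simp add: L2_norm_le_H1_norm)
  have "L2_norm_on disc (\<lambda>x. grad disc (un n) x - grad disc u x) \<le> H1_norm disc (\<lambda>x. un n x - u x)" for n
    using H1_diff(3)[OF assms(1)[of n] assms(2)] grad_norm_le_H1_norm[of disc "\<lambda>x. un n x - u x"] by simp
  then show "(\<lambda>n. L2_norm_on disc (\<lambda>x. grad disc (un n) x - grad disc u x)) \<longlonglongrightarrow> 0"
    by (intro Lim_null_comparison[OF _ lim]) simp
qed

lemma H1_tendstoI:
  assumes "\<And>n. un n \<in> H1 disc" "u \<in> H1 disc"
    and "(\<lambda>n. L2_norm_on disc (\<lambda>x. un n x - u x)) \<longlonglongrightarrow> 0"
    and "(\<lambda>n. L2_norm_on disc (\<lambda>x. grad disc (un n) x - grad disc u x)) \<longlonglongrightarrow> 0"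
  shows "(\<lambda>n. H1_norm disc (\<lambda>x. un n x - u x)) \<longlonglongrightarrow> 0"
proof (rule Lim_null_comparison)
  show "\<forall>\<^sub>F n in sequentially. norm (H1_norm disc (\<lambda>x. un n x - u x)) \<le>
      L2_norm_on disc (\<lambda>x. un n x - u x) + L2_norm_on disc (\<lambda>x. grad disc (un n) x - grad disc u x)"
  proof (intro always_eventually allI)
    fix n
    show "norm (H1_norm disc (\<lambda>x. un n x - u x)) \<le>
        L2_norm_on disc (\<lambda>x. un n x - u x) + L2_norm_on disc (\<lambda>x. grad disc (un n) x - grad disc u x)"
      using H1_norm_le[of disc "\<lambda>x. un n x - u x"] unfolding H1_diff(3)[OF assms(1)[of n] assms(2)] by simp
  qed
  show "(\<lambda>n. L2_norm_on disc (\<lambda>x. un n x - u x) + L2_norm_on disc (\<lambda>x. grad disc (un n) x - grad disc u x)) \<longlonglongrightarrow> 0"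
    using tendsto_add[OF assms(3,4)] by simp
qed

lemma H10_H1: "u \<in> H10 disc \<Longrightarrow> u \<in> H1 disc"
  by (simp add: H10_def)

lemma H10E:
  assumes "u \<in> H10 disc"
  obtains w where "\<And>j. w j \<in> test_functions disc" "(\<lambda>j. H1_norm disc (\<lambda>x. w j x - u x)) \<longlonglongrightarrow> 0"
  using assms unfolding H10_def by blast

lemma H10I:
  assumes "u \<in> H1 disc" "\<And>j. w j \<in> test_functions disc" "(\<lambda>j. H1_norm disc (\<lambda>x. w j x - u x)) \<longlonglongrightarrow> 0"
  shows "u \<in> H10 disc"
  unfolding H10_def mem_Collect_eq by (intro conjI exI[of _ w] allI assms)

lemma nonneg_null_comparison:
  fixes a b :: "nat \<Rightarrow> real"
  assumes "\<And>j. 0 \<le> a j" "\<And>j. a j \<le> b j" "b \<longlonglongrightarrow> 0"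
  shows "a \<longlonglongrightarrow> 0"
  by (rule tendsto_sandwich[OF _ _ tendsto_const assms(3)]) (simp_all add: assms(1,2))

lemma test_function_diff:
  assumes "v \<in> test_functions disc" "w \<in> test_functions disc"
  shows "(\<lambda>x. v x - w x) \<in> test_functions disc"
proof -
  obtain C where C: "compact C" "C \<subseteq> disc" "\<forall>x. x \<notin> C \<longrightarrow> v x = 0"
    using assms(1) by (auto simp: test_functions_def)
  obtain D where D: "compact D" "D \<subseteq> disc" "\<forall>x. x \<notin> D \<longrightarrow> w x = 0"
    using assms(2) by (auto simp: test_functions_def)
  have "compact (C \<union> D)" "C \<union> D \<subseteq> disc" "\<forall>x. x \<notin> C \<union> D \<longrightarrow> v x - w x = 0"
    using C D by auto
  then show ?thesis
    unfolding test_functions_def mem_Collect_eq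
    by (intro conjI exI[of _ "C \<union> D"] smooth_diff test_functionD(1)[OF assms(1)] test_functionD(1)[OF assms(2)])
qed

lemma H10_diff:
  assumes "u \<in> H10 disc" "v \<in> H10 disc" shows "(\<lambda>x. u x - v x) \<in> H10 disc"
proof -
  obtain a where a: "\<And>j. a j \<in> test_functions disc" "(\<lambda>j. H1_norm disc (\<lambda>x. a j x - u x)) \<longlonglongrightarrow> 0"
    using H10E[OF assms(1)] by blast
  obtain b where b: "\<And>j. b j \<in> test_functions disc" "(\<lambda>j. H1_norm disc (\<lambda>x. b j x - v x)) \<longlonglongrightarrow> 0"
    using H10E[OF assms(2)] by blast
  note H = H10_H1[OF assms(1)] H10_H1[OF assms(2)]
  have "H1_norm disc (\<lambda>x. (a j x - b j x) - (u x - v x)) \<le> H1_norm disc (\<lambda>x. a j x - u x) + H1_norm disc (\<lambda>x. b j x - v x)" for j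
    using H1_norm_diff_le[OF H1_diff(1)[OF H1_test_function[OF a(1)] H(1), of j] H1_diff(1)[OF H1_test_function[OF b(1)] H(2), of j]]
    by (simp add: algebra_simps)
  moreover have "(\<lambda>j. H1_norm disc (\<lambda>x. a j x - u x) + H1_norm disc (\<lambda>x. b j x - v x)) \<longlonglongrightarrow> 0"
    using tendsto_add[OF a(2) b(2)] by simp
  ultimately have "(\<lambda>j. H1_norm disc (\<lambda>x. (a j x - b j x) - (u x - v x))) \<longlonglongrightarrow> 0"
    by (rule nonneg_null_comparison[OF H1_norm_nonneg])
  then show ?thesis
    by (rule H10I[OF H1_diff(1)[OF H] test_function_diff[OF a(1) b(1)]])
qed

lemma H1_norm_cnj:
  assumes "u \<in> H1 disc" shows "H1_norm disc (\<lambda>x. cnj (u x)) = H1_norm disc u"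
proof -
  have "L2_norm_on disc (grad disc (\<lambda>x. cnj (u x))) = L2_norm_on disc (grad disc u)"
  proof (rule L2_norm_on_cong_AE)
    show "AE x in lebesgue_on disc. norm (grad disc (\<lambda>x. cnj (u x)) x) = norm (grad disc u x)"
      using H1_cnj(2)[OF assms] by eventually_elim simp
  qed (use L2_onD(1)[OF grad_L2[OF assms]] L2_onD(1)[OF grad_L2[OF H1_cnj(1)[OF assms]]] in auto)
  moreover have "L2_norm_on disc (\<lambda>x. cnj (u x)) = L2_norm_on disc u"
    by (rule L2_norm_on_cong) simp
  ultimately show ?thesis by (simp add: H1_norm_def)
qed

lemma H10_cnj:
  assumes "u \<in> H10 disc" shows "(\<lambda>x. cnj (u x)) \<in> H10 disc"
proof -
  obtain a where a: "\<And>j. a j \<in> test_functions disc" "(\<lambda>j. H1_norm disc (\<lambda>x. a j x - u x)) \<longlonglongrightarrow> 0"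
    using H10E[OF assms] by blast
  note H = H10_H1[OF assms]
  have "H1_norm disc (\<lambda>x. cnj (a j x) - cnj (u x)) = H1_norm disc (\<lambda>x. a j x - u x)" for j
    using H1_norm_cnj[OF H1_diff(1)[OF H1_test_function[OF a(1)] H, of j]] unfolding complex_cnj_diff .
  then have "(\<lambda>j. H1_norm disc (\<lambda>x. cnj (a j x) - cnj (u x))) \<longlonglongrightarrow> 0" using a(2) by (simp only:)
  then show ?thesis
    by (rule H10I[OF H1_cnj(1)[OF H] test_function_cnj[OF a(1)]])
qed

text \<open>
  Integrating \<open>\<partial>\<^sub>1 (x\<^sub>1 \<bar>w\<bar>\<^sup>2)\<close> over the disc gives zero; as \<open>\<bar>x\<^sub>1\<bar> < 1\<close> there, the constant \<open>2\<close> results.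
\<close>

lemma Poincare_test_function:
  assumes w: "w \<in> test_functions disc"
  shows "L2_norm_on disc w \<le> 2 * L2_norm_on disc (classical_grad w)"
proof -
  let ?M = "lebesgue_on disc" and ?p = "partial 1 w"
  define X where "X x = complex_of_real (x $ 1)" for x :: plane
  have sX: "smooth X" unfolding X_def by (rule smooth_coordinate)
  have pX: "partial 1 X x = 1" for x
  proof -
    have "bounded_linear X"
      unfolding X_def by (rule bounded_linear_compose[OF bounded_linear_of_real bounded_linear_vec_nth])
    from bounded_linear_imp_has_derivative[OF this] have "partial 1 X x = X (axis 1 1)" by (rule partial_eqI)
    then show ?thesis by (simp add: X_def)
  qed
  note sw = test_functionD(1)[OF w]
  have cX: "continuous_on UNIV X" using smooth_Ck[OF sX, of 0] by simp
  note cw = test_functionD(4)[OF w] test_functionD(5)[OF w, of 1]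
  have cc: "continuous_on UNIV (\<lambda>x. cnj (w x))" "continuous_on UNIV (\<lambda>x. cnj (?p x))"
    using cw by (auto intro: continuous_on_cnj)
  define a where "a x = X x * cnj (w x)" for x
  have sa: "smooth a" unfolding a_def by (intro smooth_mult sX smooth_cnj sw)
  have pa: "partial 1 a x = X x * cnj (?p x) + cnj (w x)" for x
    unfolding a_def using partial_mult[OF smooth_differentiable[OF sX] smooth_differentiable[OF smooth_cnj[OF sw]]]
    by (simp add: pX partial_cnj[OF smooth_differentiable[OF sw]])
  have I1: "integrable ?M (\<lambda>x. X x * cnj (w x) * ?p x)"
    by (rule L2_on_disc_integrable[OF continuous_imp_L2_on_disc]) (intro continuous_on_mult cX cc cw)+
  have I2: "integrable ?M (\<lambda>x. X x * cnj (?p x) * w x)"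
    by (rule L2_on_disc_integrable[OF continuous_imp_L2_on_disc]) (intro continuous_on_mult cX cc cw)+
  have I3: "integrable ?M (\<lambda>x. cnj (w x) * w x)"
    by (rule L2_on_disc_integrable[OF continuous_imp_L2_on_disc]) (intro cc cw)+
  have L: "w \<in> L2_on disc" "?p \<in> L2_on disc" using cw by (auto intro: continuous_imp_L2_on_disc)
  have "(LINT x|?M. a x * ?p x) = - (LINT x|?M. classical_grad a x $ 1 * w x)"
    by (rule weak_gradientD(2)[OF weak_gradient_classical_grad[OF smooth_Ck[OF sa]] w])
  then have eq: "(LINT x|?M. X x * cnj (w x) * ?p x) = - (LINT x|?M. X x * cnj (?p x) * w x) - (LINT x|?M. cnj (w x) * w x)"
    using I2 I3 by (simp add: a_def pa distrib_right)
  have "complex_of_real ((L2_norm_on disc w)\<^sup>2) = (LINT x|?M. cnj (w x) * w x)"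
    unfolding L2_norm_on_power2 integral_complex_of_real[symmetric] complex_norm_square by (simp add: mult.commute)
  also have "\<dots> = - (LINT x|?M. X x * cnj (w x) * ?p x + X x * cnj (?p x) * w x)"
    using eq I1 I2 by simp
  finally have "norm (complex_of_real ((L2_norm_on disc w)\<^sup>2))
      = norm (- (LINT x|?M. X x * cnj (w x) * ?p x + X x * cnj (?p x) * w x))"
    by (rule arg_cong)
  then have "(L2_norm_on disc w)\<^sup>2 = norm (LINT x|?M. X x * cnj (w x) * ?p x + X x * cnj (?p x) * w x)"
    unfolding norm_of_real norm_minus_cancel by simp
  also have "\<dots> \<le> (LINT x|?M. 2 * (norm (w x) * norm (?p x)))"
  proof (rule Bochner_Integration.integral_norm_bound_integral)
    show "integrable ?M (\<lambda>x. 2 * (norm (w x) * norm (?p x)))"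
      using L2_on_Cauchy_Schwarz(1)[OF L] by simp
    fix x assume "x \<in> space ?M"
    then have "norm x < 1" by (simp add: disc_eq)
    then have X1: "norm (X x) \<le> 1" using component_le_norm_cart[of x 1] by (simp add: X_def)
    have "norm (X x * cnj (w x) * ?p x + X x * cnj (?p x) * w x) \<le> norm (X x * cnj (w x) * ?p x) + norm (X x * cnj (?p x) * w x)"
      by (rule norm_triangle_ineq)
    also have "\<dots> = norm (X x) * (2 * (norm (w x) * norm (?p x)))"
      by (simp add: norm_mult algebra_simps)
    also have "\<dots> \<le> 1 * (2 * (norm (w x) * norm (?p x)))"
      by (intro mult_right_mono X1) simp
    finally show "norm (X x * cnj (w x) * ?p x + X x * cnj (?p x) * w x) \<le> 2 * (norm (w x) * norm (?p x))" by simp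
  qed (use I1 I2 in simp)
  also have "\<dots> \<le> 2 * (L2_norm_on disc w * L2_norm_on disc ?p)"
    using L2_on_Cauchy_Schwarz(2)[OF L] by simp
  also have "\<dots> \<le> 2 * (L2_norm_on disc w * L2_norm_on disc (classical_grad w))"
  proof -
    have "L2_norm_on disc ?p \<le> L2_norm_on disc (classical_grad w)"
      by (rule L2_on_mono(2)[OF weak_gradientD(1)[OF weak_gradient_classical_grad[OF test_functionD(2)[OF w]]] L2_onD(1)[OF L(2)]])
         (metis Finite_Cartesian_Product.norm_nth_le classical_grad_nth)
    then show ?thesis by (simp add: mult_left_mono)
  qed
  finally have "L2_norm_on disc w * L2_norm_on disc w \<le> L2_norm_on disc w * (2 * L2_norm_on disc (classical_grad w))"
    by (simp add: power2_eq_square mult.left_commute)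
  then show ?thesis
    using L2_norm_on_nonneg[of disc w] L2_norm_on_nonneg[of disc "classical_grad w"]
    by (cases "L2_norm_on disc w = 0") (simp_all add: mult_le_cancel_left_pos)
qed

lemma Poincare_H10:
  assumes "u \<in> H10 disc"
  shows "L2_norm_on disc u \<le> 2 * L2_norm_on disc (grad disc u)"
proof -
  obtain w where w: "\<And>j. w j \<in> test_functions disc" "(\<lambda>j. H1_norm disc (\<lambda>x. w j x - u x)) \<longlonglongrightarrow> 0"
    using H10E[OF assms] by blast
  note H = H1_test_function[OF w(1)] H10_H1[OF assms]
  note lim = H1_tendstoD[OF H w(2)]
  have 1: "(\<lambda>j. L2_norm_on disc (w j)) \<longlonglongrightarrow> L2_norm_on disc u"
    by (rule L2_norm_tendsto[OF H1_L2[OF H(1)] H1_L2[OF H(2)] lim(1)])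
  have "(\<lambda>j. L2_norm_on disc (grad disc (w j))) \<longlonglongrightarrow> L2_norm_on disc (grad disc u)"
    by (rule L2_norm_tendsto[OF grad_L2[OF H(1)] grad_L2[OF H(2)] lim(2)])
  then have 2: "(\<lambda>j. 2 * L2_norm_on disc (grad disc (w j))) \<longlonglongrightarrow> 2 * L2_norm_on disc (grad disc u)"
    by (intro tendsto_intros)
  have "L2_norm_on disc (w j) \<le> 2 * L2_norm_on disc (grad disc (w j))" for j
    using Poincare_test_function[OF w(1)] H1_classical(3)[OF test_functionD(2)[OF w(1)]] by simp
  then show ?thesis by (intro LIMSEQ_le[OF 1 2]) auto
qed

section \<open>The energy form and convergence of solutions\<close>

lemma L2_dot_bound:
  fixes a b :: "plane \<Rightarrow> complex ^ 2"
  assumes "a \<in> L2_on disc" "b \<in> L2_on disc"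
  shows "integrable (lebesgue_on disc) (\<lambda>x. \<Sum>i\<in>UNIV. a x $ i * b x $ i)"
    and "norm (LINT x|lebesgue_on disc. (\<Sum>i\<in>UNIV. a x $ i * b x $ i)) \<le> 2 * (L2_norm_on disc a * L2_norm_on disc b)"
proof -
  note cs = L2_on_Cauchy_Schwarz[OF assms]
  have m: "(\<lambda>x. \<Sum>i\<in>UNIV. a x $ i * b x $ i) \<in> borel_measurable (lebesgue_on disc)"
    using L2_onD(1)[OF L2_on_component[OF assms(1)]] L2_onD(1)[OF L2_on_component[OF assms(2)]] by measurable
  have le: "norm (\<Sum>i\<in>UNIV. a x $ i * b x $ i) \<le> 2 * (norm (a x) * norm (b x))" for x
  proof -
    have "norm (\<Sum>i\<in>UNIV. a x $ i * b x $ i) \<le> (\<Sum>i\<in>(UNIV::2 set). norm (a x) * norm (b x))"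
      by (rule sum_norm_le) (simp add: norm_mult mult_mono Finite_Cartesian_Product.norm_nth_le)
    then show ?thesis by simp
  qed
  have I: "integrable (lebesgue_on disc) (\<lambda>x. 2 * (norm (a x) * norm (b x)))" using cs(1) by simp
  show I': "integrable (lebesgue_on disc) (\<lambda>x. \<Sum>i\<in>UNIV. a x $ i * b x $ i)"
    by (rule Bochner_Integration.integrable_bound[OF I m]) (use le in auto)
  have "norm (LINT x|lebesgue_on disc. (\<Sum>i\<in>UNIV. a x $ i * b x $ i)) \<le> (LINT x|lebesgue_on disc. 2 * (norm (a x) * norm (b x)))"
    by (rule Bochner_Integration.integral_norm_bound_integral[OF I' I le])
  also have "\<dots> \<le> 2 * (L2_norm_on disc a * L2_norm_on disc b)" using cs(2) by simp
  finally show "norm (LINT x|lebesgue_on disc. (\<Sum>i\<in>UNIV. a x $ i * b x $ i)) \<le> 2 * (L2_norm_on disc a * L2_norm_on disc b)" .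
qed

definition bounded_coeff :: "real \<Rightarrow> (plane \<Rightarrow> real ^ 2 ^ 2) \<Rightarrow> bool" where
  "bounded_coeff C \<sigma> \<longleftrightarrow> \<sigma> \<in> borel_measurable (lebesgue_on disc) \<and> (\<forall>x\<in>disc. \<forall>i j. \<bar>\<sigma> x $ i $ j\<bar> \<le> C)"

text \<open>The energy form is an \<open>L\<^sup>2\<close> pairing of this vector field with the second gradient.\<close>

definition flux :: "(plane \<Rightarrow> real ^ 2 ^ 2) \<Rightarrow> (plane \<Rightarrow> complex ^ 2) \<Rightarrow> plane \<Rightarrow> complex ^ 2" where
  "flux \<sigma> g x = (\<chi> i. \<Sum>j\<in>UNIV. of_real (\<sigma> x $ i $ j) * g x $ j)"

lemma energy_flux: "energy disc \<sigma> g h = (LINT x|lebesgue_on disc. (\<Sum>i\<in>UNIV. flux \<sigma> g x $ i * h x $ i))"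
  by (simp add: energy_def flux_def)

lemma norm_vec2_le: "norm (z :: complex ^ 2) \<le> norm (z $ 1) + norm (z $ 2)"
  using norm_le_l1_cart by (simp add: norm_vec_def L2_set_def sum_2 sqrt_sum_squares_le_sum)

lemma bounded_coeff_nonneg: "bounded_coeff C \<sigma> \<Longrightarrow> 0 \<le> C"
  unfolding bounded_coeff_def using abs_ge_zero order_trans[of 0 "\<bar>\<sigma> 0 $ 1 $ 1\<bar>" C] by (force simp: disc_eq)

lemma flux_norm_le:
  assumes \<sigma>: "bounded_coeff C \<sigma>" and x: "x \<in> disc"
  shows "norm (flux \<sigma> g x) \<le> 4 * C * norm (g x)"
proof -
  note C = bounded_coeff_nonneg[OF \<sigma>]
  have c: "norm (flux \<sigma> g x $ i) \<le> 2 * (C * norm (g x))" for i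
  proof -
    have "norm (flux \<sigma> g x $ i) \<le> (\<Sum>j\<in>(UNIV :: 2 set). C * norm (g x))"
      unfolding flux_def vec_lambda_beta
      by (rule sum_norm_le)
         (use \<sigma> x C in \<open>auto simp: norm_mult bounded_coeff_def intro!: mult_mono Finite_Cartesian_Product.norm_nth_le\<close>)
    then show ?thesis by simp
  qed
  have "norm (flux \<sigma> g x) \<le> norm (flux \<sigma> g x $ 1) + norm (flux \<sigma> g x $ 2)" by (rule norm_vec2_le)
  also have "\<dots> \<le> 4 * C * norm (g x)" using c[of 1] c[of 2] by simp
  finally show ?thesis .
qed

lemma flux_L2:
  assumes \<sigma>: "bounded_coeff C \<sigma>" and g: "g \<in> L2_on disc"
  shows "flux \<sigma> g \<in> L2_on disc"
proof -
  have m\<sigma>: "(\<lambda>x. \<sigma> x $ i $ j) \<in> borel_measurable (lebesgue_on disc)" for i j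
  proof -
    have "(\<lambda>A :: real ^ 2 ^ 2. A $ i $ j) \<in> borel_measurable borel"
      by (rule borel_measurable_continuous_onI) (intro continuous_intros)
    then show ?thesis using measurable_compose[of \<sigma> "lebesgue_on disc" borel] \<sigma> unfolding bounded_coeff_def by blast
  qed
  have mg: "(\<lambda>x. g x $ i) \<in> borel_measurable (lebesgue_on disc)" for i
    by (rule L2_onD(1)[OF L2_on_component[OF g]])
  have comp: "(\<lambda>x. flux \<sigma> g x $ i) \<in> borel_measurable (lebesgue_on disc)" for i
    unfolding flux_def vec_lambda_beta using m\<sigma> mg by measurable
  have m: "flux \<sigma> g \<in> borel_measurable (lebesgue_on disc)"
  proof (rule borel_measurable_euclidean_space[THEN iffD2], rule ballI)
    fix b :: "complex ^ 2" assume "b \<in> Basis"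
    then obtain i u where "b = axis i u" by (auto simp: Basis_vec_def)
    then show "(\<lambda>x. flux \<sigma> g x \<bullet> b) \<in> borel_measurable (lebesgue_on disc)"
      using comp[of i] by (simp add: inner_axis)
  qed
  show ?thesis
  proof (rule L2_on_dominated(1)[OF g m, of "4 * C"])
    show "AE x in lebesgue_on disc. norm (flux \<sigma> g x) \<le> 4 * C * norm (g x)"
      by (rule AE_I2) (rule flux_norm_le[OF \<sigma>], simp)
  qed (use bounded_coeff_nonneg[OF \<sigma>] in simp)
qed

lemma energy_integrable:
  assumes "bounded_coeff C \<sigma>" "g \<in> L2_on disc" "h \<in> L2_on disc"
  shows "integrable (lebesgue_on disc) (\<lambda>x. \<Sum>i\<in>UNIV. flux \<sigma> g x $ i * h x $ i)"
  by (rule L2_dot_bound(1)[OF flux_L2[OF assms(1,2)] assms(3)])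

lemma energy_bound:
  assumes "bounded_coeff C \<sigma>" "g \<in> L2_on disc" "h \<in> L2_on disc"
  shows "norm (energy disc \<sigma> g h) \<le> 2 * (L2_norm_on disc (flux \<sigma> g) * L2_norm_on disc h)"
  unfolding energy_flux by (rule L2_dot_bound(2)[OF flux_L2[OF assms(1,2)] assms(3)])

lemma energy_cong_AE:
  assumes "bounded_coeff C \<sigma>" "g \<in> L2_on disc" "h \<in> L2_on disc" "g' \<in> L2_on disc" "h' \<in> L2_on disc"
    and "AE x in lebesgue_on disc. g x = g' x" "AE x in lebesgue_on disc. h x = h' x"
  shows "energy disc \<sigma> g h = energy disc \<sigma> g' h'"
  unfolding energy_flux
proof (rule integral_cong_AE)
  show "AE x in lebesgue_on disc. (\<Sum>i\<in>UNIV. flux \<sigma> g x $ i * h x $ i) = (\<Sum>i\<in>UNIV. flux \<sigma> g' x $ i * h' x $ i)"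
    using assms(6,7) by eventually_elim (simp add: flux_def)
qed (use energy_integrable[OF assms(1,2,3)] energy_integrable[OF assms(1,4,5)] in auto)

lemma energy_diff_left:
  assumes "bounded_coeff C \<sigma>" "g \<in> L2_on disc" "g' \<in> L2_on disc" "h \<in> L2_on disc"
  shows "energy disc \<sigma> (\<lambda>x. g x - g' x) h = energy disc \<sigma> g h - energy disc \<sigma> g' h"
proof -
  have "(\<Sum>i\<in>UNIV. flux \<sigma> (\<lambda>x. g x - g' x) x $ i * h x $ i)
      = (\<Sum>i\<in>UNIV. flux \<sigma> g x $ i * h x $ i) - (\<Sum>i\<in>UNIV. flux \<sigma> g' x $ i * h x $ i)" for x
    by (simp add: flux_def sum_2 algebra_simps)
  then show ?thesis unfolding energy_flux
    using Bochner_Integration.integral_diff[OF energy_integrable[OF assms(1,2,4)] energy_integrable[OF assms(1,3,4)]] by simp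
qed

lemma energy_diff_coeff:
  assumes "bounded_coeff C \<sigma>" "bounded_coeff C' \<tau>" "g \<in> L2_on disc" "h \<in> L2_on disc"
  shows "energy disc (\<lambda>x. \<sigma> x - \<tau> x) g h = energy disc \<sigma> g h - energy disc \<tau> g h"
proof -
  have "(\<Sum>i\<in>UNIV. flux (\<lambda>x. \<sigma> x - \<tau> x) g x $ i * h x $ i)
      = (\<Sum>i\<in>UNIV. flux \<sigma> g x $ i * h x $ i) - (\<Sum>i\<in>UNIV. flux \<tau> g x $ i * h x $ i)" for x
    by (simp add: flux_def sum_2 algebra_simps)
  then show ?thesis unfolding energy_flux
    using Bochner_Integration.integral_diff[OF energy_integrable[OF assms(1,3,4)] energy_integrable[OF assms(2,3,4)]] by simp
qed

lemma bounded_coeff_diff: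
  assumes "bounded_coeff C \<sigma>" "bounded_coeff C' \<tau>"
  shows "bounded_coeff (C + C') (\<lambda>x. \<sigma> x - \<tau> x)"
  unfolding bounded_coeff_def
proof (intro conjI ballI allI)
  show "(\<lambda>x. \<sigma> x - \<tau> x) \<in> borel_measurable (lebesgue_on disc)"
    using assms unfolding bounded_coeff_def by (intro borel_measurable_diff) auto
  fix x i j assume x: "x \<in> disc"
  have "\<bar>\<sigma> x $ i $ j\<bar> \<le> C" "\<bar>\<tau> x $ i $ j\<bar> \<le> C'" using assms x by (auto simp: bounded_coeff_def)
  then show "\<bar>(\<sigma> x - \<tau> x) $ i $ j\<bar> \<le> C + C'" by simp
qed

lemma bounded_coeff_mat_1: "bounded_coeff 1 (\<lambda>_. mat 1)"
  by (simp add: bounded_coeff_def mat_def)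

lemma energy_tendsto:
  assumes \<sigma>: "bounded_coeff C \<sigma>" and g: "g \<in> L2_on disc"
    and h: "\<And>n. hn n \<in> L2_on disc" "h \<in> L2_on disc"
    and lim: "(\<lambda>n. L2_norm_on disc (\<lambda>x. hn n x - h x)) \<longlonglongrightarrow> 0"
  shows "(\<lambda>n. energy disc \<sigma> g (hn n)) \<longlonglongrightarrow> energy disc \<sigma> g h"
proof -
  have "norm (energy disc \<sigma> g (hn n) - energy disc \<sigma> g h)
      \<le> 2 * (L2_norm_on disc (flux \<sigma> g) * L2_norm_on disc (\<lambda>x. hn n x - h x))" for n
  proof -
    have "(\<Sum>i\<in>UNIV. flux \<sigma> g x $ i * (hn n x - h x) $ i)
        = (\<Sum>i\<in>UNIV. flux \<sigma> g x $ i * hn n x $ i) - (\<Sum>i\<in>UNIV. flux \<sigma> g x $ i * h x $ i)" for x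
      by (simp add: sum_2 algebra_simps)
    then have "energy disc \<sigma> g (hn n) - energy disc \<sigma> g h = energy disc \<sigma> g (\<lambda>x. hn n x - h x)"
      unfolding energy_flux
      using Bochner_Integration.integral_diff[OF energy_integrable[OF \<sigma> g h(1)[of n]] energy_integrable[OF \<sigma> g h(2)]] by simp
    then show ?thesis using energy_bound[OF \<sigma> g L2_on_diff[OF h(1)[of n] h(2)]] by simp
  qed
  moreover have "(\<lambda>n. 2 * (L2_norm_on disc (flux \<sigma> g) * L2_norm_on disc (\<lambda>x. hn n x - h x))) \<longlonglongrightarrow> 0"
    using tendsto_mult_right_zero[OF tendsto_mult_right_zero[OF lim, of "L2_norm_on disc (flux \<sigma> g)"], of 2] .
  ultimately have "(\<lambda>n. norm (energy disc \<sigma> g (hn n) - energy disc \<sigma> g h)) \<longlonglongrightarrow> 0"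
    by (rule nonneg_null_comparison[OF norm_ge_zero])
  then show ?thesis using LIM_zero_cancel tendsto_norm_zero_iff by blast
qed

text \<open>This is where the symmetry of the coefficients enters.\<close>

lemma energy_hermitian:
  assumes "\<And>x. x \<in> disc \<Longrightarrow> transpose (\<sigma> x) = \<sigma> x"
  shows "energy disc \<sigma> g (\<lambda>x. cnj_vec (h x)) = cnj (energy disc \<sigma> h (\<lambda>x. cnj_vec (g x)))"
proof -
  have "(\<Sum>i\<in>UNIV. flux \<sigma> g x $ i * cnj_vec (h x) $ i) = cnj (\<Sum>i\<in>UNIV. flux \<sigma> h x $ i * cnj_vec (g x) $ i)"
    if "x \<in> disc" for x
  proof -
    have "\<sigma> x $ 2 $ 1 = \<sigma> x $ 1 $ 2" using arg_cong[OF assms[OF that], of "\<lambda>A. A $ 1 $ 2"] by (simp add: transpose_def)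
    then show ?thesis by (simp add: flux_def sum_2 algebra_simps)
  qed
  then have "energy disc \<sigma> g (\<lambda>x. cnj_vec (h x)) = (LINT x|lebesgue_on disc. cnj (\<Sum>i\<in>UNIV. flux \<sigma> h x $ i * cnj_vec (g x) $ i))"
    unfolding energy_flux by (intro Bochner_Integration.integral_cong) auto
  then show ?thesis by (simp only: energy_flux Bochner_Integration.integral_cnj)
qed

text \<open>
  Solutions depend continuously on the coefficients: testing both equations with the conjugate of
  \<open>u\<^sub>n - u\<close> shows that \<open>\<parallel>\<nabla>(u\<^sub>n - u)\<parallel>\<close> is at most a constant times \<open>\<parallel>(I - \<sigma>\<^sub>n)\<nabla>u\<parallel>\<close>, which tends to zero by
  dominated convergence.
\<close>

lemma G_converges_pointwise:
  assumes M: "\<And>n. \<sigma> n \<in> M_class K disc" "(\<lambda>_. mat 1) \<in> M_class K disc"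
    and bdd: "\<And>n. bounded_coeff C (\<sigma> n)"
    and coercive: "\<And>n x g. x \<in> disc \<Longrightarrow> (norm (g x))\<^sup>2 \<le> Re (\<Sum>i\<in>UNIV. flux (\<sigma> n) g x $ i * cnj (g x $ i))"
    and ev: "\<And>x. x \<in> disc \<Longrightarrow> \<forall>\<^sub>F n in sequentially. \<sigma> n x = mat 1"
  shows "G_converges K disc \<sigma> (\<lambda>_. mat 1)"
  unfolding G_converges_def
proof (intro conjI allI ballI impI M)
  fix f un u
  assume f: "f \<in> Hm1 disc"
    and un: "\<forall>n. un n \<in> H10 disc \<and> divergence_equation disc (\<sigma> n) (un n) f"
    and u: "u \<in> H10 disc \<and> divergence_equation disc (\<lambda>_. mat 1) u f"
  let ?I = "\<lambda>_::plane. mat 1 :: real ^ 2 ^ 2"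
  have un': "un n \<in> H10 disc" "divergence_equation disc (\<sigma> n) (un n) f" for n using un by auto
  have u': "u \<in> H10 disc" "divergence_equation disc ?I u f" using u by auto
  note H = H10_H1[OF un'(1)] H10_H1[OF u'(1)]
  have H0: "(\<lambda>x. un n x - u x) \<in> H10 disc" for n by (rule H10_diff[OF un'(1) u'(1)])
  \<comment> \<open>\<open>d\<close> is a version of \<open>\<nabla>(u\<^sub>n - u)\<close>, and \<open>r\<close> bounds it through the perturbation \<open>I - \<sigma>\<^sub>n\<close>\<close>
  define d where "d n x = grad disc (un n) x - grad disc u x" for n x
  have dL2: "d n \<in> L2_on disc" for n unfolding d_def by (rule L2_on_diff[OF grad_L2[OF H(1)] grad_L2[OF H(2)]])
  define \<tau> where "\<tau> n x = mat 1 - \<sigma> n x" for n x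
  have \<tau>: "bounded_coeff (1 + C) (\<tau> n)" for n
    unfolding \<tau>_def by (rule bounded_coeff_diff[OF bounded_coeff_mat_1 bdd])
  define r where "r n = L2_norm_on disc (flux (\<tau> n) (grad disc u))" for n
  have d_le: "L2_norm_on disc (d n) \<le> 2 * r n" for n
  proof -
    let ?v = "\<lambda>x. cnj (un n x - u x)" and ?V = "\<lambda>x. cnj_vec (d n x)"
    have v: "?v \<in> H10 disc" by (rule H10_cnj[OF H0])
    have VL2: "?V \<in> L2_on disc" by (rule L2_on_cnj_vec[OF dL2])
    have gv: "AE x in lebesgue_on disc. grad disc ?v x = ?V x"
      using H1_cnj(2)[OF H10_H1[OF H0[of n]]] H1_diff(2)[OF H(1)[of n] H(2)]
      by eventually_elim (simp add: d_def)
    have E: "energy disc s g (grad disc ?v) = energy disc s g ?V" if "bounded_coeff c s" "g \<in> L2_on disc" for s g c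
      by (rule energy_cong_AE[OF that(1) that(2) grad_L2[OF H10_H1[OF v]] that(2) VL2 _ gv]) simp
    have "energy disc (\<sigma> n) (grad disc (un n)) (grad disc ?v) = f ?v"
      "energy disc ?I (grad disc u) (grad disc ?v) = f ?v"
      using un'(2)[of n] u'(2) v unfolding divergence_equation_def by (blast, blast)
    then have same: "energy disc (\<sigma> n) (grad disc (un n)) ?V = energy disc ?I (grad disc u) ?V"
      using E[OF bdd[of n] grad_L2[OF H(1)[of n]]] E[OF bounded_coeff_mat_1 grad_L2[OF H(2)]] by (simp only:)
    have eq: "energy disc (\<sigma> n) (d n) ?V = energy disc (\<tau> n) (grad disc u) ?V"
    proof -
      have dd: "d n = (\<lambda>x. grad disc (un n) x - grad disc u x)" and tt: "\<tau> n = (\<lambda>x. mat 1 - \<sigma> n x)"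
        by (auto simp: d_def \<tau>_def)
      have "energy disc (\<sigma> n) (d n) ?V = energy disc (\<sigma> n) (grad disc (un n)) ?V - energy disc (\<sigma> n) (grad disc u) ?V"
        using energy_diff_left[OF bdd grad_L2[OF H(1)] grad_L2[OF H(2)] VL2, of n n] by (simp only: dd)
      also have "\<dots> = energy disc ?I (grad disc u) ?V - energy disc (\<sigma> n) (grad disc u) ?V"
        by (simp only: same)
      also have "\<dots> = energy disc (\<tau> n) (grad disc u) ?V"
        using energy_diff_coeff[OF bounded_coeff_mat_1 bdd grad_L2[OF H(2)] VL2, of n] by (simp only: tt)
      finally show ?thesis .
    qed
    have "(L2_norm_on disc (d n))\<^sup>2 \<le> (LINT x|lebesgue_on disc. Re (\<Sum>i\<in>UNIV. flux (\<sigma> n) (d n) x $ i * ?V x $ i))"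
      unfolding L2_norm_on_power2
    proof (rule integral_mono)
      show "integrable (lebesgue_on disc) (\<lambda>x. Re (\<Sum>i\<in>UNIV. flux (\<sigma> n) (d n) x $ i * ?V x $ i))"
        by (rule integrable_Re[OF energy_integrable[OF bdd dL2 VL2]])
      fix x assume "x \<in> space (lebesgue_on disc)"
      then show "(norm (d n x))\<^sup>2 \<le> Re (\<Sum>i\<in>UNIV. flux (\<sigma> n) (d n) x $ i * ?V x $ i)"
        using coercive[of x "d n" n] by simp
    qed (rule L2_onD(2)[OF dL2])
    also have "\<dots> = Re (energy disc (\<sigma> n) (d n) ?V)"
      unfolding energy_flux by (rule integral_Re[OF energy_integrable[OF bdd dL2 VL2]])
    also have "\<dots> \<le> norm (energy disc (\<tau> n) (grad disc u) ?V)"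
      unfolding eq by (rule complex_Re_le_cmod)
    also have "\<dots> \<le> 2 * (r n * L2_norm_on disc ?V)"
      unfolding r_def by (rule energy_bound[OF \<tau> grad_L2[OF H(2)] VL2])
    also have "L2_norm_on disc ?V = L2_norm_on disc (d n)"
      by (rule L2_norm_on_cong) simp
    finally have "L2_norm_on disc (d n) * L2_norm_on disc (d n) \<le> L2_norm_on disc (d n) * (2 * r n)"
      by (simp add: power2_eq_square mult_ac)
    moreover have "0 \<le> r n" by (simp add: r_def)
    ultimately show ?thesis
      using L2_norm_on_nonneg[of disc "d n"]
      by (cases "L2_norm_on disc (d n) = 0") (simp_all add: mult_le_cancel_left_pos)
  qed
  have r0: "r \<longlonglongrightarrow> 0"
  proof -
    let ?U = "grad disc u"
    have UL2: "?U \<in> L2_on disc" by (rule grad_L2[OF H(2)])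
    have fL2: "flux (\<tau> n) ?U \<in> L2_on disc" for n by (rule flux_L2[OF \<tau> UL2])
    have "(\<lambda>n. LINT x|lebesgue_on disc. (norm (flux (\<tau> n) ?U x))\<^sup>2) \<longlonglongrightarrow> (LINT x|lebesgue_on disc. 0)"
    proof (rule integral_dominated_convergence)
      show "integrable (lebesgue_on disc) (\<lambda>x. (4 * (1 + C))\<^sup>2 * (norm (?U x))\<^sup>2)"
        using L2_onD(2)[OF UL2] by simp
      show "(\<lambda>x. (norm (flux (\<tau> n) ?U x))\<^sup>2) \<in> borel_measurable (lebesgue_on disc)" for n
        using L2_onD(1)[OF fL2[of n]] by measurable
      show "AE x in lebesgue_on disc. (\<lambda>n. (norm (flux (\<tau> n) ?U x))\<^sup>2) \<longlonglongrightarrow> 0"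
      proof (rule AE_I2)
        fix x assume "x \<in> space (lebesgue_on disc)"
        then have "\<forall>\<^sub>F n in sequentially. \<sigma> n x = mat 1" using ev by simp
        then have "\<forall>\<^sub>F n in sequentially. (norm (flux (\<tau> n) ?U x))\<^sup>2 = 0"
          by eventually_elim (simp add: flux_def \<tau>_def vec_eq_iff)
        then show "(\<lambda>n. (norm (flux (\<tau> n) ?U x))\<^sup>2) \<longlonglongrightarrow> 0" by (rule tendsto_eventually)
      qed
      show "AE x in lebesgue_on disc. norm ((norm (flux (\<tau> n) ?U x))\<^sup>2) \<le> (4 * (1 + C))\<^sup>2 * (norm (?U x))\<^sup>2" for n
      proof (rule AE_I2)
        fix x assume "x \<in> space (lebesgue_on disc)"
        then have x: "x \<in> disc" by simp
        have "norm (flux (\<tau> n) ?U x) \<le> 4 * (1 + C) * norm (?U x)" by (rule flux_norm_le[OF \<tau> x])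
        then show "norm ((norm (flux (\<tau> n) ?U x))\<^sup>2) \<le> (4 * (1 + C))\<^sup>2 * (norm (?U x))\<^sup>2"
          by (simp add: power_mono flip: power_mult_distrib)
      qed
    qed simp
    then have "(\<lambda>n. sqrt (LINT x|lebesgue_on disc. (norm (flux (\<tau> n) ?U x))\<^sup>2)) \<longlonglongrightarrow> sqrt 0"
      by (intro tendsto_real_sqrt) simp
    then show ?thesis by (simp add: r_def[abs_def] L2_norm_on_def)
  qed
  have H1_le: "H1_norm disc (\<lambda>x. un n x - u x) \<le> 6 * r n" for n
  proof -
    have "L2_norm_on disc (grad disc (\<lambda>x. un n x - u x)) = L2_norm_on disc (d n)"
      unfolding d_def[abs_def] by (rule H1_diff(3)[OF H(1) H(2)])
    then show ?thesis
      using H1_norm_le[of disc "\<lambda>x. un n x - u x"] Poincare_H10[OF H0[of n]] d_le[of n] by linarith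
  qed
  show "weakly_converges_H10 disc un u"
    unfolding weakly_converges_H10_def
  proof
    fix L assume L: "L \<in> Hm1 disc"
    then obtain B where B: "\<forall>w\<in>H10 disc. norm (L w) \<le> B * H1_norm disc w"
      unfolding Hm1_def mem_Collect_eq by blast
    have "norm (L (un n) - L u) \<le> \<bar>B\<bar> * (6 * r n)" for n
    proof -
      have "L (\<lambda>x. (un n x - u x) + u x) = L (\<lambda>x. un n x - u x) + L u"
      proof -
        have add: "\<forall>v\<in>H10 disc. \<forall>w\<in>H10 disc. L (\<lambda>x. v x + w x) = L v + L w"
          using L by (simp add: Hm1_def)
        show ?thesis by (rule bspec[OF bspec[OF add H0] u'(1)])
      qed
      then have "norm (L (un n) - L u) = norm (L (\<lambda>x. un n x - u x))" by simp
      also have "\<dots> \<le> B * H1_norm disc (\<lambda>x. un n x - u x)" by (rule bspec[OF B H0])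
      also have "\<dots> \<le> \<bar>B\<bar> * H1_norm disc (\<lambda>x. un n x - u x)" by (intro mult_right_mono) auto
      also have "\<dots> \<le> \<bar>B\<bar> * (6 * r n)" by (intro mult_left_mono H1_le) auto
      finally show ?thesis .
    qed
    moreover have "(\<lambda>n. \<bar>B\<bar> * (6 * r n)) \<longlonglongrightarrow> 0"
      by (intro tendsto_mult_right_zero r0)
    ultimately have "(\<lambda>n. norm (L (un n) - L u)) \<longlonglongrightarrow> 0"
      by (rule nonneg_null_comparison[OF norm_ge_zero])
    then show "(\<lambda>n. L (un n)) \<longlonglongrightarrow> L u" using LIM_zero_cancel tendsto_norm_zero_iff by blast
  qed
qed

section \<open>Reciprocity of the Dirichlet-to-Neumann map\<close>

text \<open>
  The energy form is Hermitian, so the value of \<open>\<Lambda>\<^sub>\<sigma> \<phi>\<close> at \<open>\<psi>\<close> is determined by any solution with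
  boundary values \<open>\<psi>\<close>.
\<close>

lemma is_DN_reciprocal:
  assumes sym: "\<And>x. x \<in> disc \<Longrightarrow> transpose (\<sigma> x) = \<sigma> x"
    and T: "is_DN \<sigma> \<phi> T" and S: "is_DN \<sigma> \<psi> S"
  shows "T \<psi> = cnj (S \<phi>)"
proof -
  obtain u where u: "has_trace u \<phi>"
    "\<And>\<psi> v. has_trace v \<psi> \<Longrightarrow> T \<psi> = energy disc \<sigma> (grad disc u) (\<lambda>x. \<chi> i. cnj (grad disc v x $ i))"
    using T unfolding is_DN_def by blast
  obtain v where v: "has_trace v \<psi>"
    "\<And>\<phi> u. has_trace u \<phi> \<Longrightarrow> S \<phi> = energy disc \<sigma> (grad disc v) (\<lambda>x. \<chi> i. cnj (grad disc u x $ i))"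
    using S unfolding is_DN_def by blast
  show ?thesis
    unfolding u(2)[OF v(1)] v(2)[OF u(1)]
    using energy_hermitian[OF sym, where g="grad disc u" and h="grad disc v"] by (simp add: cnj_vec_def)
qed

section \<open>Polar coordinates\<close>

lemma circle_point_nth [simp]: "circle_point \<theta> $ 1 = cos \<theta>" "circle_point \<theta> $ 2 = sin \<theta>"
  by (auto simp: circle_point_def vector_2)

lemma norm_circle_point [simp]: "norm (circle_point \<theta>) = 1"
proof -
  have "(norm (circle_point \<theta>))\<^sup>2 = 1" by (simp add: norm_plane_power2)
  then show ?thesis using norm_ge_zero[of "circle_point \<theta>"] by (auto simp: power2_eq_1_iff simp del: norm_ge_zero)
qed

lemma circle_point_has_derivative:
  "(circle_point has_derivative (\<lambda>h. h *\<^sub>R (- sin \<theta> *\<^sub>R axis 1 1 + cos \<theta> *\<^sub>R axis 2 1))) (at \<theta> within S)"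
proof -
  have eq: "circle_point = (\<lambda>\<theta>. cos \<theta> *\<^sub>R axis 1 1 + sin \<theta> *\<^sub>R axis 2 1)"
    by (rule ext) (simp add: vec_eq_iff forall_2 axis_def)
  show ?thesis unfolding eq
    by (auto intro!: derivative_eq_intros simp: algebra_simps)
qed

lemma continuous_on_circle_point: "continuous_on S circle_point"
  using circle_point_has_derivative by (meson continuous_on_eq_continuous_within has_derivative_continuous)

lemma borel_measurable_bounded_absolutely_integrable:
  fixes f :: "'a::euclidean_space \<Rightarrow> 'b::euclidean_space"
  assumes "f \<in> borel_measurable borel" "S \<in> lmeasurable" "\<And>x. x \<in> S \<Longrightarrow> norm (f x) \<le> B"
  shows "f absolutely_integrable_on S"
proof (rule measurable_bounded_by_integrable_imp_absolutely_integrable)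
  have "f \<in> borel_measurable lebesgue" using assms(1) by (simp add: measurable_completion)
  then show "f \<in> borel_measurable (lebesgue_on S)" by (rule measurable_restrict_space1)
  show "(\<lambda>x. B) integrable_on S" using assms(2) by (rule integrable_on_const)
qed (use assms in \<open>auto simp: fmeasurableD\<close>)

text \<open>The open rectangle misses only a radius of the disc, so that no mass is lost.\<close>

lemma polar_image:
  defines "P \<equiv> (\<lambda>x :: plane. (x $ 1) *\<^sub>R circle_point (x $ 2))"
  defines "S \<equiv> box 0 (\<chi> i. if i = 1 then 1 else 2 * pi) :: plane set"
  shows "inj_on P S" "P ` S \<subseteq> disc" "negligible (disc - P ` S)"
proof -
  have S: "x \<in> S \<longleftrightarrow> 0 < x $ 1 \<and> x $ 1 < 1 \<and> 0 < x $ 2 \<and> x $ 2 < 2 * pi" for x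
    by (auto simp: S_def mem_box_cart forall_2)
  show "inj_on P S"
  proof (rule inj_onI)
    fix x y assume x: "x \<in> S" and y: "y \<in> S" and eq: "P x = P y"
    have "norm (P x) = norm (P y)" using eq by simp
    then have 1: "x $ 1 = y $ 1" using x y by (simp add: P_def S)
    then have "circle_point (x $ 2) = circle_point (y $ 2)" using eq x by (simp add: P_def S)
    then have "cos (x $ 2) = cos (y $ 2)" "sin (x $ 2) = sin (y $ 2)" by (metis circle_point_nth)+
    then obtain n :: int where n: "x $ 2 = y $ 2 + 2 * pi * n" using sin_cos_eq_iff by metis
    have "\<bar>2 * pi * real_of_int n\<bar> < 2 * pi * 1" using x y n unfolding S by linarith
    then have "\<bar>real_of_int n\<bar> < 1" by (simp add: abs_mult)
    then have "n = 0" by linarith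
    then show "x = y" using 1 n by (simp add: vec_eq_iff forall_2)
  qed
  show "P ` S \<subseteq> disc" by (auto simp: P_def S disc_eq)
  have "disc - P ` S \<subseteq> {x. x $ 2 = 0}"
  proof
    fix x assume x: "x \<in> disc - P ` S"
    show "x \<in> {x. x $ 2 = 0}"
    proof (rule ccontr)
      assume "x \<notin> {x. x $ 2 = 0}"
      then have x2: "x $ 2 \<noteq> 0" by simp
      then have r: "0 < norm x" by auto
      have "(x $ 1 / norm x)\<^sup>2 + (x $ 2 / norm x)\<^sup>2 = 1"
      proof -
        have "(x $ 1 / norm x)\<^sup>2 + (x $ 2 / norm x)\<^sup>2 = (norm x)\<^sup>2 / (norm x)\<^sup>2"
          unfolding power_divide add_divide_distrib[symmetric] norm_plane_power2[symmetric] ..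
        then show ?thesis using r by simp
      qed
      then obtain t where t: "0 \<le> t" "t < 2 * pi" "x $ 1 / norm x = cos t" "x $ 2 / norm x = sin t"
        by (rule sincos_total_2pi)
      have "t \<noteq> 0" using t(4) x2 r by auto
      then have "(\<chi> i. if i = 1 then norm x else t) \<in> S" using t r x by (auto simp: S disc_eq)
      moreover have "P (\<chi> i. if i = 1 then norm x else t) = x"
      proof -
        have "norm x * cos t = x $ 1" "norm x * sin t = x $ 2"
          using r by (simp_all flip: t(3,4))
        then show ?thesis by (simp add: P_def vec_eq_iff forall_2)
      qed
      ultimately show False using x by force
    qed
  qed
  then show "negligible (disc - P ` S)"
    using negligible_subset negligible_standard_hyperplane_cart by blast
qed

lemma borel_measurable_pair_to_plane:
  "(\<lambda>p :: real \<times> real. (\<chi> i. if i = 1 then fst p else snd p) :: plane) \<in> borel_measurable borel"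
proof (rule borel_measurable_continuous_onI, rule continuous_on_vec_lambda)
  show "continuous_on UNIV (\<lambda>p :: real \<times> real. if i = 1 then fst p else snd p)" for i :: 2
    by (cases "i = 1") (auto intro!: continuous_intros)
qed

lemma lborel_plane_eq_distr:
  "(lborel :: plane measure) = distr lborel borel (\<lambda>p. \<chi> i. if i = 1 then fst p else snd p)"
proof (rule lborel_eqI)
  let ?v = "\<lambda>p :: real \<times> real. (\<chi> i. if i = 1 then fst p else snd p) :: plane"
  note m = borel_measurable_pair_to_plane
  fix l u :: plane assume le: "\<And>b. b \<in> Basis \<Longrightarrow> l \<bullet> b \<le> u \<bullet> b"
  have lu: "l $ i \<le> u $ i" for i using le[of "axis i 1"] by (simp add: inner_axis)
  have pre: "?v -` box l u = box (l $ 1, l $ 2) (u $ 1, u $ 2)"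
    by (auto simp: mem_box_cart forall_2 mem_box Basis_prod_def)
  have "emeasure (distr lborel borel ?v) (box l u) = emeasure lborel (box (l $ 1, l $ 2) (u $ 1, u $ 2))"
    using m pre by (subst emeasure_distr) auto
  also have "\<dots> = (\<Prod>b\<in>Basis. ((u $ 1, u $ 2) - (l $ 1, l $ 2)) \<bullet> b)"
    by (rule emeasure_lborel_box) (use lu in \<open>auto simp: Basis_prod_def\<close>)
  also have "(\<Prod>b\<in>Basis. ((u $ 1, u $ 2) - (l $ 1, l $ 2)) \<bullet> b) = (u $ 1 - l $ 1) * (u $ 2 - l $ 2)"
    by (simp add: Basis_prod_def prod.union_disjoint prod.reindex inj_on_def disjoint_iff)
  also have "\<dots> = (\<Prod>i\<in>UNIV. (u - l) $ i)" by (simp add: UNIV_2)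
  also have "\<dots> = (\<Prod>b\<in>Basis. (u - l) \<bullet> b)"
  proof -
    have Basis: "(Basis :: plane set) = range (\<lambda>i :: 2. axis i 1)" by (auto simp: Basis_vec_def)
    have "inj (\<lambda>i :: 2. axis i (1::real))" by (auto simp: inj_on_def axis_eq_axis)
    from prod.reindex[OF this] have "(\<Prod>b\<in>Basis. (u - l) \<bullet> b) = (\<Prod>i\<in>UNIV. (u - l) \<bullet> axis i 1)"
      unfolding Basis o_def .
    then show ?thesis by (simp add: inner_axis)
  qed
  finally show "emeasure (distr lborel borel ?v) (box l u) = ennreal (\<Prod>b\<in>Basis. (u - l) \<bullet> b)" .
qed simp

text \<open>
  The change of variables formula concerns vector-valued functions and the box in \<open>\<real>\<^sup>2\<close>; it is applied
  after identifying \<open>\<complex>\<close> with \<open>\<real>\<^sup>2\<close>, and the box is identified with a rectangle in \<open>\<real> \<times> \<real>\<close> afterwards to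
  make Fubini's theorem applicable.  The factor \<open>fst p\<close> is the Jacobian determinant.
\<close>

lemma polar_coordinates:
  fixes f :: "plane \<Rightarrow> complex"
  assumes f: "f \<in> borel_measurable borel" and B: "\<And>x. x \<in> disc \<Longrightarrow> norm (f x) \<le> B"
  shows "(LINT x|lebesgue_on disc. f x)
    = (LINT p|lborel. indicator ({0..1} \<times> {0..2*pi}) p *\<^sub>R (fst p *\<^sub>R f (fst p *\<^sub>R circle_point (snd p))))"
proof -
  define P where "P = (\<lambda>x :: plane. (x $ 1) *\<^sub>R circle_point (x $ 2))"
  define b where "b = ((\<chi> i. if i = 1 then 1 else 2 * pi) :: plane)"
  define v where "v z = (\<chi> i. if i = 1 then Re z else Im z :: real ^ 2)" for z
  define c where "c y = Complex (y $ 1) (y $ 2)" for y :: "real ^ 2"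
  have cv: "c (v z) = z" for z by (simp add: c_def v_def)
  have blc: "bounded_linear c"
  proof -
    have "bounded_linear (\<lambda>y :: real ^ 2. of_real (y $ 1) + \<i> * of_real (y $ 2))"
      by (intro bounded_linear_add bounded_linear_const_mult
          bounded_linear_compose[OF bounded_linear_of_real bounded_linear_vec_nth])
    moreover have "c = (\<lambda>y :: real ^ 2. of_real (y $ 1) + \<i> * of_real (y $ 2))"
      by (rule ext) (simp add: c_def Complex_eq)
    ultimately show ?thesis by simp
  qed
  have vlin: "v (r *\<^sub>R z) = r *\<^sub>R v z" for r z by (simp add: v_def vec_eq_iff forall_2)
  have normv: "norm (v z) = norm z" for z
    by (simp add: v_def norm_vec_def L2_set_def sum_2 cmod_def)
  have vm: "v \<in> borel_measurable borel"
  proof (rule borel_measurable_continuous_onI)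
    have "continuous_on UNIV (\<lambda>z. if i = 1 then Re z else Im z)" for i :: 2
      by (cases "i = 1") (auto intro!: continuous_intros)
    then show "continuous_on UNIV v" unfolding v_def by (rule continuous_on_vec_lambda)
  qed
  note img = polar_image[folded P_def b_def]
  have Pm: "P \<in> borel_measurable borel"
    unfolding P_def
    by (intro borel_measurable_continuous_onI continuous_intros continuous_on_compose2[OF continuous_on_circle_point[of UNIV]]) auto
  define D where "D x h = (h $ 1) *\<^sub>R circle_point (x $ 2)
      + ((x $ 1) * (h $ 2)) *\<^sub>R (- sin (x $ 2) *\<^sub>R axis 1 1 + cos (x $ 2) *\<^sub>R axis 2 1)" for x h :: plane
  have der: "(P has_derivative D x) (at x within S)" for x S
  proof -
    have 1: "((\<lambda>x :: plane. x $ i) has_derivative (\<lambda>h. h $ i)) (at x within S)" for i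
      by (rule bounded_linear_imp_has_derivative[OF bounded_linear_vec_nth])
    have "((\<lambda>x :: plane. circle_point (x $ 2)) has_derivative
        (\<lambda>h. (h $ 2) *\<^sub>R (- sin (x $ 2) *\<^sub>R axis 1 1 + cos (x $ 2) *\<^sub>R axis 2 1))) (at x within S)"
      by (rule has_derivative_compose[OF 1 circle_point_has_derivative])
    from has_derivative_scaleR[OF 1[of 1] this] show ?thesis
      unfolding P_def D_def by (simp add: add.commute)
  qed
  have det: "det (matrix (D x)) = x $ 1" for x
    by (simp add: det_2 matrix_def D_def axis_def power2_eq_square[symmetric] flip: distrib_left)
       (simp add: algebra_simps flip: power2_eq_square distrib_left)
  have fv: "(\<lambda>x. v (f x)) \<in> borel_measurable borel" using f vm by measurable
  have PS_leb: "P ` box 0 b \<in> lmeasurable"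
  proof -
    have "disc - (disc - P ` box 0 b) \<in> lmeasurable"
      by (rule fmeasurable.Diff) (use img(3) in \<open>auto simp: negligible_imp_measurable\<close>)
    then show ?thesis using img(2) by (simp add: Diff_Diff_Int Int_absorb1)
  qed
  have "(\<lambda>x. v (f x)) absolutely_integrable_on P ` box 0 b"
    by (rule borel_measurable_bounded_absolutely_integrable[OF fv PS_leb]) (use img(2) B normv in auto)
  then have cv1: "(\<lambda>x. \<bar>x $ 1\<bar> *\<^sub>R v (f (P x))) absolutely_integrable_on box 0 b
      \<and> integral (box 0 b) (\<lambda>x. \<bar>x $ 1\<bar> *\<^sub>R v (f (P x))) = integral (P ` box 0 b) (\<lambda>x. v (f x))"
    using has_absolute_integral_change_of_variables[OF _ der img(1), where f="\<lambda>x. v (f x)"] det by simp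
  have "integral (P ` box 0 b) (\<lambda>x. v (f x)) = integral disc (\<lambda>x. v (f x))"
    by (rule integral_subset_negligible[OF img(2,3)])
  moreover have "integral (box 0 b) (\<lambda>x. \<bar>x $ 1\<bar> *\<^sub>R v (f (P x))) = integral (cbox 0 b) (\<lambda>x. (x $ 1) *\<^sub>R v (f (P x)))"
    unfolding integral_open_interval[symmetric]
    by (rule Henstock_Kurzweil_Integration.integral_cong) (simp add: mem_box_cart less_imp_le)
  ultimately have eq: "integral disc (\<lambda>x. v (f x)) = integral (cbox 0 b) (\<lambda>x. (x $ 1) *\<^sub>R v (f (P x)))"
    using cv1 by simp
  have int1: "f absolutely_integrable_on disc" "(\<lambda>x. v (f x)) absolutely_integrable_on disc"
    by (rule borel_measurable_bounded_absolutely_integrable[OF f disc_lmeasurable B],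
        assumption, rule borel_measurable_bounded_absolutely_integrable[OF fv disc_lmeasurable, of B])
       (simp add: normv B)
  let ?G = "\<lambda>x. (x $ 1) *\<^sub>R f (P x)"
  have Gm: "?G \<in> borel_measurable borel"
  proof -
    have "(\<lambda>x :: plane. x $ 1) \<in> borel_measurable borel"
      by (intro borel_measurable_continuous_onI continuous_intros)
    then show ?thesis using f Pm by measurable
  qed
  have "(\<lambda>x. (x $ 1) *\<^sub>R v (f (P x))) integrable_on cbox 0 b"
  proof -
    have "(\<lambda>x. \<bar>x $ 1\<bar> *\<^sub>R v (f (P x))) integrable_on box 0 b"
      using cv1 set_lebesgue_integral_eq_integral(1) by blast
    then have "(\<lambda>x. (x $ 1) *\<^sub>R v (f (P x))) integrable_on box 0 b"
      by (rule integrable_eq) (simp add: mem_box_cart less_imp_le)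
    then show ?thesis by (simp add: integrable_on_open_interval)
  qed
  then have "c (integral (cbox 0 b) (\<lambda>x. (x $ 1) *\<^sub>R v (f (P x)))) = integral (cbox 0 b) ?G"
    using integral_linear[OF _ blc, of "\<lambda>x. (x $ 1) *\<^sub>R v (f (P x))" "cbox 0 b"]
    by (simp add: o_def cv flip: vlin)
  moreover have "c (integral disc (\<lambda>x. v (f x))) = integral disc f"
    using integral_linear[OF set_lebesgue_integral_eq_integral(1)[OF int1(2)] blc] by (simp add: o_def cv)
  ultimately have "integral disc f = integral (cbox 0 b) ?G"
    using eq by simp
  moreover have "(LINT x|lebesgue_on disc. f x) = integral disc f"
  proof -
    have "(LINT x|lebesgue_on disc. f x) = (LINT x:disc|lebesgue. f x)"
      unfolding set_lebesgue_integral_def by (rule integral_restrict_space) simp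
    then show ?thesis using set_lebesgue_integral_eq_integral(2)[OF int1(1)] by simp
  qed
  moreover have "integral (cbox 0 b) ?G = (LINT x|lborel. indicator (cbox 0 b) x *\<^sub>R ?G x)"
  proof -
    have ai: "?G absolutely_integrable_on box 0 b"
    proof -
      have "(\<lambda>x. c (\<bar>x $ 1\<bar> *\<^sub>R v (f (P x)))) absolutely_integrable_on box 0 b"
        using absolutely_integrable_linear[OF _ blc] cv1 by (auto simp: o_def)
      then show ?thesis
        by (rule set_integrable_cong[THEN iffD1, rotated -1])
           (simp_all add: mem_box_cart less_imp_le vlin[symmetric] cv)
    qed
    have "?G absolutely_integrable_on cbox 0 b"
    proof (subst absolutely_integrable_spike_set_eq)
      have "negligible (cbox 0 b - box 0 b)" by (rule negligible_frontier_interval)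
      then show "negligible {x \<in> cbox 0 b - box 0 b. ?G x \<noteq> 0}" by (rule negligible_subset) auto
      have "{x \<in> box 0 b - cbox 0 b. ?G x \<noteq> 0} = {}" using box_subset_cbox by blast
      then show "negligible {x \<in> box 0 b - cbox 0 b. ?G x \<noteq> 0}" by (simp only: negligible_empty)
    qed (rule ai)
    then have "integral (cbox 0 b) ?G = (LINT x|lebesgue. indicator (cbox 0 b) x *\<^sub>R ?G x)"
      by (rule set_lebesgue_integral_eq_integral(2)[unfolded set_lebesgue_integral_def, symmetric])
    also have "\<dots> = (LINT x|lborel. indicator (cbox 0 b) x *\<^sub>R ?G x)"
      by (rule integral_completion) (use Gm in measurable)
    finally show ?thesis .
  qed
  moreover have "(LINT x|lborel. indicator (cbox 0 b) x *\<^sub>R ?G x)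
      = (LINT p|lborel. indicator ({0..1} \<times> {0..2*pi}) p *\<^sub>R (fst p *\<^sub>R f (fst p *\<^sub>R circle_point (snd p))))"
  proof -
    let ?v = "\<lambda>p :: real \<times> real. (\<chi> i. if i = 1 then fst p else snd p) :: plane"
    note m = borel_measurable_pair_to_plane
    have Hm: "(\<lambda>x. indicator (cbox 0 b) x *\<^sub>R ?G x) \<in> borel_measurable borel" using Gm by measurable
    have "(LINT x|lborel. indicator (cbox 0 b) x *\<^sub>R ?G x) = (LINT p|lborel. indicator (cbox 0 b) (?v p) *\<^sub>R ?G (?v p))"
      by (subst lborel_plane_eq_distr, rule integral_distr) (use m Hm in auto)
    also have "\<dots> = (LINT p|lborel. indicator ({0..1} \<times> {0..2*pi}) p *\<^sub>R (fst p *\<^sub>R f (fst p *\<^sub>R circle_point (snd p))))"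
      by (rule Bochner_Integration.integral_cong)
         (auto simp: indicator_def mem_box_cart forall_2 b_def P_def)
    finally show ?thesis .
  qed
  ultimately show ?thesis by simp
qed

section \<open>Functions with a single angular mode\<close>

definition cplx :: "plane \<Rightarrow> complex" where
  "cplx x = Complex (x $ 1) (x $ 2)"

text \<open>
  A function \<open>f(r) e\<^sup>i\<^sup>N\<^sup>\<theta>\<close> is written with \<open>f(r) = r\<^sup>N h(r\<^sup>2)\<close>, so that the smoothness of \<open>h\<close> passes to the
  function even at the origin.
\<close>

definition radial_mode :: "nat \<Rightarrow> (real \<Rightarrow> real) \<Rightarrow> plane \<Rightarrow> complex" where
  "radial_mode N h x = cplx x ^ N * of_real (h ((norm x)\<^sup>2))"

lemma cplx_eq: "cplx = (\<lambda>x. of_real (x $ 1) + \<i> * of_real (x $ 2))"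
  by (rule ext) (simp add: cplx_def Complex_eq)

lemma bounded_linear_cplx: "bounded_linear cplx"
  unfolding cplx_eq
  by (intro bounded_linear_add bounded_linear_const_mult
      bounded_linear_compose[OF bounded_linear_of_real bounded_linear_vec_nth])

lemma smooth_cplx: "smooth cplx"
  by (rule smooth_bounded_linear[OF bounded_linear_cplx])

lemma norm_cplx [simp]: "norm (cplx x) = norm x"
  by (simp add: cplx_def cmod_def norm_vec_def L2_set_def sum_2)

lemma cplx_axis [simp]: "cplx (axis 1 1) = 1" "cplx (axis 2 1) = \<i>"
  by (auto simp: cplx_def axis_def complex_eq_iff)

lemma norm_cplx_axis [simp]: "norm (cplx (axis i 1)) = 1"
  by (simp add: norm_axis_1)

lemma cplx_circle_point: "cplx (circle_point \<theta>) ^ N = circle_mode (int N) \<theta>"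
proof -
  have "cplx (circle_point \<theta>) = cis \<theta>" by (simp add: cplx_def cis.ctr)
  then show ?thesis by (simp add: circle_mode_def Complex.DeMoivre)
qed

lemma norm_power2_has_derivative:
  "((\<lambda>x :: plane. (norm x)\<^sup>2) has_derivative (\<lambda>k. 2 * (x \<bullet> k))) (at x)"
  unfolding power2_norm_eq_inner
  by (auto intro!: derivative_eq_intros simp: inner_commute)

lemma radial_part_has_derivative:
  assumes "(h has_real_derivative h') (at ((norm x)\<^sup>2))"
  shows "((\<lambda>x :: plane. complex_of_real (h ((norm x)\<^sup>2))) has_derivative (\<lambda>k. of_real (h' * (2 * (x \<bullet> k))))) (at x)"
  by (rule has_derivative_of_real, rule has_derivative_compose[OF norm_power2_has_derivative])
     (rule assms[unfolded has_field_derivative_def])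

lemma radial_mode_partial:
  assumes d: "\<And>y. 0 \<le> y \<Longrightarrow> (h has_real_derivative h' y) (at y)"
  shows "radial_mode N h differentiable (at x)"
    and "partial i (radial_mode N h) x =
      of_nat N * cplx (axis i 1) * cplx x ^ (N - 1) * of_real (h ((norm x)\<^sup>2))
      + cplx x ^ N * of_real (h' ((norm x)\<^sup>2) * (2 * x $ i))"
proof -
  have 1: "((\<lambda>x. cplx x ^ N) has_derivative (\<lambda>k. of_nat N * cplx k * cplx x ^ (N - 1))) (at x)"
    by (rule has_derivative_power[OF bounded_linear_imp_has_derivative[OF bounded_linear_cplx]])
  have "(h has_real_derivative h' ((norm x)\<^sup>2)) (at ((norm x)\<^sup>2))" by (rule d) simp
  note D = has_derivative_mult[OF 1 radial_part_has_derivative[OF this]]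
  show "radial_mode N h differentiable (at x)"
    unfolding radial_mode_def[abs_def] by (rule differentiableI[OF D])
  show "partial i (radial_mode N h) x =
      of_nat N * cplx (axis i 1) * cplx x ^ (N - 1) * of_real (h ((norm x)\<^sup>2))
      + cplx x ^ N * of_real (h' ((norm x)\<^sup>2) * (2 * x $ i))"
    unfolding radial_mode_def[abs_def] using partial_eqI[OF D, of i]
    by (simp add: inner_axis)
qed

lemma Ck_radial_mode:
  assumes d: "\<And>y. 0 \<le> y \<Longrightarrow> (h has_real_derivative h' y) (at y)" and c: "continuous_on {0..} h'"
  shows "Ck (Suc 0) (radial_mode N h)"
proof -
  have ch: "continuous_on {0..} h"
    by (intro continuous_at_imp_continuous_on ballI) (auto intro: DERIV_isCont[OF d])
  have comp: "continuous_on UNIV (\<lambda>x :: plane. f ((norm x)\<^sup>2))" if "continuous_on {0..} f" for f :: "real \<Rightarrow> real"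
    by (rule continuous_on_compose2[OF that]) (auto intro!: continuous_intros)
  have cc: "continuous_on UNIV cplx" by (rule linear_continuous_on[OF bounded_linear_cplx])
  have "partial i (radial_mode N h) = (\<lambda>x. of_nat N * cplx (axis i 1) * cplx x ^ (N - 1) * of_real (h ((norm x)\<^sup>2))
      + cplx x ^ N * of_real (h' ((norm x)\<^sup>2) * (2 * x $ i)))" for i
    by (rule ext) (rule radial_mode_partial(2)[OF d])
  moreover have "continuous_on UNIV (\<lambda>x. of_nat N * cplx (axis i 1) * cplx x ^ (N - 1) * of_real (h ((norm x)\<^sup>2))
      + cplx x ^ N * of_real (h' ((norm x)\<^sup>2) * (2 * x $ i)))" for i
    by (intro continuous_intros cc comp ch c)
  ultimately show ?thesis using radial_mode_partial(1)[OF d] by simp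
qed

lemma smooth_radial_mode_polynomial: "smooth (radial_mode N (\<lambda>y. \<Sum>k\<le>n. a k * y ^ k))"
  unfolding radial_mode_def[abs_def] of_real_sum of_real_mult[of "a _"] of_real_power[of "(norm _)\<^sup>2"]
  by (intro smooth_mult smooth_power smooth_sum smooth_const smooth_cplx smooth_norm_power2)

text \<open>Approximating \<open>h'\<close> uniformly by polynomials and integrating approximates \<open>h\<close> in \<open>C\<^sup>1\<close>.\<close>

lemma polynomial_C1_approximation:
  fixes h h' :: "real \<Rightarrow> real"
  assumes d: "\<And>y. 0 \<le> y \<Longrightarrow> (h has_real_derivative h' y) (at y)" and c: "continuous_on {0..} h'" and e: "0 < e"
  obtains n a where
    "\<And>y. y \<in> {0..1} \<Longrightarrow> \<bar>(\<Sum>k\<le>n. a k * y ^ k) - h y\<bar> \<le> e"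
    "\<And>y. y \<in> {0..1} \<Longrightarrow> \<bar>(\<Sum>k<n. real (Suc k) * a (Suc k) * y ^ k) - h' y\<bar> \<le> e"
    "\<And>y. ((\<lambda>y. \<Sum>k\<le>n. a k * y ^ k) has_real_derivative (\<Sum>k<n. real (Suc k) * a (Suc k) * y ^ k)) (at y)"
proof -
  have "continuous_on {0..1} h'" using c by (rule continuous_on_subset) auto
  then obtain p where p: "polynomial_function p" "\<And>y. y \<in> {0..1} \<Longrightarrow> norm (h' y - p y) < e"
    using Stone_Weierstrass_polynomial_function[of "{0..1}" h' e] e by auto
  then obtain b m where b: "p = (\<lambda>y. \<Sum>k\<le>m. b k * y ^ k)"
    using real_polynomial_function_iff_sum[of p] by (auto simp: real_polynomial_function_eq)
  define a where "a k = (case k of 0 \<Rightarrow> h 0 | Suc j \<Rightarrow> b j / real (Suc j))" for k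
  let ?q = "\<lambda>y. \<Sum>k\<le>Suc m. a k * y ^ k"
  have p_eq: "(\<Sum>k<Suc m. real (Suc k) * a (Suc k) * y ^ k) = p y" for y
    unfolding b lessThan_Suc_atMost by (rule sum.cong) (simp_all add: a_def)
  have dq: "(?q has_real_derivative (\<Sum>k<Suc m. real (Suc k) * a (Suc k) * y ^ k)) (at y)" for y
  proof -
    have "(?q has_real_derivative (\<Sum>k\<le>Suc m. a k * (real k * y ^ (k - 1)))) (at y)"
    proof (rule DERIV_sum)
      show "((\<lambda>y. a k * y ^ k) has_real_derivative a k * (real k * y ^ (k - 1))) (at y)" for k
        using DERIV_cmult[OF DERIV_pow[of k y]] by simp
    qed
    also have "(\<Sum>k\<le>Suc m. a k * (real k * y ^ (k - 1))) = (\<Sum>k<Suc m. real (Suc k) * a (Suc k) * y ^ k)"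
      by (simp add: sum.atMost_Suc_shift lessThan_Suc_atMost mult_ac del: sum.atMost_Suc sum.lessThan_Suc)
    finally show ?thesis .
  qed
  have "\<bar>?q y - h y\<bar> \<le> e" if y: "y \<in> {0..1}" for y
  proof -
    have q0: "?q 0 = h 0" by (simp add: sum.atMost_Suc_shift a_def del: sum.atMost_Suc)
    have "norm ((?q y - h y) - (?q 0 - h 0)) \<le> e * norm (y - 0)"
    proof (rule field_differentiable_bound[where S="{0..1}" and f'="\<lambda>y. p y - h' y"])
      fix z :: real assume z: "z \<in> {0..1}"
      have "((\<lambda>y. ?q y - h y) has_real_derivative p z - h' z) (at z)"
        using DERIV_diff[OF dq d] z by (simp only: p_eq) simp
      then show "((\<lambda>y. ?q y - h y) has_real_derivative p z - h' z) (at z within {0..1})"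
        by (rule has_field_derivative_at_within)
      show "norm (p z - h' z) \<le> e" using p(2)[OF z] by (simp add: norm_minus_commute)
    qed (use y in auto)
    also have "\<dots> \<le> e" using y e by (simp add: mult_left_le)
    finally show ?thesis using q0 by simp
  qed
  moreover have "\<bar>(\<Sum>k<Suc m. real (Suc k) * a (Suc k) * y ^ k) - h' y\<bar> \<le> e" if "y \<in> {0..1}" for y
    using p(2)[OF that] unfolding p_eq by simp
  ultimately show ?thesis using dq that[where n="Suc m" and a=a] by blast
qed

text \<open>
  The profile need not be smooth, so the function is approximated by the modes of the polynomials
  that approximate \<open>h\<close>; the approximation is uniform up to the circle, together with the gradients.
\<close>

lemma has_trace_radial_mode:
  assumes d: "\<And>y. 0 \<le> y \<Longrightarrow> (h has_real_derivative h' y) (at y)" and c: "continuous_on {0..} h'"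
  shows "has_trace (radial_mode N h) (\<lambda>\<theta>. of_real (h 1) * circle_mode (int N) \<theta>)"
proof -
  let ?u = "radial_mode N h" and ?\<phi> = "\<lambda>\<theta>. of_real (h 1) * circle_mode (int N) \<theta>"
  have Cu: "Ck (Suc 0) ?u" using d c by (rule Ck_radial_mode)
  have "\<exists>w w'. smooth (radial_mode N w) \<and> (\<forall>y. (w has_real_derivative w' y) (at y)) \<and>
      (\<forall>y\<in>{0..1}. \<bar>w y - h y\<bar> \<le> inverse (real (Suc j)) \<and> \<bar>w' y - h' y\<bar> \<le> inverse (real (Suc j)))" for j
  proof -
    obtain n a where
      "\<And>y. y \<in> {0..1} \<Longrightarrow> \<bar>(\<Sum>k\<le>n. a k * y ^ k) - h y\<bar> \<le> inverse (real (Suc j))"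
      "\<And>y. y \<in> {0..1} \<Longrightarrow> \<bar>(\<Sum>k<n. real (Suc k) * a (Suc k) * y ^ k) - h' y\<bar> \<le> inverse (real (Suc j))"
      "\<And>y. ((\<lambda>y. \<Sum>k\<le>n. a k * y ^ k) has_real_derivative (\<Sum>k<n. real (Suc k) * a (Suc k) * y ^ k)) (at y)"
      by (rule polynomial_C1_approximation[OF d c, of "inverse (real (Suc j))"]) auto
    then show ?thesis
      by (intro exI[of _ "\<lambda>y. \<Sum>k\<le>n. a k * y ^ k"] exI[of _ "\<lambda>y. \<Sum>k<n. real (Suc k) * a (Suc k) * y ^ k"]
          conjI allI ballI smooth_radial_mode_polynomial) auto
  qed
  then obtain w w' where w: "\<And>j. smooth (radial_mode N (w j))" "\<And>j y. (w j has_real_derivative w' j y) (at y)"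
    "\<And>j y. y \<in> {0..1} \<Longrightarrow> \<bar>w j y - h y\<bar> \<le> inverse (real (Suc j))"
    "\<And>j y. y \<in> {0..1} \<Longrightarrow> \<bar>w' j y - h' y\<bar> \<le> inverse (real (Suc j))"
    by metis
  define W where "W j = radial_mode N (w j)" for j
  have W: "W j \<in> H1 disc" for j unfolding W_def by (rule H1_smooth[OF w(1)])
  have CW: "Ck (Suc 0) (W j)" for j unfolding W_def by (rule smooth_Ck[OF w(1)])
  have u: "?u \<in> H1 disc" by (rule H1_classical(1)[OF Cu])
  have pow: "norm (cplx x ^ n) \<le> 1" if "x \<in> cball 0 1" for x n
    using that by (simp add: norm_power power_le_one)
  have y01: "(norm x)\<^sup>2 \<in> {0..1}" if "x \<in> cball 0 1" for x :: plane
    using that by (simp add: power_le_one)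
  have W_le: "norm (W j x - ?u x) \<le> inverse (real (Suc j))" if x: "x \<in> cball 0 1" for j x
  proof -
    have "W j x - ?u x = cplx x ^ N * of_real (w j ((norm x)\<^sup>2) - h ((norm x)\<^sup>2))"
      by (simp add: W_def radial_mode_def algebra_simps)
    also have "norm \<dots> \<le> 1 * inverse (real (Suc j))"
      unfolding norm_mult norm_of_real
      by (intro mult_mono pow[OF x] w(3)[OF y01[OF x]]) auto
    finally show ?thesis by simp
  qed
  have g_le: "norm (classical_grad (W j) x - classical_grad ?u x) \<le> 2 * (real N + 2) * inverse (real (Suc j))"
    if x: "x \<in> cball 0 1" for j x
  proof -
    have comp: "norm ((classical_grad (W j) x - classical_grad ?u x) $ i) \<le> (real N + 2) * inverse (real (Suc j))" for i
    proof -
      let ?y = "(norm x)\<^sup>2"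
      have xi: "\<bar>x $ i\<bar> \<le> 1" using component_le_norm_cart[of x i] x by simp
      have "(classical_grad (W j) x - classical_grad ?u x) $ i =
          (of_nat N * cplx (axis i 1)) * cplx x ^ (N - 1) * of_real (w j ?y - h ?y)
          + cplx x ^ N * of_real ((w' j ?y - h' ?y) * (2 * x $ i))"
        using radial_mode_partial(2)[OF w(2)[of j], where N=N and i=i and x=x] radial_mode_partial(2)[OF d, where N=N and i=i and x=x]
        by (simp add: W_def algebra_simps)
      also have "norm \<dots> \<le> norm ((of_nat N * cplx (axis i 1)) * cplx x ^ (N - 1) * of_real (w j ?y - h ?y))
          + norm (cplx x ^ N * of_real ((w' j ?y - h' ?y) * (2 * x $ i)))"
        by (rule norm_triangle_ineq)
      also have "norm ((of_nat N * cplx (axis i 1)) * cplx x ^ (N - 1) * of_real (w j ?y - h ?y))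
          \<le> real N * 1 * inverse (real (Suc j))"
      proof -
        have "norm ((of_nat N * cplx (axis i 1)) * cplx x ^ (N - 1) * of_real (w j ?y - h ?y))
            = real N * norm (cplx x ^ (N - 1)) * \<bar>w j ?y - h ?y\<bar>"
          unfolding norm_mult norm_of_real norm_of_nat norm_cplx_axis by simp
        also have "\<dots> \<le> real N * 1 * inverse (real (Suc j))"
          by (intro mult_mono order_refl pow[OF x] w(3)[OF y01[OF x]]) auto
        finally show ?thesis .
      qed
      also have "norm (cplx x ^ N * of_real ((w' j ?y - h' ?y) * (2 * x $ i)))
          \<le> 1 * (inverse (real (Suc j)) * 2)"
        unfolding norm_mult norm_of_real abs_mult
        by (intro mult_mono pow[OF x] w(4)[OF y01[OF x]]) (use xi in auto)
      finally show ?thesis by (simp add: algebra_simps)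
    qed
    show ?thesis
      using norm_vec2_le[of "classical_grad (W j) x - classical_grad ?u x"] comp[of 1] comp[of 2]
      by (simp add: algebra_simps)
  qed
  have inv0: "(\<lambda>j. inverse (real (Suc j))) \<longlonglongrightarrow> 0" by (rule LIMSEQ_inverse_real_of_nat)
  have lim: "(\<lambda>j. H1_norm disc (\<lambda>x. W j x - ?u x)) \<longlonglongrightarrow> 0"
  proof (rule H1_tendstoI[OF W u])
    have "L2_norm_on disc (\<lambda>x. W j x - ?u x) \<le> inverse (real (Suc j)) * sqrt (measure lebesgue disc)" for j
    proof (rule bounded_imp_L2_on(2)[OF disc_lmeasurable])
      show "(\<lambda>x. W j x - ?u x) \<in> borel_measurable (lebesgue_on disc)"
        using L2_onD(1)[OF L2_on_diff[OF H1_L2[OF W] H1_L2[OF u]]] .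
      show "norm (W j x - ?u x) \<le> inverse (real (Suc j))" if "x \<in> disc" for x
        by (rule W_le[OF disc_subset_cball[OF that]])
    qed simp
    then show "(\<lambda>j. L2_norm_on disc (\<lambda>x. W j x - ?u x)) \<longlonglongrightarrow> 0"
      by (rule nonneg_null_comparison[OF L2_norm_on_nonneg _ tendsto_mult_left_zero[OF inv0]])
    have "L2_norm_on disc (\<lambda>x. grad disc (W j) x - grad disc ?u x)
        \<le> (2 * (real N + 2) * inverse (real (Suc j))) * sqrt (measure lebesgue disc)" for j
    proof -
      have gL: "classical_grad (W j) \<in> L2_on disc" "classical_grad ?u \<in> L2_on disc"
        using continuous_imp_L2_on_disc[OF continuous_on_classical_grad[OF CW]]
          continuous_imp_L2_on_disc[OF continuous_on_classical_grad[OF Cu]] by auto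
      have m: "(\<lambda>x. classical_grad (W j) x - classical_grad ?u x) \<in> borel_measurable (lebesgue_on disc)"
        by (rule L2_onD(1)[OF L2_on_diff[OF gL]])
      have "L2_norm_on disc (\<lambda>x. grad disc (W j) x - grad disc ?u x)
          = L2_norm_on disc (\<lambda>x. classical_grad (W j) x - classical_grad ?u x)"
      proof (rule L2_norm_on_cong_AE[OF L2_onD(1)[OF L2_on_diff[OF grad_L2[OF W] grad_L2[OF u]]] m])
        show "AE x in lebesgue_on disc. norm (grad disc (W j) x - grad disc ?u x) = norm (classical_grad (W j) x - classical_grad ?u x)"
          using H1_classical(2)[OF CW[of j]] H1_classical(2)[OF Cu] by eventually_elim simp
      qed
      also have "\<dots> \<le> (2 * (real N + 2) * inverse (real (Suc j))) * sqrt (measure lebesgue disc)"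
        by (rule bounded_imp_L2_on(2)[OF disc_lmeasurable m]) (use g_le disc_subset_cball in auto)
      finally show ?thesis .
    qed
    then show "(\<lambda>j. L2_norm_on disc (\<lambda>x. grad disc (W j) x - grad disc ?u x)) \<longlonglongrightarrow> 0"
      by (rule nonneg_null_comparison[OF L2_norm_on_nonneg _ tendsto_mult_left_zero[OF tendsto_mult_right_zero[OF inv0]]])
  qed
  have u_circle: "?u (circle_point \<theta>) = ?\<phi> \<theta>" for \<theta>
    by (simp add: radial_mode_def cplx_circle_point)
  have cphi: "continuous_on UNIV ?\<phi>"
    unfolding circle_mode_def by (intro continuous_intros)
  have I: "{0..2*pi} \<in> lmeasurable" by simp
  have phi: "?\<phi> \<in> L2_on {0..2*pi}"
  proof (rule bounded_imp_L2_on(1)[OF I])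
    show "?\<phi> \<in> borel_measurable (lebesgue_on {0..2*pi})"
      by (rule continuous_imp_measurable_on_sets_lebesgue) (auto intro: continuous_on_subset[OF cphi])
    show "norm (?\<phi> \<theta>) \<le> \<bar>h 1\<bar>" for \<theta> by (simp add: norm_mult circle_mode_def)
  qed simp
  have circ: "(\<lambda>j. L2_norm_on {0..2*pi} (\<lambda>\<theta>. W j (circle_point \<theta>) - ?\<phi> \<theta>)) \<longlonglongrightarrow> 0"
  proof -
    have "L2_norm_on {0..2*pi} (\<lambda>\<theta>. W j (circle_point \<theta>) - ?\<phi> \<theta>) \<le> inverse (real (Suc j)) * sqrt (measure lebesgue {0..2*pi})" for j
    proof (rule bounded_imp_L2_on(2)[OF I])
      have "continuous_on UNIV (\<lambda>\<theta>. W j (circle_point \<theta>) - ?\<phi> \<theta>)"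
        by (intro continuous_on_diff cphi continuous_on_compose2[OF Ck_continuous[OF CW] continuous_on_circle_point]) auto
      then show "(\<lambda>\<theta>. W j (circle_point \<theta>) - ?\<phi> \<theta>) \<in> borel_measurable (lebesgue_on {0..2*pi})"
        by (intro continuous_imp_measurable_on_sets_lebesgue) (auto intro: continuous_on_subset)
      show "norm (W j (circle_point \<theta>) - ?\<phi> \<theta>) \<le> inverse (real (Suc j))" for \<theta>
        using W_le[of "circle_point \<theta>" j] unfolding u_circle by simp
    qed simp
    then show ?thesis
      by (rule nonneg_null_comparison[OF L2_norm_on_nonneg _ tendsto_mult_left_zero[OF inv0]])
  qed
  show ?thesis
    unfolding has_trace_def using u phi lim circ w(1) by (intro conjI exI[of _ W]) (auto simp: W_def)
qed

section \<open>Green's formula in polar coordinates\<close>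

text \<open>
  The identity plus \<open>\<beta>\<close> times the projection onto the direction of \<open>(- x\<^sub>2, x\<^sub>1)\<close>, that is, the tangential
  direction.  The radial conductivity remains \<open>1\<close>, so radial derivatives of solutions do not jump where
  \<open>\<beta>\<close> does.
\<close>

definition angular_coeff :: "(real \<Rightarrow> real) \<Rightarrow> plane \<Rightarrow> real ^ 2 ^ 2" where
  "angular_coeff \<beta> x = (\<chi> i j. (if i = j then 1 else 0)
     + \<beta> ((norm x)\<^sup>2) / (norm x)\<^sup>2 * ((vector [- x $ 2, x $ 1] :: plane) $ i * (vector [- x $ 2, x $ 1] :: plane) $ j))"

lemma angular_coeff_nth:
  "angular_coeff \<beta> x $ 1 $ 1 = 1 + \<beta> ((norm x)\<^sup>2) / (norm x)\<^sup>2 * (x $ 2 * x $ 2)"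
  "angular_coeff \<beta> x $ 1 $ 2 = - (\<beta> ((norm x)\<^sup>2) / (norm x)\<^sup>2 * (x $ 2 * x $ 1))"
  "angular_coeff \<beta> x $ 2 $ 1 = - (\<beta> ((norm x)\<^sup>2) / (norm x)\<^sup>2 * (x $ 2 * x $ 1))"
  "angular_coeff \<beta> x $ 2 $ 2 = 1 + \<beta> ((norm x)\<^sup>2) / (norm x)\<^sup>2 * (x $ 1 * x $ 1)"
  by (simp_all add: angular_coeff_def vector_2)

lemma transpose_angular_coeff: "transpose (angular_coeff \<beta> x) = angular_coeff \<beta> x"
  by (simp add: transpose_def vec_eq_iff forall_2 angular_coeff_nth)

lemma angular_coeff_eq_mat_1: "\<beta> ((norm x)\<^sup>2) = 0 \<Longrightarrow> angular_coeff \<beta> x = mat 1"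
  by (simp add: vec_eq_iff forall_2 angular_coeff_nth mat_def)

lemma borel_measurable_angular_coeff:
  assumes [measurable]: "\<beta> \<in> borel_measurable borel"
  shows "angular_coeff \<beta> \<in> borel_measurable borel"
proof -
  have [measurable]: "(\<lambda>x :: plane. x $ i) \<in> borel_measurable borel" for i
    by (intro borel_measurable_continuous_onI continuous_intros)
  have nth: "(\<lambda>x. angular_coeff \<beta> x $ i $ j) \<in> borel_measurable borel" for i j
    using exhaust_2[of i] exhaust_2[of j] by (elim disjE) (simp_all add: angular_coeff_nth)
  show ?thesis
  proof (rule borel_measurable_euclidean_space[THEN iffD2], rule ballI)
    fix b :: "real ^ 2 ^ 2" assume "b \<in> Basis"
    then obtain i j where "b = axis i (axis j 1)" by (auto simp: Basis_vec_def)
    then show "(\<lambda>x. angular_coeff \<beta> x \<bullet> b) \<in> borel_measurable borel"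
      using nth[of i j] by (simp add: inner_axis)
  qed
qed

lemma measurable_lebesgue_on_disc: "f \<in> borel_measurable borel \<Longrightarrow> f \<in> borel_measurable (lebesgue_on disc)"
  by (rule measurable_restrict_space1) (simp add: measurable_completion)

lemma bounded_coeff_angular_coeff:
  assumes "\<beta> \<in> borel_measurable borel" and C: "\<And>y. 0 \<le> y \<Longrightarrow> y \<le> 1 \<Longrightarrow> \<bar>\<beta> y\<bar> \<le> C"
  shows "bounded_coeff (1 + C) (angular_coeff \<beta>)"
  unfolding bounded_coeff_def
proof (intro conjI ballI allI)
  show "angular_coeff \<beta> \<in> borel_measurable (lebesgue_on disc)"
    by (rule measurable_lebesgue_on_disc[OF borel_measurable_angular_coeff[OF assms(1)]])
  fix x i j assume "x \<in> disc"
  then have x: "norm x \<le> 1" by (simp add: disc_eq)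
  have C0: "0 \<le> C" using C[of 0] by simp
  have b: "\<bar>\<beta> ((norm x)\<^sup>2) / (norm x)\<^sup>2 * (x $ k * x $ l)\<bar> \<le> C" for k l
  proof (cases "x = 0")
    case False
    have "\<bar>x $ k * x $ l\<bar> \<le> norm x * norm x"
      unfolding abs_mult by (intro mult_mono component_le_norm_cart) auto
    then have "\<bar>x $ k * x $ l\<bar> / (norm x)\<^sup>2 \<le> 1" using False by (simp add: power2_eq_square)
    moreover have "\<bar>\<beta> ((norm x)\<^sup>2)\<bar> \<le> C" using x by (intro C) (auto simp: power_le_one)
    ultimately have "\<bar>\<beta> ((norm x)\<^sup>2)\<bar> * (\<bar>x $ k * x $ l\<bar> / (norm x)\<^sup>2) \<le> C * 1"
      by (intro mult_mono) (auto simp: C0)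
    then show ?thesis by (simp add: abs_mult abs_divide)
  qed (simp add: C0)
  show "\<bar>angular_coeff \<beta> x $ i $ j\<bar> \<le> 1 + C"
    using exhaust_2[of i] exhaust_2[of j] b[of 1 1] b[of 2 2] b[of 2 1]
    by (elim disjE; simp only: angular_coeff_nth; linarith)
qed

lemma flux_angular_coeff:
  "(\<Sum>i\<in>UNIV. flux (angular_coeff \<beta>) g x $ i * k $ i) = g x $ 1 * k $ 1 + g x $ 2 * k $ 2
     + of_real (\<beta> ((norm x)\<^sup>2) / (norm x)\<^sup>2) * (of_real (x $ 1) * g x $ 2 - of_real (x $ 2) * g x $ 1)
       * (of_real (x $ 1) * k $ 2 - of_real (x $ 2) * k $ 1)"
proof -
  define c where "c = \<beta> ((norm x)\<^sup>2) / (norm x)\<^sup>2"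
  show ?thesis
    unfolding flux_def vec_lambda_beta sum_2 angular_coeff_nth c_def[symmetric]
    by (simp add: algebra_simps)
qed

text \<open>
  In terms of \<open>f(r) = r\<^sup>N h(r\<^sup>2)\<close> the right-hand side is \<open>e\<^sup>i\<^sup>N\<^sup>\<theta> (r f' v\<^sub>r + (1 + \<beta>) i N f (v\<^sub>\<theta>/r))\<close>: only the
  angular part sees \<open>\<beta>\<close>.  The proof factors \<open>e\<^sup>i\<^sup>\<theta>\<close> out of \<open>v\<^sub>1 + i v\<^sub>2\<close>.
\<close>

lemma radial_mode_polar_integrand:
  fixes h h' \<beta> :: "real \<Rightarrow> real" and v1 v2 :: complex
  assumes N: "N \<ge> 1" and r: "0 \<le> r"
    and k: "k = (\<chi> i. if i = 1 then v1 else v2)"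
    and g: "\<And>i. g (r *\<^sub>R circle_point \<theta>) $ i =
      of_nat N * cplx (axis i 1) * cplx (r *\<^sub>R circle_point \<theta>) ^ (N - 1) * of_real (h (r\<^sup>2))
      + cplx (r *\<^sub>R circle_point \<theta>) ^ N * of_real (h' (r\<^sup>2) * (2 * (r *\<^sub>R circle_point \<theta>) $ i))"
  shows "of_real r * (\<Sum>i\<in>UNIV. flux (angular_coeff \<beta>) g (r *\<^sub>R circle_point \<theta>) $ i * k $ i)
    = circle_mode (int N) \<theta> * (of_real (real N * r ^ N * h (r\<^sup>2) + 2 * r ^ (N + 2) * h' (r\<^sup>2)) * (of_real (cos \<theta>) * v1 + of_real (sin \<theta>) * v2)
      + of_real (1 + \<beta> (r\<^sup>2)) * (\<i> * of_real (real N * r ^ N * h (r\<^sup>2)) * (of_real (cos \<theta>) * v2 - of_real (sin \<theta>) * v1)))"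
proof (cases "r = 0")
  case True
  then show ?thesis using N by (simp add: power_0_left)
next
  case False
  with r have r: "0 < r" by simp
  define C where "C = complex_of_real (cos \<theta>)"
  define S where "S = complex_of_real (sin \<theta>)"
  define e where "e = C + \<i> * S"
  define R where "R = complex_of_real r"
  define E where "E = (R * e) ^ (N - 1)"
  define H where "H = complex_of_real (h (r\<^sup>2))"
  define H' where "H' = complex_of_real (h' (r\<^sup>2))"
  define b where "b = complex_of_real (\<beta> (r\<^sup>2))"
  define n where "n = (of_nat N :: complex)"
  have CS: "C * C + S * S = 1"
    unfolding C_def S_def of_real_mult[symmetric] of_real_add[symmetric]
    using sin_cos_squared_add2[of \<theta>] by (simp add: power2_eq_square)
  have ecis: "e = cis \<theta>" by (simp add: e_def C_def S_def cis_conv_exp exp_Euler cos_of_real sin_of_real)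
  have z: "cplx (r *\<^sub>R circle_point \<theta>) = R * e"
    by (simp add: cplx_eq R_def e_def C_def S_def algebra_simps)
  have pN: "(R * e) ^ N = R * e * E" using N by (cases N) (auto simp: E_def)
  have mode: "circle_mode (int N) \<theta> * R ^ N = R * e * E"
  proof -
    have "(R * e) ^ N = R ^ N * cis (real N * \<theta>)"
      by (simp add: power_mult_distrib ecis Complex.DeMoivre)
    then show ?thesis by (simp add: pN circle_mode_def mult.commute)
  qed
  have g1: "g (r *\<^sub>R circle_point \<theta>) $ 1 = n * E * H + R * e * E * (H' * (2 * (R * C)))"
    using g[of 1] unfolding z pN by (simp add: n_def E_def H_def H'_def R_def C_def)
  have g2: "g (r *\<^sub>R circle_point \<theta>) $ 2 = n * \<i> * E * H + R * e * E * (H' * (2 * (R * S)))"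
    using g[of 2] unfolding z pN by (simp add: n_def E_def H_def H'_def R_def S_def)
  have norm: "(norm (r *\<^sub>R circle_point \<theta>))\<^sup>2 = r\<^sup>2" by simp
  define a where "a = C * v1 + S * v2"
  define w where "w = C * v2 - S * v1"
  have v: "v1 + \<i> * v2 = e * (a + \<i> * w)"
  proof -
    have "e * (a + \<i> * w) = (C * C + S * S) * (v1 + \<i> * v2)"
      unfolding e_def a_def w_def by (simp add: algebra_simps)
    then show ?thesis using CS by simp
  qed
  have tang: "R * C * (n * \<i> * E * H + R * e * E * (H' * (2 * (R * S)))) - R * S * (n * E * H + R * e * E * (H' * (2 * (R * C))))
      = \<i> * n * E * H * R * e"
    unfolding e_def by (simp add: algebra_simps)
  have "(\<Sum>i\<in>UNIV. flux (angular_coeff \<beta>) g (r *\<^sub>R circle_point \<theta>) $ i * k $ i)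
      = (n * E * H + R * e * E * (H' * (2 * (R * C)))) * v1 + (n * \<i> * E * H + R * e * E * (H' * (2 * (R * S)))) * v2
       + b / (R * R) * (\<i> * n * E * H * R * e) * (R * w)"
    unfolding flux_angular_coeff norm tang[symmetric] g1 g2
    by (simp add: k b_def R_def C_def S_def w_def power2_eq_square algebra_simps)
  also have "\<dots> = n * E * H * (v1 + \<i> * v2) + 2 * H' * R * R * e * E * a + b * \<i> * n * E * H * e * w"
  proof -
    have "R \<noteq> 0" using r by (simp add: R_def)
    then have "b / (R * R) * (\<i> * n * E * H * R * e) * (R * w) = b * \<i> * n * E * H * e * w" by simp
    then show ?thesis by (simp add: a_def algebra_simps)
  qed
  also have "R * \<dots> = (R * e * E) * ((n * H + 2 * R\<^sup>2 * H') * a + (1 + b) * (\<i> * (n * H) * w))"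
    unfolding v by (simp add: power2_eq_square algebra_simps)
  also have "\<dots> = circle_mode (int N) \<theta> * ((n * R ^ N * H + 2 * R ^ (N + 2) * H') * a + (1 + b) * (\<i> * (n * R ^ N * H) * w))"
    unfolding mode[symmetric] by (simp add: power_add power2_eq_square algebra_simps)
  finally show ?thesis
    by (simp add: n_def R_def H_def H'_def a_def w_def b_def C_def S_def)
qed

lemma frechet_derivative_plane:
  fixes v :: "plane \<Rightarrow> complex"
  assumes "v differentiable (at x)"
  shows "(v has_derivative (\<lambda>k. (k $ 1) *\<^sub>R partial 1 v x + (k $ 2) *\<^sub>R partial 2 v x)) (at x)"
proof -
  let ?D = "frechet_derivative v (at x)"
  have D: "(v has_derivative ?D) (at x)" using assms by (simp add: frechet_derivative_works)
  have "?D k = (k $ 1) *\<^sub>R partial 1 v x + (k $ 2) *\<^sub>R partial 2 v x" for k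
  proof -
    have k: "k = (k $ 1) *\<^sub>R axis 1 1 + (k $ 2) *\<^sub>R axis 2 1"
      by (simp add: vec_eq_iff forall_2 axis_def)
    have "?D k = ?D ((k $ 1) *\<^sub>R axis 1 1 + (k $ 2) *\<^sub>R axis 2 1)" using k by simp
    also have "\<dots> = (k $ 1) *\<^sub>R ?D (axis 1 1) + (k $ 2) *\<^sub>R ?D (axis 2 1)"
      using has_derivative_linear[OF D] by (simp add: linear_add linear_scale)
    finally show ?thesis by (simp add: partial_def)
  qed
  then show ?thesis using D by (metis (no_types, lifting) ext)
qed

definition radial_deriv :: "(plane \<Rightarrow> complex) \<Rightarrow> real \<Rightarrow> real \<Rightarrow> complex" where
  "radial_deriv v r \<theta> = of_real (cos \<theta>) * partial 1 v (r *\<^sub>R circle_point \<theta>)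
     + of_real (sin \<theta>) * partial 2 v (r *\<^sub>R circle_point \<theta>)"

definition tangential_deriv :: "(plane \<Rightarrow> complex) \<Rightarrow> real \<Rightarrow> real \<Rightarrow> complex" where
  "tangential_deriv v r \<theta> = of_real (cos \<theta>) * partial 2 v (r *\<^sub>R circle_point \<theta>)
     - of_real (sin \<theta>) * partial 1 v (r *\<^sub>R circle_point \<theta>)"

lemma polar_derivatives:
  fixes v :: "plane \<Rightarrow> complex"
  assumes "v differentiable (at (r *\<^sub>R circle_point \<theta>))"
  shows "((\<lambda>r. v (r *\<^sub>R circle_point \<theta>)) has_vector_derivative radial_deriv v r \<theta>) (at r within S)"
    and "((\<lambda>\<theta>. v (r *\<^sub>R circle_point \<theta>)) has_vector_derivative of_real r * tangential_deriv v r \<theta>) (at \<theta> within S)"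
proof -
  note D = frechet_derivative_plane[OF assms]
  have 1: "((\<lambda>r. r *\<^sub>R circle_point \<theta>) has_derivative (\<lambda>k. k *\<^sub>R circle_point \<theta>)) (at r within S)"
    by (auto intro!: derivative_eq_intros)
  show "((\<lambda>r. v (r *\<^sub>R circle_point \<theta>)) has_vector_derivative radial_deriv v r \<theta>) (at r within S)"
    using has_derivative_compose[OF 1 D]
    unfolding has_vector_derivative_def radial_deriv_def tangential_deriv_def
    by (rule has_derivative_eq_rhs) (auto simp: fun_eq_iff scaleR_conv_of_real[where 'a=complex] algebra_simps)
  have 2: "((\<lambda>\<theta>. r *\<^sub>R circle_point \<theta>) has_derivative (\<lambda>h. r *\<^sub>R (h *\<^sub>R (- sin \<theta> *\<^sub>R axis 1 1 + cos \<theta> *\<^sub>R axis 2 1)))) (at \<theta> within S)"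
    by (rule has_derivative_scaleR_right[OF circle_point_has_derivative])
  show "((\<lambda>\<theta>. v (r *\<^sub>R circle_point \<theta>)) has_vector_derivative of_real r * tangential_deriv v r \<theta>) (at \<theta> within S)"
    using has_derivative_compose[OF 2 D]
    unfolding has_vector_derivative_def radial_deriv_def tangential_deriv_def
    by (rule has_derivative_eq_rhs) (auto simp: fun_eq_iff scaleR_conv_of_real[where 'a=complex] axis_def algebra_simps)
qed

lemma weighted_compact_integrable:
  fixes G :: "'a::euclidean_space \<Rightarrow> complex" and q :: "'a \<Rightarrow> real"
  assumes [measurable]: "\<beta> \<in> borel_measurable borel" and K: "compact K"
    and C: "\<And>x. x \<in> K \<Longrightarrow> \<bar>\<beta> (q x)\<bar> \<le> C" and q: "continuous_on UNIV q" and G: "continuous_on UNIV G"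
  shows "integrable lborel (\<lambda>x. indicator K x *\<^sub>R (of_real (1 + \<beta> (q x)) * G x))"
proof -
  have "compact (G ` K)"
    by (rule compact_continuous_image[OF _ K]) (use G in \<open>auto intro: continuous_on_subset\<close>)
  then obtain B where B: "0 < B" "\<And>x. x \<in> K \<Longrightarrow> norm (G x) \<le> B"
    using compact_imp_bounded[of "G ` K"] by (auto simp: bounded_pos)
  note [measurable] = borel_measurable_continuous_onI[OF G] borel_measurable_continuous_onI[OF q]
  show ?thesis
  proof (rule integrableI_bounded_set_indicator[where B="(1 + C) * B"])
    show "K \<in> sets lborel" using K by (simp add: borel_compact)
    show "emeasure lborel K < \<infinity>" by (rule emeasure_compact_finite[OF K])
    show "AE x in lborel. x \<in> K \<longrightarrow> norm (of_real (1 + \<beta> (q x)) * G x) \<le> (1 + C) * B"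
    proof (rule AE_I2, rule impI)
      fix x assume x: "x \<in> K"
      then have "\<bar>1 + \<beta> (q x)\<bar> \<le> 1 + C" using C[OF x] by linarith
      then have "\<bar>1 + \<beta> (q x)\<bar> * norm (G x) \<le> (1 + C) * B" by (intro mult_mono B(2)[OF x]) auto
      then show "norm (of_real (1 + \<beta> (q x)) * G x) \<le> (1 + C) * B" unfolding norm_mult norm_of_real .
    qed
  qed measurable
qed

text \<open>Integration by parts in \<open>\<theta>\<close>: the integrand is periodic, so there is no boundary term.\<close>

lemma integral_angular_by_parts:
  fixes v :: "plane \<Rightarrow> complex"
  assumes v: "Ck (Suc 0) v"
  shows "(LINT \<theta>|lborel. indicator {0..2*pi} \<theta> *\<^sub>R (circle_mode (int N) \<theta> * (of_real r * tangential_deriv v r \<theta>)))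
    = - (\<i> * of_nat N * (LINT \<theta>|lborel. indicator {0..2*pi} \<theta> *\<^sub>R (circle_mode (int N) \<theta> * v (r *\<^sub>R circle_point \<theta>))))"
proof -
  let ?e = "circle_mode (int N)"
  let ?W = "\<lambda>\<theta>. of_real r * tangential_deriv v r \<theta>"
  have de: "(?e has_vector_derivative \<i> * of_nat N * ?e \<theta>) (at \<theta> within S)" for \<theta> S
  proof -
    have eq: "?e = (\<lambda>\<theta>. of_real (cos (real N * \<theta>)) + \<i> * of_real (sin (real N * \<theta>)))"
      by (rule ext) (simp add: circle_mode_def complex_eq_iff)
    have c: "((\<lambda>\<theta>. complex_of_real (cos (real N * \<theta>))) has_vector_derivative of_real (- sin (real N * \<theta>) * real N)) (at \<theta> within S)"
      by (rule has_vector_derivative_of_real) (auto intro!: derivative_eq_intros)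
    have s: "((\<lambda>\<theta>. complex_of_real (sin (real N * \<theta>))) has_vector_derivative of_real (cos (real N * \<theta>) * real N)) (at \<theta> within S)"
      by (rule has_vector_derivative_of_real) (auto intro!: derivative_eq_intros)
    show ?thesis
      unfolding eq using has_vector_derivative_add[OF c has_vector_derivative_mult_right[OF s, of \<i>]]
      by (simp add: algebra_simps)
  qed
  have dv: "((\<lambda>\<theta>. v (r *\<^sub>R circle_point \<theta>)) has_vector_derivative ?W \<theta>) (at \<theta> within S)" for \<theta> S
    by (rule polar_derivatives(2)) (use v in simp)
  have ce: "continuous_on UNIV ?e"
    unfolding circle_mode_def by (intro continuous_intros)
  have cp: "continuous_on UNIV (\<lambda>\<theta>. f (r *\<^sub>R circle_point \<theta>))" if "continuous_on UNIV f" for f :: "plane \<Rightarrow> complex"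
    by (rule continuous_on_compose2[OF that]) (auto intro!: continuous_intros continuous_on_circle_point)
  have cv: "continuous_on UNIV v" "continuous_on UNIV (partial i v)" for i
    using Ck_continuous[OF v] v by auto
  have c1: "continuous_on UNIV (\<lambda>\<theta>. ?e \<theta> * ?W \<theta>)" and c2: "continuous_on UNIV (\<lambda>\<theta>. ?e \<theta> * v (r *\<^sub>R circle_point \<theta>))"
    unfolding tangential_deriv_def by (intro continuous_intros ce cp cv)+
  have I: "integrable lborel (\<lambda>\<theta>. indicator {0..2*pi} \<theta> *\<^sub>R f \<theta>)" if "continuous_on UNIV f" for f :: "real \<Rightarrow> complex"
    by (rule borel_integrable_compact) (use that in \<open>auto intro: continuous_on_subset\<close>)
  have "has_bochner_integral lborel (\<lambda>\<theta>. indicator {0..2*pi} \<theta> *\<^sub>R (?e \<theta> * ?W \<theta> + \<i> * of_nat N * (?e \<theta> * v (r *\<^sub>R circle_point \<theta>))))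
      (?e (2*pi) * v (r *\<^sub>R circle_point (2*pi)) - ?e 0 * v (r *\<^sub>R circle_point 0))"
  proof (rule has_bochner_integral_FTC_Icc)
    fix \<theta> :: real
    show "((\<lambda>\<theta>. ?e \<theta> * v (r *\<^sub>R circle_point \<theta>)) has_vector_derivative
        (?e \<theta> * ?W \<theta> + \<i> * of_nat N * (?e \<theta> * v (r *\<^sub>R circle_point \<theta>)))) (at \<theta> within {0..2*pi})"
      using has_vector_derivative_mult[OF de dv] by (simp only: mult.assoc)
  next
    show "continuous_on {0..2*pi} (\<lambda>\<theta>. ?e \<theta> * ?W \<theta> + \<i> * of_nat N * (?e \<theta> * v (r *\<^sub>R circle_point \<theta>)))"
      by (rule continuous_on_subset[of UNIV]) (intro continuous_on_add c1 continuous_on_mult continuous_on_const c2, simp)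
  qed simp
  moreover have "?e (2*pi) = ?e 0"
  proof -
    have "cis (real N * (2 * pi)) = 1" using cis_multiple_2pi[of "real N"] by (simp add: mult_ac)
    then show ?thesis by (simp add: circle_mode_def)
  qed
  moreover have "circle_point (2*pi) = circle_point 0" by (simp add: circle_point_def)
  ultimately have "(LINT \<theta>|lborel. indicator {0..2*pi} \<theta> *\<^sub>R (?e \<theta> * ?W \<theta>) + \<i> * of_nat N * (indicator {0..2*pi} \<theta> *\<^sub>R (?e \<theta> * v (r *\<^sub>R circle_point \<theta>)))) = 0"
    by (simp add: has_bochner_integral_iff scaleR_add_right)
  then have "(LINT \<theta>|lborel. indicator {0..2*pi} \<theta> *\<^sub>R (?e \<theta> * ?W \<theta>))
      + (LINT \<theta>|lborel. \<i> * of_nat N * (indicator {0..2*pi} \<theta> *\<^sub>R (?e \<theta> * v (r *\<^sub>R circle_point \<theta>)))) = 0"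
    using Bochner_Integration.integral_add[OF I[OF c1] integrable_mult_right[OF I[OF c2], of "\<i> * of_nat N"]] by simp
  then show ?thesis unfolding integral_mult_right_zero by (simp only: eq_neg_iff_add_eq_0)
qed

text \<open>
  The equation for \<open>A\<close> makes the integrand the derivative of \<open>A(r) v\<close>.  It may fail at finitely many
  radii, because \<open>\<beta>\<close> jumps at the ends of the window.
\<close>

lemma integral_radial_FTC:
  fixes v :: "plane \<Rightarrow> complex" and A h \<beta> :: "real \<Rightarrow> real"
  assumes v: "Ck (Suc 0) v"
    and \<beta>: "\<beta> \<in> borel_measurable borel" and C: "\<And>y. 0 \<le> y \<Longrightarrow> y \<le> 1 \<Longrightarrow> \<bar>\<beta> y\<bar> \<le> C"
    and ch: "continuous_on UNIV h"
    and E: "finite E" and ode: "\<And>r. r \<in> {0<..<1} - E \<Longrightarrow> (A has_real_derivative (1 + \<beta> (r\<^sup>2)) * h r) (at r)"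
    and A: "continuous_on UNIV A" "A 0 = 0"
  shows "(LINT r|lborel. indicator {0..1} r *\<^sub>R (of_real (A r) * radial_deriv v r \<theta>
      + of_real (1 + \<beta> (r\<^sup>2)) * (of_real (h r) * v (r *\<^sub>R circle_point \<theta>)))) = of_real (A 1) * v (circle_point \<theta>)"
proof -
  let ?a = "\<lambda>r. radial_deriv v r \<theta>"
  let ?V = "\<lambda>r. v (r *\<^sub>R circle_point \<theta>)"
  let ?f = "\<lambda>r. of_real (A r) * ?a r + of_real (1 + \<beta> (r\<^sup>2)) * (of_real (h r) * ?V r)"
  have cp: "continuous_on UNIV (\<lambda>r. f (r *\<^sub>R circle_point \<theta>))" if "continuous_on UNIV f" for f :: "plane \<Rightarrow> complex"
    by (rule continuous_on_compose2[OF that]) (auto intro!: continuous_intros)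
  have cv: "continuous_on UNIV v" "continuous_on UNIV (partial i v)" for i
    using Ck_continuous[OF v] v by auto
  have c1: "continuous_on UNIV (\<lambda>r. of_real (A r) * ?a r)" and c2: "continuous_on UNIV (\<lambda>r. of_real (h r) * ?V r)"
    unfolding radial_deriv_def by (intro continuous_intros A(1) ch cp cv)+
  have FTC: "(?f has_integral (of_real (A 1) * ?V 1 - of_real (A 0) * ?V 0)) {0..1}"
  proof (rule fundamental_theorem_of_calculus_interior_strong[OF E])
    fix r assume r: "r \<in> {0<..<1} - E"
    have dA: "((\<lambda>r. complex_of_real (A r)) has_vector_derivative of_real ((1 + \<beta> (r\<^sup>2)) * h r)) (at r)"
      by (rule has_vector_derivative_of_real[OF ode[OF r]])
    have dV: "(?V has_vector_derivative ?a r) (at r)"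
      by (rule polar_derivatives(1)) (use v in simp)
    show "((\<lambda>r. of_real (A r) * ?V r) has_vector_derivative ?f r) (at r)"
      using has_vector_derivative_mult[OF dA dV] by (simp add: mult.assoc)
  next
    show "continuous_on {0..1} (\<lambda>r. of_real (A r) * ?V r)"
      by (rule continuous_on_subset[of UNIV]) (intro continuous_intros A(1) cp cv, simp)
  qed simp
  have I1: "integrable lborel (\<lambda>r. indicator {0..1} r *\<^sub>R (of_real (A r) * ?a r))"
    by (rule borel_integrable_compact) (use c1 in \<open>auto intro: continuous_on_subset\<close>)
  have I2: "integrable lborel (\<lambda>r. indicator {0..1} r *\<^sub>R (of_real (1 + \<beta> (r\<^sup>2)) * (of_real (h r) * ?V r)))"
    by (rule weighted_compact_integrable[OF \<beta> _ C _ c2])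
       (auto simp: power_le_one intro!: continuous_intros)
  have "set_integrable lborel {0..1} ?f"
    using Bochner_Integration.integrable_add[OF I1 I2] unfolding set_integrable_def by (simp add: scaleR_add_right)
  from set_borel_integral_eq_integral(2)[OF this]
  have "(LINT r|lborel. indicator {0..1} r *\<^sub>R ?f r) = integral {0..1} ?f"
    unfolding set_lebesgue_integral_def .
  also have "\<dots> = of_real (A 1) * v (circle_point \<theta>)"
    using integral_unique[OF FTC] A(2) by simp
  finally show ?thesis .
qed

text \<open>
  The equation \<open>(r f')' = (1 + \<beta>) N\<^sup>2 f / r\<close> for \<open>f(r) = r\<^sup>N h(r\<^sup>2)\<close>; the function being differentiated is
  \<open>r f'\<close>.
\<close>

definition radial_solution :: "nat \<Rightarrow> (real \<Rightarrow> real) \<Rightarrow> (real \<Rightarrow> real) \<Rightarrow> (real \<Rightarrow> real) \<Rightarrow> bool" where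
  "radial_solution N \<beta> h h' \<longleftrightarrow>
     (\<forall>y\<ge>0. (h has_real_derivative h' y) (at y)) \<and> continuous_on {0..} h' \<and>
     (\<exists>E. finite E \<and> (\<forall>r\<in>{0<..<1} - E.
        ((\<lambda>r. real N * r ^ N * h (r\<^sup>2) + 2 * r ^ (N + 2) * h' (r\<^sup>2)) has_real_derivative
          (1 + \<beta> (r\<^sup>2)) * ((real N)\<^sup>2 * r ^ (N - 1) * h (r\<^sup>2))) (at r)))"

lemma radial_solutionD:
  assumes "radial_solution N \<beta> h h'"
  shows "0 \<le> y \<Longrightarrow> (h has_real_derivative h' y) (at y)" and "continuous_on {0..} h'"
    and "\<exists>E. finite E \<and> (\<forall>r\<in>{0<..<1} - E.
        ((\<lambda>r. real N * r ^ N * h (r\<^sup>2) + 2 * r ^ (N + 2) * h' (r\<^sup>2)) has_real_derivative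
          (1 + \<beta> (r\<^sup>2)) * ((real N)\<^sup>2 * r ^ (N - 1) * h (r\<^sup>2))) (at r))"
proof -
  note D = assms[unfolded radial_solution_def]
  show "0 \<le> y \<Longrightarrow> (h has_real_derivative h' y) (at y)" using D[THEN conjunct1] by simp
  show "continuous_on {0..} h'" by (rule D[THEN conjunct2, THEN conjunct1])
  show "\<exists>E. finite E \<and> (\<forall>r\<in>{0<..<1} - E.
        ((\<lambda>r. real N * r ^ N * h (r\<^sup>2) + 2 * r ^ (N + 2) * h' (r\<^sup>2)) has_real_derivative
          (1 + \<beta> (r\<^sup>2)) * ((real N)\<^sup>2 * r ^ (N - 1) * h (r\<^sup>2))) (at r))"
    by (rule D[THEN conjunct2, THEN conjunct2])
qed

text \<open>
  In polar coordinates the angular part is integrated by parts in \<open>\<theta>\<close>; with the radial equation the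
  integrand becomes an exact \<open>r\<close>-derivative, which leaves only the boundary term at \<open>r = 1\<close>.
\<close>

lemma green_radial_mode:
  fixes h h' \<beta> :: "real \<Rightarrow> real"
  assumes N: "N \<ge> 1"
    and \<beta>: "\<beta> \<in> borel_measurable borel" and C: "\<And>y. 0 \<le> y \<Longrightarrow> y \<le> 1 \<Longrightarrow> \<bar>\<beta> y\<bar> \<le> C"
    and sol: "radial_solution N \<beta> h h'"
    and v: "Ck (Suc 0) v"
  shows "energy disc (angular_coeff \<beta>) (classical_grad (radial_mode N h)) (classical_grad v)
    = of_real (real N * h 1 + 2 * h' 1)
      * (LINT \<theta>|lborel. indicator {0..2*pi} \<theta> *\<^sub>R (circle_mode (int N) \<theta> * v (circle_point \<theta>)))"
proof -
  note d = radial_solutionD(1)[OF sol] and c = radial_solutionD(2)[OF sol]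
  obtain E where E: "finite E" and ode: "\<forall>r\<in>{0<..<1} - E.
      ((\<lambda>r. real N * r ^ N * h (r\<^sup>2) + 2 * r ^ (N + 2) * h' (r\<^sup>2)) has_real_derivative
        (1 + \<beta> (r\<^sup>2)) * ((real N)\<^sup>2 * r ^ (N - 1) * h (r\<^sup>2))) (at r)"
    using radial_solutionD(3)[OF sol] by (elim conjE exE)
  let ?\<sigma> = "angular_coeff \<beta>" and ?g = "classical_grad (radial_mode N h)" and ?k = "classical_grad v"
  let ?e = "circle_mode (int N)"
  define P where "P p = fst p *\<^sub>R circle_point (snd p)" for p :: "real \<times> real"
  define A where "A r = real N * r ^ N * h (r\<^sup>2) + 2 * r ^ (N + 2) * h' (r\<^sup>2)" for r
  define B where "B r = (real N)\<^sup>2 * r ^ (N - 1) * h (r\<^sup>2)" for r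
  define a where "a p = radial_deriv v (fst p) (snd p)" for p
  define w where "w p = tangential_deriv v (fst p) (snd p)" for p
  let ?I = "\<lambda>p. indicator ({0..1} \<times> {0..2*pi}) p :: real"
  have Cu: "Ck (Suc 0) (radial_mode N h)" using d c by (rule Ck_radial_mode)
  have cg: "continuous_on UNIV ?g" "continuous_on UNIV ?k"
    using continuous_on_classical_grad[OF Cu] continuous_on_classical_grad[OF v] by auto
  have bdd: "bounded_coeff (1 + C) ?\<sigma>" by (rule bounded_coeff_angular_coeff[OF \<beta> C])
  have ch: "continuous_on {0..} h"
    by (intro continuous_at_imp_continuous_on ballI) (auto intro: DERIV_isCont[OF d])
  have comp: "continuous_on UNIV (\<lambda>r. f (r\<^sup>2))" if "continuous_on {0..} f" for f :: "real \<Rightarrow> real"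
    by (rule continuous_on_compose2[OF that]) (auto intro!: continuous_intros)
  have cA: "continuous_on UNIV A" and cB: "continuous_on UNIV B"
    unfolding A_def B_def by (intro continuous_intros comp ch c)+
  have A0: "A 0 = 0" using N by (simp add: A_def power_0_left)
  have A1: "A 1 = real N * h 1 + 2 * h' 1" by (simp add: A_def)

  have cP: "continuous_on UNIV P"
    unfolding P_def[abs_def] by (intro continuous_intros continuous_on_compose2[OF continuous_on_circle_point[of UNIV]]) auto
  have cvP: "continuous_on UNIV (\<lambda>p. f (P p))" if "continuous_on UNIV f" for f :: "plane \<Rightarrow> complex"
    by (rule continuous_on_compose2[OF that cP]) simp
  have cv: "continuous_on UNIV v" "continuous_on UNIV (partial i v)" for i
    using Ck_continuous[OF v] v by auto
  have ca: "continuous_on UNIV a" and cw: "continuous_on UNIV w"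
    unfolding a_def[abs_def] w_def[abs_def] radial_deriv_def tangential_deriv_def
    by (intro continuous_intros cvP[unfolded P_def] cv)+
  have ce: "continuous_on UNIV (\<lambda>p :: real \<times> real. ?e (snd p))"
    unfolding circle_mode_def by (intro continuous_intros)
  have cfst: "continuous_on UNIV (\<lambda>p :: real \<times> real. f (fst p))" if "continuous_on UNIV f" for f :: "real \<Rightarrow> real"
    by (rule continuous_on_compose2[OF that]) (auto intro!: continuous_intros)
  let ?F1 = "\<lambda>p. ?I p *\<^sub>R (?e (snd p) * (of_real (A (fst p)) * a p))"
  let ?F2 = "\<lambda>p. ?I p *\<^sub>R (of_real (1 + \<beta> ((fst p)\<^sup>2)) * (?e (snd p) * (\<i> * of_real (real N * fst p ^ N * h ((fst p)\<^sup>2)) * w p)))"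
  let ?F3 = "\<lambda>p. ?I p *\<^sub>R (of_real (1 + \<beta> ((fst p)\<^sup>2)) * (?e (snd p) * (of_real (B (fst p)) * v (P p))))"
  have box: "compact ({0..1} \<times> {0..2*pi} :: (real \<times> real) set)" by (intro compact_Times) auto
  have cfst2: "continuous_on UNIV (\<lambda>p :: real \<times> real. (fst p)\<^sup>2)" by (intro continuous_intros)
  have Cbox: "\<bar>\<beta> ((fst p)\<^sup>2)\<bar> \<le> C" if "p \<in> {0..1} \<times> {0..2*pi}" for p :: "real \<times> real"
    by (rule C) (use that in \<open>auto simp: power_le_one\<close>)
  have int1: "integrable (lborel \<Otimes>\<^sub>M lborel) ?F1"
    unfolding lborel_prod
    by (rule borel_integrable_compact[OF box], rule continuous_on_subset[of UNIV])
       (intro continuous_intros ce ca cfst cA, simp)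
  have int2: "integrable (lborel \<Otimes>\<^sub>M lborel) ?F2"
    unfolding lborel_prod
  proof (rule weighted_compact_integrable[OF \<beta> box Cbox cfst2])
    have "continuous_on UNIV (\<lambda>r. real N * r ^ N * h (r\<^sup>2))" by (intro continuous_intros comp ch)
    note q = continuous_on_of_real[OF cfst[OF this]]
    show "continuous_on UNIV (\<lambda>p. ?e (snd p) * (\<i> * of_real (real N * fst p ^ N * h ((fst p)\<^sup>2)) * w p))"
      by (rule continuous_on_mult[OF ce continuous_on_mult[OF continuous_on_mult[OF continuous_on_const q] cw]])
  qed
  have int3: "integrable (lborel \<Otimes>\<^sub>M lborel) ?F3"
    unfolding lborel_prod
    by (rule weighted_compact_integrable[OF \<beta> box Cbox cfst2])
       (simp, intro continuous_intros ce cvP cv cfst cB)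
  have I_eq: "?I (r, \<theta>) = indicator {0..1} r * indicator {0..2*pi} \<theta>" for r \<theta>
    by (simp add: indicator_times)

  define S where "S x = (\<Sum>i\<in>UNIV. flux ?\<sigma> ?g x $ i * ?k x $ i)" for x
  have S_meas: "S \<in> borel_measurable borel"
  proof -
    have [measurable]: "(\<lambda>x :: plane. x $ i) \<in> borel_measurable borel" "(\<lambda>x :: plane. (norm x)\<^sup>2) \<in> borel_measurable borel" for i
      by (intro borel_measurable_continuous_onI continuous_intros)+
    have nthm: "(\<lambda>x. f x $ i) \<in> borel_measurable borel" if "continuous_on UNIV f" for f :: "plane \<Rightarrow> complex ^ 2" and i
      by (rule borel_measurable_continuous_onI) (intro continuous_intros that)
    note [measurable] = nthm[OF cg(1)] nthm[OF cg(2)] \<beta>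
    show ?thesis unfolding S_def[abs_def] flux_angular_coeff by measurable
  qed
  obtain Bg where Bg: "0 < Bg" "\<And>x. x \<in> cball 0 1 \<Longrightarrow> norm (?g x) \<le> Bg"
    using continuous_imp_bounded_disc[OF cg(1)] by blast
  obtain Bk where Bk: "0 < Bk" "\<And>x. x \<in> cball 0 1 \<Longrightarrow> norm (?k x) \<le> Bk"
    using continuous_imp_bounded_disc[OF cg(2)] by blast
  have S_le: "norm (S x) \<le> 2 * (4 * (1 + C) * Bg * Bk)" if x: "x \<in> disc" for x
  proof -
    have C0: "0 \<le> 1 + C" by (rule bounded_coeff_nonneg[OF bdd])
    have f: "norm (flux ?\<sigma> ?g x) \<le> 4 * (1 + C) * Bg"
    proof -
      have "4 * (1 + C) * norm (?g x) \<le> 4 * (1 + C) * Bg"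
        by (rule mult_left_mono[OF Bg(2)[OF disc_subset_cball[OF x]]]) (use C0 in simp)
      with flux_norm_le[OF bdd x, of ?g] show ?thesis by (rule order_trans)
    qed
    have "norm (S x) \<le> (\<Sum>i\<in>(UNIV::2 set). 4 * (1 + C) * Bg * Bk)"
      unfolding S_def
    proof (rule sum_norm_le)
      fix i :: 2
      have "norm (flux ?\<sigma> ?g x $ i) \<le> 4 * (1 + C) * Bg" "norm (?k x $ i) \<le> Bk"
        using Finite_Cartesian_Product.norm_nth_le[of "flux ?\<sigma> ?g x" i] f
          Finite_Cartesian_Product.norm_nth_le[of "?k x" i] Bk(2)[OF disc_subset_cball[OF x]] by (auto simp del: classical_grad_nth)
      then show "norm (flux ?\<sigma> ?g x $ i * ?k x $ i) \<le> 4 * (1 + C) * Bg * Bk"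
        unfolding norm_mult by (rule mult_mono) (use C0 Bg(1) in auto)
    qed
    then show ?thesis by simp
  qed
  have "energy disc ?\<sigma> ?g ?k = (LINT x|lebesgue_on disc. S x)"
    by (simp only: energy_flux S_def)
  also have "\<dots> = (LINT p|lborel. ?I p *\<^sub>R (fst p *\<^sub>R S (P p)))"
    unfolding P_def by (rule polar_coordinates[OF S_meas S_le])
  also have "\<dots> = (LINT p|lborel. ?I p *\<^sub>R (?e (snd p) * (of_real (A (fst p)) * a p))
      + ?I p *\<^sub>R (of_real (1 + \<beta> ((fst p)\<^sup>2)) * (?e (snd p) * (\<i> * of_real (real N * fst p ^ N * h ((fst p)\<^sup>2)) * w p))))"
  proof (rule Bochner_Integration.integral_cong[OF refl])
    fix p :: "real \<times> real"
    show "?I p *\<^sub>R (fst p *\<^sub>R S (P p)) = ?I p *\<^sub>R (?e (snd p) * (of_real (A (fst p)) * a p))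
      + ?I p *\<^sub>R (of_real (1 + \<beta> ((fst p)\<^sup>2)) * (?e (snd p) * (\<i> * of_real (real N * fst p ^ N * h ((fst p)\<^sup>2)) * w p)))"
    proof (cases "p \<in> {0..1} \<times> {0..2*pi}")
      case True
      then have r: "0 \<le> fst p" by auto
      have k: "?k (P p) = (\<chi> i. if i = 1 then partial 1 v (P p) else partial 2 v (P p))"
        by (simp add: vec_eq_iff forall_2)
      have g: "?g (fst p *\<^sub>R circle_point (snd p)) $ i =
          of_nat N * cplx (axis i 1) * cplx (fst p *\<^sub>R circle_point (snd p)) ^ (N - 1) * of_real (h ((fst p)\<^sup>2))
          + cplx (fst p *\<^sub>R circle_point (snd p)) ^ N * of_real (h' ((fst p)\<^sup>2) * (2 * (fst p *\<^sub>R circle_point (snd p)) $ i))" for i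
        using radial_mode_partial(2)[OF d, where N=N and i=i and x="fst p *\<^sub>R circle_point (snd p)"] by simp
      have "of_real (fst p) * S (P p) = ?e (snd p) * (of_real (A (fst p)) * a p
          + of_real (1 + \<beta> ((fst p)\<^sup>2)) * (\<i> * of_real (real N * fst p ^ N * h ((fst p)\<^sup>2)) * w p))"
        using radial_mode_polar_integrand[where N=N and r="fst p" and \<theta>="snd p" and h=h and h'=h' and \<beta>=\<beta> and g="?g"
            and k="?k (P p)", OF N r k g]
        unfolding S_def A_def a_def w_def P_def radial_deriv_def tangential_deriv_def .
      then have "fst p *\<^sub>R S (P p) = ?e (snd p) * (of_real (A (fst p)) * a p
          + of_real (1 + \<beta> ((fst p)\<^sup>2)) * (\<i> * of_real (real N * fst p ^ N * h ((fst p)\<^sup>2)) * w p))"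
        by (simp only: scaleR_conv_of_real)
      then show ?thesis using True by (simp add: algebra_simps)
    qed simp
  qed
  also have "\<dots> = (LINT p|lborel. ?I p *\<^sub>R (?e (snd p) * (of_real (A (fst p)) * a p)))
      + (LINT p|lborel. ?I p *\<^sub>R (of_real (1 + \<beta> ((fst p)\<^sup>2)) * (?e (snd p) * (\<i> * of_real (real N * fst p ^ N * h ((fst p)\<^sup>2)) * w p))))"
    (is "_ = ?J1 + ?J2")
    by (rule Bochner_Integration.integral_add[OF int1[unfolded lborel_prod] int2[unfolded lborel_prod]])
  also have "?J2 = (LINT p|lborel. ?I p *\<^sub>R (of_real (1 + \<beta> ((fst p)\<^sup>2)) * (?e (snd p) * (of_real (B (fst p)) * v (P p)))))"
    (is "_ = ?J3")
  proof -
    have "(LINT \<theta>|lborel. ?F2 (r, \<theta>)) = (LINT \<theta>|lborel. ?F3 (r, \<theta>))" for r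
    proof -
      let ?JV = "LINT \<theta>|lborel. indicator {0..2*pi} \<theta> *\<^sub>R (?e \<theta> * v (r *\<^sub>R circle_point \<theta>))"
      let ?JW = "LINT \<theta>|lborel. indicator {0..2*pi} \<theta> *\<^sub>R (?e \<theta> * (of_real r * tangential_deriv v r \<theta>))"
      define K where "K = complex_of_real (indicator {0..1} r * (1 + \<beta> (r\<^sup>2)))"
      define q where "q = r ^ (N - 1)"
      have rN: "r ^ N = q * r" using N power_minus_mult[of N r] by (simp add: q_def)
      have "(LINT \<theta>|lborel. ?F2 (r, \<theta>)) = K * (\<i> * of_real (real N * q * h (r\<^sup>2))) * ?JW"
        unfolding integral_mult_right_zero[symmetric]
        by (rule Bochner_Integration.integral_cong[OF refl])
           (simp add: I_eq K_def w_def P_def rN scaleR_conv_of_real[where 'a=complex]; simp add: mult_ac)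
      also have "\<dots> = K * of_real (B r) * ?JV"
        unfolding integral_angular_by_parts[OF v] B_def q_def[symmetric]
        by (simp add: power2_eq_square mult_ac)
      also have "\<dots> = (LINT \<theta>|lborel. ?F3 (r, \<theta>))"
        unfolding integral_mult_right_zero[symmetric]
        by (rule Bochner_Integration.integral_cong[OF refl])
           (simp add: I_eq K_def P_def scaleR_conv_of_real[where 'a=complex]; simp add: mult_ac)
      finally show ?thesis .
    qed
    then have "(LINT r|lborel. LINT \<theta>|lborel. ?F2 (r, \<theta>)) = (LINT r|lborel. LINT \<theta>|lborel. ?F3 (r, \<theta>))"
      by (simp only:)
    then show ?thesis
      unfolding lborel_pair.integral_fst'[OF int2] lborel_pair.integral_fst'[OF int3] unfolding lborel_prod .
  qed
  also have "?J1 + ?J3 = (LINT \<theta>|lborel. indicator {0..2*pi} \<theta> *\<^sub>R (?e \<theta> * (of_real (A 1) * v (circle_point \<theta>))))"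
  proof -
    have ode': "(A has_real_derivative (1 + \<beta> (r\<^sup>2)) * B r) (at r)" if "r \<in> {0<..<1} - E" for r
      unfolding A_def[abs_def] B_def by (rule bspec[OF ode that])
    have inner: "(LINT r|lborel. ?F1 (r, \<theta>) + ?F3 (r, \<theta>)) = indicator {0..2*pi} \<theta> *\<^sub>R (?e \<theta> * (of_real (A 1) * v (circle_point \<theta>)))" for \<theta>
    proof -
      define K where "K = of_real (indicator {0..2*pi} \<theta>) * ?e \<theta>"
      have "(LINT r|lborel. ?F1 (r, \<theta>) + ?F3 (r, \<theta>)) = K * (LINT r|lborel. indicator {0..1} r *\<^sub>R (of_real (A r) * radial_deriv v r \<theta>
          + of_real (1 + \<beta> (r\<^sup>2)) * (of_real (B r) * v (r *\<^sub>R circle_point \<theta>))))"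
        unfolding integral_mult_right_zero[symmetric]
      proof (rule Bochner_Integration.integral_cong[OF refl])
        fix r
        show "?F1 (r, \<theta>) + ?F3 (r, \<theta>) = K * (indicator {0..1} r *\<^sub>R (of_real (A r) * radial_deriv v r \<theta>
          + of_real (1 + \<beta> (r\<^sup>2)) * (of_real (B r) * v (r *\<^sub>R circle_point \<theta>))))"
          unfolding I_eq K_def a_def P_def fst_conv snd_conv scaleR_conv_of_real[where 'a=complex] of_real_mult[of "indicator _ _" "indicator _ _"]
          by (simp only: distrib_left mult_ac)
      qed
      also have "\<dots> = K * (of_real (A 1) * v (circle_point \<theta>))"
      proof -
        have "(LINT r|lborel. indicator {0..1} r *\<^sub>R (of_real (A r) * radial_deriv v r \<theta>
            + of_real (1 + \<beta> (r\<^sup>2)) * (of_real (B r) * v (r *\<^sub>R circle_point \<theta>)))) = of_real (A 1) * v (circle_point \<theta>)"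
          using v \<beta> C cB E ode' cA A0 by (rule integral_radial_FTC)
        then show ?thesis by (simp only:)
      qed
      finally show ?thesis by (simp add: K_def scaleR_conv_of_real mult_ac)
    qed
    have "?J1 + ?J3 = (LINT p|lborel. ?F1 p + ?F3 p)"
      by (rule Bochner_Integration.integral_add[symmetric, OF int1[unfolded lborel_prod] int3[unfolded lborel_prod]])
    also have "\<dots> = (LINT \<theta>|lborel. LINT r|lborel. ?F1 (r, \<theta>) + ?F3 (r, \<theta>))"
      using lborel_pair.integral_snd[of "\<lambda>r \<theta>. ?F1 (r, \<theta>) + ?F3 (r, \<theta>)"] Bochner_Integration.integrable_add[OF int1 int3]
      by (simp only: lborel_prod case_prod_beta' prod.collapse)
    finally show ?thesis unfolding inner .
  qed
  also have "\<dots> = of_real (A 1) * (LINT \<theta>|lborel. indicator {0..2*pi} \<theta> *\<^sub>R (?e \<theta> * v (circle_point \<theta>)))"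
    unfolding integral_mult_right_zero[symmetric]
    by (rule Bochner_Integration.integral_cong) (simp_all add: scaleR_conv_of_real mult_ac)
  finally show ?thesis unfolding A1 .
qed

section \<open>The Dirichlet-to-Neumann map on a single mode\<close>

lemma integral_circle_eq:
  fixes f :: "real \<Rightarrow> complex"
  assumes "f \<in> borel_measurable borel"
  shows "(LINT \<theta>|lebesgue_on {0..2*pi}. f \<theta>) = (LINT \<theta>|lborel. indicator {0..2*pi} \<theta> *\<^sub>R f \<theta>)"
proof -
  have "(LINT \<theta>|lebesgue_on {0..2*pi}. f \<theta>) = (LINT \<theta>|lebesgue. indicator {0..2*pi} \<theta> *\<^sub>R f \<theta>)"
    by (rule integral_restrict_space) simp
  also have "\<dots> = (LINT \<theta>|lborel. indicator {0..2*pi} \<theta> *\<^sub>R f \<theta>)"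
    by (rule integral_completion) (use assms in measurable)
  finally show ?thesis .
qed

lemma continuous_on_circle_mode: "continuous_on S (circle_mode k)"
  unfolding circle_mode_def by (intro continuous_intros)

lemma norm_circle_mode [simp]: "norm (circle_mode k \<theta>) = 1"
  by (simp add: circle_mode_def)

lemma continuous_imp_L2_on_circle:
  fixes f :: "real \<Rightarrow> complex"
  assumes "continuous_on UNIV f"
  shows "f \<in> L2_on {0..2*pi}"
proof -
  have "compact (f ` {0..2*pi})"
    by (rule compact_continuous_image) (use assms in \<open>auto intro: continuous_on_subset\<close>)
  then obtain B where "0 < B" "\<And>x. x \<in> {0..2*pi} \<Longrightarrow> norm (f x) \<le> B"
    using compact_imp_bounded[of "f ` {0..2*pi}"] by (auto simp: bounded_pos)
  moreover have "f \<in> borel_measurable (lebesgue_on {0..2*pi})"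
    by (rule continuous_imp_measurable_on_sets_lebesgue) (use assms in \<open>auto intro: continuous_on_subset\<close>)
  ultimately show ?thesis by (intro bounded_imp_L2_on(1)[of _ f B]) auto
qed

text \<open>
  Green's formula holds for smooth \<open>v\<close>.  Approximation by test functions gives the weak equation, and
  approximation by the smooth functions in the definition of the trace gives the functional, since the
  energy and the boundary integral are both continuous along these approximations.
\<close>

lemma is_DN_radial_mode:
  fixes h h' \<beta> :: "real \<Rightarrow> real"
  assumes N: "N \<ge> 1"
    and \<beta>: "\<beta> \<in> borel_measurable borel" and C: "\<And>y. 0 \<le> y \<Longrightarrow> y \<le> 1 \<Longrightarrow> \<bar>\<beta> y\<bar> \<le> C"
    and sol: "radial_solution N \<beta> h h'"
  shows "is_DN (angular_coeff \<beta>) (\<lambda>\<theta>. of_real (h 1) * circle_mode (int N) \<theta>)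
    (\<lambda>\<psi>. of_real (real N * h 1 + 2 * h' 1) * (LINT \<theta>|lebesgue_on {0..2*pi}. cnj (\<psi> \<theta>) * circle_mode (int N) \<theta>))"
  unfolding is_DN_def
proof (intro exI[of _ "radial_mode N h"] conjI allI impI)
  note d = radial_solutionD(1)[OF sol] and c = radial_solutionD(2)[OF sol]
  let ?\<sigma> = "angular_coeff \<beta>" and ?u = "radial_mode N h" and ?e = "circle_mode (int N)"
  let ?L = "of_real (real N * h 1 + 2 * h' 1) :: complex"
  show "has_trace ?u (\<lambda>\<theta>. of_real (h 1) * ?e \<theta>)" using d c by (rule has_trace_radial_mode)
  have Cu: "Ck (Suc 0) ?u" using d c by (rule Ck_radial_mode)
  have bdd: "bounded_coeff (1 + C) ?\<sigma>" using \<beta> C by (rule bounded_coeff_angular_coeff)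
  have uL: "grad disc ?u \<in> L2_on disc" by (rule grad_L2[OF H1_classical(1)[OF Cu]])
  have cuL: "classical_grad ?u \<in> L2_on disc" by (rule continuous_imp_L2_on_disc[OF continuous_on_classical_grad[OF Cu]])
  have green: "energy disc ?\<sigma> (grad disc ?u) (classical_grad v)
      = ?L * (LINT \<theta>|lborel. indicator {0..2*pi} \<theta> *\<^sub>R (?e \<theta> * v (circle_point \<theta>)))" if v: "Ck (Suc 0) v" for v
  proof -
    have vL: "classical_grad v \<in> L2_on disc" by (rule continuous_imp_L2_on_disc[OF continuous_on_classical_grad[OF v]])
    have "energy disc ?\<sigma> (grad disc ?u) (classical_grad v) = energy disc ?\<sigma> (classical_grad ?u) (classical_grad v)"
      by (rule energy_cong_AE[OF bdd uL vL cuL vL H1_classical(2)[OF Cu]]) simp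
    also have "\<dots> = ?L * (LINT \<theta>|lborel. indicator {0..2*pi} \<theta> *\<^sub>R (?e \<theta> * v (circle_point \<theta>)))"
      using N \<beta> C sol v by (rule green_radial_mode)
    finally show ?thesis .
  qed
  show "divergence_equation disc ?\<sigma> ?u (\<lambda>_. 0)"
    unfolding divergence_equation_def
  proof
    fix v assume v: "v \<in> H10 disc"
    obtain w where w: "\<And>j. w j \<in> test_functions disc" "(\<lambda>j. H1_norm disc (\<lambda>x. w j x - v x)) \<longlonglongrightarrow> 0"
      using H10E[OF v] by blast
    note H = H1_test_function[OF w(1)] H10_H1[OF v]
    have "energy disc ?\<sigma> (grad disc ?u) (grad disc (w j)) = 0" for j
    proof -
      have cw: "Ck (Suc 0) (w j)" by (rule test_functionD(2)[OF w(1)])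
      have z: "w j (circle_point \<theta>) = 0" for \<theta>
      proof -
        obtain K where K: "K \<subseteq> disc" "\<forall>x. x \<notin> K \<longrightarrow> w j x = 0"
          using w(1)[of j] by (auto simp: test_functions_def)
        have "circle_point \<theta> \<notin> disc" by (simp add: disc_eq)
        then show ?thesis using K by blast
      qed
      have "energy disc ?\<sigma> (grad disc ?u) (grad disc (w j)) = energy disc ?\<sigma> (grad disc ?u) (classical_grad (w j))"
        by (rule energy_cong_AE[OF bdd uL grad_L2[OF H(1)] uL
              continuous_imp_L2_on_disc[OF continuous_on_classical_grad[OF cw]] _ H1_classical(2)[OF cw]]) simp
      also have "\<dots> = 0" unfolding green[OF cw] z by simp
      finally show ?thesis .
    qed
    then have "(\<lambda>j. 0) \<longlonglongrightarrow> energy disc ?\<sigma> (grad disc ?u) (grad disc v)"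
      using energy_tendsto[OF bdd uL grad_L2[OF H(1)] grad_L2[OF H(2)] H1_tendstoD(2)[OF H w(2)]] by (simp only:)
    then show "energy disc ?\<sigma> (grad disc ?u) (grad disc v) = 0" by (simp add: LIMSEQ_const_iff)
  qed
  fix \<psi> v assume tr: "has_trace v \<psi>"
  then obtain w where vH: "v \<in> H1 disc" and \<psi>: "\<psi> \<in> L2_on {0..2*pi}"
    and w: "\<forall>j. smooth (w j)" "(\<lambda>j. H1_norm disc (\<lambda>x. w j x - v x)) \<longlonglongrightarrow> 0"
      "(\<lambda>j. L2_norm_on {0..2*pi} (\<lambda>\<theta>. w j (circle_point \<theta>) - \<psi> \<theta>)) \<longlonglongrightarrow> 0"
    unfolding has_trace_def by blast
  have sw: "smooth (w j)" for j using w(1) by blast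
  have cw: "Ck (Suc 0) (w j)" for j by (rule smooth_Ck[OF sw])
  have cw': "Ck (Suc 0) (\<lambda>x. cnj (w j x))" for j by (rule smooth_Ck[OF smooth_cnj[OF sw]])
  have wH: "w j \<in> H1 disc" for j by (rule H1_smooth[OF sw])
  have cwL: "(\<lambda>x. cnj_vec (grad disc (w j) x)) \<in> L2_on disc" for j by (rule L2_on_cnj_vec[OF grad_L2[OF wH]])
  have cvL: "(\<lambda>x. cnj_vec (grad disc v x)) \<in> L2_on disc" by (rule L2_on_cnj_vec[OF grad_L2[OF vH]])
  have "L2_norm_on disc (\<lambda>x. cnj_vec (grad disc (w j) x) - cnj_vec (grad disc v x))
      = L2_norm_on disc (\<lambda>x. grad disc (w j) x - grad disc v x)" for j
    by (rule L2_norm_on_cong) (simp flip: cnj_vec_diff)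
  then have "(\<lambda>j. L2_norm_on disc (\<lambda>x. cnj_vec (grad disc (w j) x) - cnj_vec (grad disc v x))) \<longlonglongrightarrow> 0"
    using H1_tendstoD(2)[OF wH vH w(2)] by (simp only:)
  from energy_tendsto[OF bdd uL cwL cvL this]
  have lim1: "(\<lambda>j. energy disc ?\<sigma> (grad disc ?u) (\<lambda>x. cnj_vec (grad disc (w j) x)))
      \<longlonglongrightarrow> energy disc ?\<sigma> (grad disc ?u) (\<lambda>x. cnj_vec (grad disc v x))" .
  have E_w: "energy disc ?\<sigma> (grad disc ?u) (\<lambda>x. cnj_vec (grad disc (w j) x))
      = ?L * (LINT \<theta>|lebesgue_on {0..2*pi}. cnj (w j (circle_point \<theta>)) * ?e \<theta>)" for j
  proof -
    have conj: "cnj_vec (classical_grad (w j) x) = classical_grad (\<lambda>x. cnj (w j x)) x" for x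
      by (simp add: vec_eq_iff partial_cnj[OF smooth_differentiable[OF sw]])
    have "AE x in lebesgue_on disc. cnj_vec (grad disc (w j) x) = classical_grad (\<lambda>x. cnj (w j x)) x"
      using H1_classical(2)[OF cw[of j]] by eventually_elim (simp only: conj)
    then have "energy disc ?\<sigma> (grad disc ?u) (\<lambda>x. cnj_vec (grad disc (w j) x))
        = energy disc ?\<sigma> (grad disc ?u) (classical_grad (\<lambda>x. cnj (w j x)))"
      by (intro energy_cong_AE[OF bdd uL cwL uL continuous_imp_L2_on_disc[OF continuous_on_classical_grad[OF cw']]]) simp_all
    also have "\<dots> = ?L * (LINT \<theta>|lborel. indicator {0..2*pi} \<theta> *\<^sub>R (?e \<theta> * cnj (w j (circle_point \<theta>))))"
      by (rule green[OF cw'])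
    also have "(LINT \<theta>|lborel. indicator {0..2*pi} \<theta> *\<^sub>R (?e \<theta> * cnj (w j (circle_point \<theta>))))
        = (LINT \<theta>|lebesgue_on {0..2*pi}. ?e \<theta> * cnj (w j (circle_point \<theta>)))"
    proof (rule integral_circle_eq[symmetric], rule borel_measurable_continuous_onI)
      have "continuous_on UNIV (\<lambda>\<theta>. cnj (w j (circle_point \<theta>)))"
        by (rule continuous_on_compose2[OF Ck_continuous[OF cw'] continuous_on_circle_point]) simp
      then show "continuous_on UNIV (\<lambda>\<theta>. ?e \<theta> * cnj (w j (circle_point \<theta>)))"
        by (intro continuous_on_mult continuous_on_circle_mode)
    qed
    finally show ?thesis by (simp only: mult.commute)
  qed
  have c\<psi>: "(\<lambda>\<theta>. cnj (\<psi> \<theta>)) \<in> L2_on {0..2*pi}" by (rule L2_on_cnj[OF \<psi>])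
  have cwc: "(\<lambda>\<theta>. cnj (w j (circle_point \<theta>))) \<in> L2_on {0..2*pi}" for j
    by (rule continuous_imp_L2_on_circle)
       (rule continuous_on_compose2[OF Ck_continuous[OF cw'] continuous_on_circle_point], simp)
  have eL: "?e \<in> L2_on {0..2*pi}" by (rule continuous_imp_L2_on_circle[OF continuous_on_circle_mode])
  have "L2_norm_on {0..2*pi} (\<lambda>\<theta>. cnj (w j (circle_point \<theta>)) - cnj (\<psi> \<theta>))
      = L2_norm_on {0..2*pi} (\<lambda>\<theta>. w j (circle_point \<theta>) - \<psi> \<theta>)" for j
    by (rule L2_norm_on_cong) (simp flip: complex_cnj_diff)
  then have "(\<lambda>j. L2_norm_on {0..2*pi} (\<lambda>\<theta>. cnj (w j (circle_point \<theta>)) - cnj (\<psi> \<theta>))) \<longlonglongrightarrow> 0"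
    using w(3) by (simp only:)
  from tendsto_mult_left[OF L2_integral_tendsto[OF eL c\<psi> cwc this], of ?L]
  have "(\<lambda>j. energy disc ?\<sigma> (grad disc ?u) (\<lambda>x. cnj_vec (grad disc (w j) x)))
      \<longlonglongrightarrow> ?L * (LINT \<theta>|lebesgue_on {0..2*pi}. cnj (\<psi> \<theta>) * ?e \<theta>)"
    unfolding E_w .
  from LIMSEQ_unique[OF this lim1]
  show "?L * (LINT \<theta>|lebesgue_on {0..2*pi}. cnj (\<psi> \<theta>) * ?e \<theta>)
      = energy disc ?\<sigma> (grad disc ?u) (\<lambda>x. \<chi> i. cnj (grad disc v x $ i))"
    by (simp only: cnj_vec_def)
qed

section \<open>The radial profile\<close>

text \<open>
  With \<open>y = r\<^sup>2\<close> and \<open>u = z\<^sup>N h(\<bar>z\<bar>\<^sup>2)\<close> the radial equation becomes \<open>4 y\<^sup>1\<^sup>-\<^sup>N k' = \<beta> N\<^sup>2 h\<close> for \<open>k = y\<^sup>N\<^sup>+\<^sup>1 h'\<close>.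
  On the window \<open>y\<^sub>0 < y < y\<^sub>1\<close> the function \<open>k\<close> is taken to be a multiple of \<open>y\<^sup>N - y\<^sub>0\<^sup>N\<close>, which
  makes \<open>\<beta> h\<close> equal to the constant \<open>\<alpha>\<close>; \<open>k\<close> is constant on either side, where then \<open>\<beta> = 0\<close>.
\<close>

lemma radial_profile:
  fixes \<alpha> y0 y1 :: real
  assumes \<alpha>: "0 \<le> \<alpha>" and N: "N \<ge> 1" and y: "0 < y0" "y0 < y1" "y1 < 1"
  obtains h h' \<beta> :: "real \<Rightarrow> real" where
    "radial_solution N \<beta> h h'" "\<beta> \<in> borel_measurable borel" "\<And>y. 0 \<le> y \<Longrightarrow> y \<le> 1 \<Longrightarrow> 0 \<le> \<beta> y \<and> \<beta> y \<le> \<alpha>"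
    "\<And>y. y \<notin> {y0<..<y1} \<Longrightarrow> \<beta> y = 0"
    "1 \<le> h 1" "h 1 \<le> 1 + \<alpha> * real N / 4 * (1 - y0) / y0" "h' 1 = \<alpha> * real N / 4 * (y1 ^ N - y0 ^ N)"
proof -
  define k where "k y = \<alpha> * real N / 4 * (min (max y y0) y1 ^ N - y0 ^ N)" for y
  \<comment> \<open>\<open>k\<close> vanishes below \<open>y0\<close>, so the maximum only keeps the denominator away from zero.  Integrating
    from \<open>-1\<close> makes \<open>h\<close> differentiable at \<open>0\<close> from both sides.\<close>
  define h' where "h' y = k y / max y y0 ^ (N + 1)" for y
  define h where "h y = 1 + integral {-1..y} h'" for y
  define \<beta> where "\<beta> y = (if y0 < y \<and> y < y1 then \<alpha> / h y else 0)" for y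
  have k0: "0 \<le> k y" for y
    unfolding k_def by (intro mult_nonneg_nonneg divide_nonneg_nonneg) (use \<alpha> y in \<open>auto intro!: power_mono\<close>)
  have h'0: "0 \<le> h' y" for y unfolding h'_def using k0 y by simp
  have m0: "max y y0 \<noteq> 0" for y using y by linarith
  have ch': "continuous_on S h'" for S
    unfolding h'_def[abs_def] k_def[abs_def] by (intro continuous_intros ballI) (use m0 in simp)
  have d: "(h has_real_derivative h' y) (at y)" if "-1 < y" for y
  proof -
    have "((\<lambda>u. integral {-1..u} h') has_vector_derivative h' y) (at y within {-1..y+1})"
      by (rule integral_has_vector_derivative[OF ch']) (use that in auto)
    then have "((\<lambda>u. integral {-1..u} h') has_vector_derivative h' y) (at y)"
      by (subst (asm) at_within_interior) (use that in auto)
    then have "((\<lambda>u. 1 + integral {-1..u} h') has_real_derivative 0 + h' y) (at y)"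
      by (intro DERIV_add DERIV_const) (simp add: has_real_derivative_iff_has_vector_derivative)
    then show ?thesis by (simp add: h_def[abs_def])
  qed
  have h1: "1 \<le> h y" for y
    unfolding h_def using integral_nonneg[OF integrable_continuous_real[OF ch'] , of "-1" y] h'0 by simp
  have ch: "continuous_on {-1<..} h"
    by (intro continuous_at_imp_continuous_on ballI) (auto intro: DERIV_isCont[OF d])
  have \<beta>m: "\<beta> \<in> borel_measurable borel"
  proof -
    have "(\<lambda>y. if y \<in> {y0<..<y1} then \<alpha> / h y else 0) \<in> borel_measurable borel"
    proof (rule borel_measurable_continuous_on_if)
      have "h y \<noteq> 0" for y using h1[of y] by linarith
      then show "continuous_on {y0<..<y1} (\<lambda>y. \<alpha> / h y)"
        by (intro continuous_intros continuous_on_subset[OF ch]) (use y in auto)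
    qed auto
    then show ?thesis by (simp add: \<beta>_def[abs_def])
  qed
  have \<beta>b: "0 \<le> \<beta> y \<and> \<beta> y \<le> \<alpha>" for y
  proof -
    have "\<alpha> / h y \<le> \<alpha> / 1" using h1[of y] \<alpha> by (intro divide_left_mono) auto
    moreover have "0 \<le> \<alpha> / h y" using h1[of y] \<alpha> by (intro divide_nonneg_nonneg) auto
    ultimately show ?thesis using \<alpha> by (simp add: \<beta>_def)
  qed
  have h'_low: "h' y = 0" if "y \<le> y0" for y
    using that y by (simp add: h'_def k_def max_def min_def)
  \<comment> \<open>For \<open>h'(s\<^sup>2) = \<kappa>(s)/s\<^sup>2\<^sup>N\<^sup>+\<^sup>2\<close>, the term from differentiating \<open>h\<close> cancels the one from differentiating \<open>s\<^sup>-\<^sup>N\<close>.\<close>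
  have gen: "((\<lambda>r. real N * r ^ N * h (r\<^sup>2) + 2 * r ^ (N + 2) * h' (r\<^sup>2)) has_real_derivative
        (real N)\<^sup>2 * r ^ (N - 1) * h (r\<^sup>2) + 2 * \<kappa>' / r ^ N) (at r)"
    if r: "0 < r" and \<kappa>: "(\<kappa> has_real_derivative \<kappa>') (at r)" and S: "open S" "r \<in> S" "S \<subseteq> {0<..}"
      and eq: "\<And>s. s \<in> S \<Longrightarrow> h' (s\<^sup>2) = \<kappa> s / (s ^ (N + 1))\<^sup>2" for r \<kappa> \<kappa>' S
  proof -
    obtain m where m: "N = Suc m" using N by (cases N) auto
    have "-1 < r\<^sup>2" using zero_le_power2[of r] by linarith
    then have dh: "((\<lambda>r. h (r\<^sup>2)) has_real_derivative h' (r\<^sup>2) * (2 * r)) (at r)"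
      by (intro DERIV_chain2[OF d]) (auto intro!: derivative_eq_intros)
    have "((\<lambda>r. real N * r ^ N * h (r\<^sup>2)) has_real_derivative
        real N * (real N * r ^ (N - 1)) * h (r\<^sup>2) + real N * r ^ N * (h' (r\<^sup>2) * (2 * r))) (at r)"
      using dh by (auto intro!: derivative_eq_intros simp: algebra_simps)
    moreover have "((\<lambda>r. 2 * r ^ (N + 2) * h' (r\<^sup>2)) has_real_derivative
        (2 * \<kappa>' * r ^ N - 2 * \<kappa> r * (real N * r ^ (N - 1))) / (r ^ N * r ^ N)) (at r)"
    proof (rule has_field_derivative_transform_within_open[OF _ S(1,2)])
      show "((\<lambda>r. 2 * \<kappa> r / r ^ N) has_real_derivative
          (2 * \<kappa>' * r ^ N - 2 * \<kappa> r * (real N * r ^ (N - 1))) / (r ^ N * r ^ N)) (at r)"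
        using r \<kappa> by (auto intro!: derivative_eq_intros)
      fix s assume s: "s \<in> S"
      then have "s \<noteq> 0" using S(3) by auto
      then show "2 * \<kappa> s / s ^ N = 2 * s ^ (N + 2) * h' (s\<^sup>2)"
        unfolding eq[OF s] by (simp add: divide_simps power_add power2_eq_square)
    qed
    ultimately have D: "((\<lambda>r. real N * r ^ N * h (r\<^sup>2) + 2 * r ^ (N + 2) * h' (r\<^sup>2)) has_real_derivative
        (real N * (real N * r ^ (N - 1)) * h (r\<^sup>2) + real N * r ^ N * (h' (r\<^sup>2) * (2 * r)))
         + (2 * \<kappa>' * r ^ N - 2 * \<kappa> r * (real N * r ^ (N - 1))) / (r ^ N * r ^ N)) (at r)"
      by (rule DERIV_add)
    have e: "real N * r ^ N * (h' (r\<^sup>2) * (2 * r)) + (2 * \<kappa>' * r ^ N - 2 * \<kappa> r * (real N * r ^ (N - 1))) / (r ^ N * r ^ N)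
        = 2 * \<kappa>' / r ^ N"
      unfolding eq[OF S(2)] using r by (simp add: m divide_simps power2_eq_square)
    show ?thesis
      by (rule DERIV_cong[OF D]) (unfold add.assoc e, simp add: power2_eq_square mult.assoc)
  qed
  have ode: "((\<lambda>r. real N * r ^ N * h (r\<^sup>2) + 2 * r ^ (N + 2) * h' (r\<^sup>2)) has_real_derivative
        (1 + \<beta> (r\<^sup>2)) * ((real N)\<^sup>2 * r ^ (N - 1) * h (r\<^sup>2))) (at r)" if r: "r \<in> {0<..<1} - {sqrt y0, sqrt y1}" for r
  proof -
    have r0: "0 < r" "r < 1" "r\<^sup>2 \<noteq> y0" "r\<^sup>2 \<noteq> y1" using r y by (auto simp: real_sqrt_unique)
    have pow: "(s\<^sup>2) ^ (N + 1) = (s ^ (N + 1))\<^sup>2" for s :: real by (simp only: power_mult[symmetric] mult.commute)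
    consider "r\<^sup>2 < y0" | "y0 < r\<^sup>2" "r\<^sup>2 < y1" | "y1 < r\<^sup>2" using r0 by linarith
    then show ?thesis
    proof cases
      case 1
      have "((\<lambda>r. real N * r ^ N * h (r\<^sup>2) + 2 * r ^ (N + 2) * h' (r\<^sup>2)) has_real_derivative
          (real N)\<^sup>2 * r ^ (N - 1) * h (r\<^sup>2) + 2 * 0 / r ^ N) (at r)"
      proof (rule gen[of r "\<lambda>_. 0" 0 "{0<..} \<inter> {s. s\<^sup>2 < y0}"])
        show "open ({0<..} \<inter> {s :: real. s\<^sup>2 < y0})"
          by (intro open_Int open_Collect_less continuous_intros open_greaterThan)
      qed (use 1 r0 h'_low in auto)
      then show ?thesis using 1 by (simp add: \<beta>_def)
    next
      case 2
      have "((\<lambda>r. real N * r ^ N * h (r\<^sup>2) + 2 * r ^ (N + 2) * h' (r\<^sup>2)) has_real_derivative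
          (real N)\<^sup>2 * r ^ (N - 1) * h (r\<^sup>2) + 2 * (\<alpha> * real N / 4 * (real N * (r\<^sup>2) ^ (N - 1) * (2 * r))) / r ^ N) (at r)"
      proof (rule gen[of r "\<lambda>s. \<alpha> * real N / 4 * ((s\<^sup>2) ^ N - y0 ^ N)" _ "{0<..} \<inter> ({s. y0 < s\<^sup>2} \<inter> {s. s\<^sup>2 < y1})"])
        show "open ({0<..} \<inter> ({s :: real. y0 < s\<^sup>2} \<inter> {s. s\<^sup>2 < y1}))"
          by (intro open_Int open_Collect_less continuous_intros open_greaterThan)
        show "((\<lambda>s. \<alpha> * real N / 4 * ((s\<^sup>2) ^ N - y0 ^ N)) has_real_derivative
            \<alpha> * real N / 4 * (real N * (r\<^sup>2) ^ (N - 1) * (2 * r))) (at r)"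
          by (auto intro!: derivative_eq_intros)
        fix s assume "s \<in> {0<..} \<inter> ({s. y0 < s\<^sup>2} \<inter> {s. s\<^sup>2 < y1})"
        then show "h' (s\<^sup>2) = \<alpha> * real N / 4 * ((s\<^sup>2) ^ N - y0 ^ N) / (s ^ (N + 1))\<^sup>2"
          unfolding h'_def k_def pow[symmetric] by (simp add: max_def min_def)
      qed (use 2 r0 in auto)
      moreover have "2 * (\<alpha> * real N / 4 * (real N * (r\<^sup>2) ^ (N - 1) * (2 * r))) / r ^ N = \<beta> (r\<^sup>2) * ((real N)\<^sup>2 * r ^ (N - 1) * h (r\<^sup>2))"
      proof -
        obtain m where m: "N = Suc m" using N by (cases N) auto
        have "\<beta> (r\<^sup>2) * h (r\<^sup>2) = \<alpha>" using 2 h1[of "r\<^sup>2"] by (simp add: \<beta>_def)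
        then have "\<beta> (r\<^sup>2) * ((real N)\<^sup>2 * r ^ (N - 1) * h (r\<^sup>2)) = \<alpha> * ((real N)\<^sup>2 * r ^ (N - 1))"
          by (simp add: algebra_simps flip: \<open>\<beta> (r\<^sup>2) * h (r\<^sup>2) = \<alpha>\<close>)
        moreover have "(r\<^sup>2) ^ m = r ^ m * r ^ m" by (simp add: power2_eq_square power_mult_distrib)
        ultimately show ?thesis using r0 by (simp add: m power2_eq_square divide_simps)
      qed
      ultimately show ?thesis by (simp add: distrib_right)
    next
      case 3
      have "((\<lambda>r. real N * r ^ N * h (r\<^sup>2) + 2 * r ^ (N + 2) * h' (r\<^sup>2)) has_real_derivative
          (real N)\<^sup>2 * r ^ (N - 1) * h (r\<^sup>2) + 2 * 0 / r ^ N) (at r)"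
      proof (rule gen[of r "\<lambda>_. \<alpha> * real N / 4 * (y1 ^ N - y0 ^ N)" 0 "{0<..} \<inter> {s. y1 < s\<^sup>2}"])
        show "open ({0<..} \<inter> {s :: real. y1 < s\<^sup>2})"
          by (intro open_Int open_Collect_less continuous_intros open_greaterThan)
        fix s assume "s \<in> {0<..} \<inter> {s. y1 < s\<^sup>2}"
        then show "h' (s\<^sup>2) = \<alpha> * real N / 4 * (y1 ^ N - y0 ^ N) / (s ^ (N + 1))\<^sup>2"
          unfolding h'_def k_def pow[symmetric] using y by (simp add: max_def min_def)
      qed (use 3 r0 in auto)
      then show ?thesis using 3 by (simp add: \<beta>_def)
    qed
  qed
  show ?thesis
  proof (rule that[of \<beta> h h'])
    show "radial_solution N \<beta> h h'"
      unfolding radial_solution_def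
      by (intro conjI allI impI exI[of _ "{sqrt y0, sqrt y1}"] ballI ode ch') (simp_all add: d)
    show "h 1 \<le> 1 + \<alpha> * real N / 4 * (1 - y0) / y0"
    proof -
      have int: "h' integrable_on {a..b}" for a b by (rule integrable_continuous_real[OF ch'])
      have "integral {-1..1} h' = integral {-1..y0} h' + integral {y0..1} h'"
        using Henstock_Kurzweil_Integration.integral_combine[of "-1" y0 1 h'] y int by simp
      also have "integral {-1..y0} h' = integral {-1..y0} (\<lambda>_. 0)"
        by (rule Henstock_Kurzweil_Integration.integral_cong) (simp add: h'_low)
      finally have eq: "integral {-1..1} h' = integral {y0..1} h'" by simp
      have "norm (integral {y0..1} h') \<le> (\<alpha> * real N / 4 / y0) * (1 - y0)"
      proof (rule integral_bound[OF _ ch'])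
        fix t assume t: "t \<in> {y0..1}"
        then have m: "max t y0 = t" and t0: "0 < t" using y by auto
        have "min t y1 ^ N \<le> t ^ N" using t0 y by (intro power_mono) auto
        then have "min t y1 ^ N - y0 ^ N \<le> t ^ N" using zero_le_power[of y0 N] y by linarith
        then have "k t \<le> \<alpha> * real N / 4 * t ^ N"
          unfolding k_def m using \<alpha> by (intro mult_left_mono) auto
        then have "h' t \<le> \<alpha> * real N / 4 * t ^ N / t ^ (N + 1)"
          unfolding h'_def m using t0 by (intro divide_right_mono) auto
        also have "\<dots> = \<alpha> * real N / 4 / t" using t0 by simp
        also have "\<dots> \<le> \<alpha> * real N / 4 / y0" using t y \<alpha> by (intro divide_left_mono) auto
        finally show "norm (h' t) \<le> \<alpha> * real N / 4 / y0" using h'0[of t] by simp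
      qed (use y in simp)
      then show ?thesis unfolding h_def eq by (simp add: field_simps)
    qed
    show "h' 1 = \<alpha> * real N / 4 * (y1 ^ N - y0 ^ N)" using y by (simp add: h'_def k_def max_def min_def)
  qed (use \<beta>m \<beta>b h1 in \<open>auto simp: \<beta>_def\<close>)
qed

section \<open>Fourier coefficients and the operator norm\<close>

lemma circle_mode_orthogonal:
  "(LINT \<theta>|lebesgue_on {0..2*pi}. cnj (circle_mode k \<theta>) * circle_mode j \<theta>) = (if j = k then of_real (2 * pi) else 0)"
proof -
  let ?m = "real_of_int (j - k)"
  have prod: "cnj (circle_mode k \<theta>) * circle_mode j \<theta> = circle_mode (j - k) \<theta>" for \<theta>
    by (simp add: circle_mode_def cis_cnj cis_mult algebra_simps)
  have "(LINT \<theta>|lebesgue_on {0..2*pi}. cnj (circle_mode k \<theta>) * circle_mode j \<theta>)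
      = (LINT \<theta>|lborel. indicator {0..2*pi} \<theta> *\<^sub>R circle_mode (j - k) \<theta>)"
    unfolding prod by (rule integral_circle_eq) (rule borel_measurable_continuous_onI[OF continuous_on_circle_mode])
  also have "\<dots> = (if j = k then of_real (2 * pi) else 0)"
  proof (cases "j = k")
    case True
    have "(LINT \<theta>|lborel. indicator {0..2*pi} \<theta> *\<^sub>R circle_mode (j - k) \<theta>) = of_real (2 * pi) - of_real 0"
    proof (rule integral_FTC_Icc)
      show "((\<lambda>\<theta>. complex_of_real \<theta>) has_vector_derivative circle_mode (j - k) \<theta>) (at \<theta> within {0..2*pi})" for \<theta>
        using has_vector_derivative_of_real[OF DERIV_ident] True by (simp add: circle_mode_def)
    qed (auto intro: continuous_on_circle_mode)
    then show ?thesis using True by simp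
  next
    case False
    then have m: "?m \<noteq> 0" by simp
    let ?F = "\<lambda>\<theta>. complex_of_real (sin (?m * \<theta>) / ?m) + \<i> * of_real (- cos (?m * \<theta>) / ?m)"
    have "(LINT \<theta>|lborel. indicator {0..2*pi} \<theta> *\<^sub>R circle_mode (j - k) \<theta>) = ?F (2 * pi) - ?F 0"
    proof (rule integral_FTC_Icc)
      fix \<theta> :: real
      have s: "((\<lambda>\<theta>. complex_of_real (sin (?m * \<theta>) / ?m)) has_vector_derivative of_real (cos (?m * \<theta>))) (at \<theta> within {0..2*pi})"
        by (rule has_vector_derivative_of_real) (use m in \<open>auto intro!: derivative_eq_intros\<close>)
      have c: "((\<lambda>\<theta>. complex_of_real (- cos (?m * \<theta>) / ?m)) has_vector_derivative of_real (sin (?m * \<theta>))) (at \<theta> within {0..2*pi})"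
        by (rule has_vector_derivative_of_real) (use m in \<open>auto intro!: derivative_eq_intros\<close>)
      have "circle_mode (j - k) \<theta> = of_real (cos (?m * \<theta>)) + \<i> * of_real (sin (?m * \<theta>))"
        by (simp add: circle_mode_def complex_eq_iff)
      then show "(?F has_vector_derivative circle_mode (j - k) \<theta>) (at \<theta> within {0..2*pi})"
        using has_vector_derivative_add[OF s has_vector_derivative_mult_right[OF c, of \<i>]] by simp
    qed (auto intro: continuous_on_circle_mode)
    also have "?F (2 * pi) = ?F 0"
      using sin_int_2pin[of "j - k"] cos_int_2pin[of "j - k"] by (simp add: mult_ac)
    finally show ?thesis using False by simp
  qed
  finally show ?thesis .
qed

lemma fourier_coeff_circle_mode:
  "fourier_coeff (\<lambda>\<theta>. c * circle_mode j \<theta>) = (\<lambda>k. if k = j then c else 0)"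
proof
  fix k
  have "(LINT \<theta>|lebesgue_on {0..2*pi}. c * circle_mode j \<theta> * cnj (circle_mode k \<theta>))
      = c * (LINT \<theta>|lebesgue_on {0..2*pi}. cnj (circle_mode k \<theta>) * circle_mode j \<theta>)"
    unfolding integral_mult_right_zero[symmetric]
    by (rule Bochner_Integration.integral_cong[OF refl]) (simp only: mult_ac)
  then show "fourier_coeff (\<lambda>\<theta>. c * circle_mode j \<theta>) k = (if k = j then c else 0)"
    by (simp add: fourier_coeff_def circle_mode_orthogonal)
qed

lemma powr_squared: "(x powr s)\<^sup>2 = x powr (2 * s)" for x s :: real
  by (simp add: power2_eq_square flip: powr_add)

lemma Hs_norm_single:
  assumes "j \<noteq> 0"
  shows "Hs_norm s (\<lambda>k. if k = j then c else 0) = ereal (real_of_int \<bar>j\<bar> powr s * norm c)"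
proof -
  let ?f = "\<lambda>k. real_of_int \<bar>k\<bar> powr (2 * s) * (norm (if k = j then c else 0))\<^sup>2"
  have "?f summable_on (- {0}) \<longleftrightarrow> ?f summable_on {j}"
    by (rule summable_on_cong_neutral) (use assms in auto)
  then have sum: "?f summable_on (- {0})" by simp
  have "infsum ?f (- {0}) = infsum ?f {j}"
    by (rule infsum_cong_neutral) (use assms in auto)
  also have "\<dots> = real_of_int \<bar>j\<bar> powr (2 * s) * (norm c)\<^sup>2" by simp
  also have "\<dots> = (real_of_int \<bar>j\<bar> powr s * norm c)\<^sup>2"
    by (simp only: power_mult_distrib powr_squared)
  finally have inf: "infsum ?f (- {0}) = (real_of_int \<bar>j\<bar> powr s * norm c)\<^sup>2" .
  show ?thesis
    unfolding Hs_norm_def if_P[OF sum] inf using assms by simp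
qed

lemma Hs_norm_ge:
  assumes "j \<noteq> 0"
  shows "ereal (real_of_int \<bar>j\<bar> powr s * norm (c j)) \<le> Hs_norm s c"
proof -
  let ?f = "\<lambda>k. real_of_int \<bar>k\<bar> powr (2 * s) * (norm (c k))\<^sup>2"
  show ?thesis
  proof (cases "?f summable_on (- {0})")
    case True
    have "sum ?f {j} \<le> infsum ?f (- {0})"
      by (rule finite_sum_le_infsum[OF True]) (use assms in auto)
    then have "(real_of_int \<bar>j\<bar> powr s * norm (c j))\<^sup>2 \<le> infsum ?f (- {0})"
      by (simp add: power_mult_distrib powr_squared)
    then have "(real_of_int \<bar>j\<bar> powr s * norm (c j))\<^sup>2 \<le> (norm (c 0))\<^sup>2 + infsum ?f (- {0})"
      by (rule add_increasing[OF zero_le_power2])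
    then have "real_of_int \<bar>j\<bar> powr s * norm (c j) \<le> sqrt ((norm (c 0))\<^sup>2 + infsum ?f (- {0}))"
      by (rule real_le_rsqrt)
    then show ?thesis unfolding Hs_norm_def if_P[OF True] by simp
  next
    case False
    then show ?thesis unfolding Hs_norm_def by simp
  qed
qed

section \<open>Eigenvalues of the Dirichlet-to-Neumann map\<close>

lemma radial_solution_scale:
  assumes "radial_solution N \<beta> h h'"
  shows "radial_solution N \<beta> (\<lambda>y. t * h y) (\<lambda>y. t * h' y)"
proof -
  note d = radial_solutionD(1)[OF assms] and c = radial_solutionD(2)[OF assms]
  obtain E where E: "finite E" "\<forall>r\<in>{0<..<1} - E.
      ((\<lambda>r. real N * r ^ N * h (r\<^sup>2) + 2 * r ^ (N + 2) * h' (r\<^sup>2)) has_real_derivative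
        (1 + \<beta> (r\<^sup>2)) * ((real N)\<^sup>2 * r ^ (N - 1) * h (r\<^sup>2))) (at r)"
    using radial_solutionD(3)[OF assms] by (elim conjE exE)
  have "((\<lambda>r. real N * r ^ N * (t * h (r\<^sup>2)) + 2 * r ^ (N + 2) * (t * h' (r\<^sup>2))) has_real_derivative
      (1 + \<beta> (r\<^sup>2)) * ((real N)\<^sup>2 * r ^ (N - 1) * (t * h (r\<^sup>2)))) (at r)" if r: "r \<in> {0<..<1} - E" for r
    using DERIV_cmult[OF bspec[OF E(2) r], of t] by (simp add: algebra_simps)
  then show ?thesis
    unfolding radial_solution_def using E(1) d c
    by (intro conjI allI impI exI[of _ E] ballI DERIV_cmult continuous_on_mult continuous_on_const) simp_all
qed

lemma is_DN_radial_solution: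
  assumes N: "N \<ge> 1" and \<beta>: "\<beta> \<in> borel_measurable borel" "\<And>y. 0 \<le> y \<Longrightarrow> y \<le> 1 \<Longrightarrow> \<bar>\<beta> y\<bar> \<le> C"
    and sol: "radial_solution N \<beta> h h'" and h: "h 1 \<noteq> 0"
  shows "is_DN (angular_coeff \<beta>) (\<lambda>\<theta>. of_real s * circle_mode (int N) \<theta>)
    (\<lambda>\<psi>. of_real (s * (real N + 2 * h' 1 / h 1)) * (LINT \<theta>|lebesgue_on {0..2*pi}. cnj (\<psi> \<theta>) * circle_mode (int N) \<theta>))"
proof -
  \<comment> \<open>the multiple of the profile that has boundary value \<open>s\<close>\<close>
  let ?t = "s / h 1"
  have "is_DN (angular_coeff \<beta>) (\<lambda>\<theta>. of_real (?t * h 1) * circle_mode (int N) \<theta>)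
    (\<lambda>\<psi>. of_real (real N * (?t * h 1) + 2 * (?t * h' 1)) * (LINT \<theta>|lebesgue_on {0..2*pi}. cnj (\<psi> \<theta>) * circle_mode (int N) \<theta>))"
    using N \<beta> radial_solution_scale[OF sol] by (rule is_DN_radial_mode)
  moreover have "?t * h 1 = s" "real N * s + 2 * (?t * h' 1) = s * (real N + 2 * h' 1 / h 1)"
    using h by (simp_all add: field_simps)
  ultimately show ?thesis by (simp only:)
qed

text \<open>
  The functional chosen by \<open>DN_map\<close> is compared with the explicit one for the boundary values
  \<open>e\<^sup>i\<^sup>N\<^sup>\<theta>\<close> by reciprocity.
\<close>

lemma DN_map_circle_mode:
  assumes N: "N \<ge> 1" and \<beta>: "\<beta> \<in> borel_measurable borel" "\<And>y. 0 \<le> y \<Longrightarrow> y \<le> 1 \<Longrightarrow> \<bar>\<beta> y\<bar> \<le> C"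
    and sol: "radial_solution N \<beta> h h'" and h: "h 1 \<noteq> 0"
  shows "DN_map (angular_coeff \<beta>) (\<lambda>\<theta>. of_real s * circle_mode (int N) \<theta>) (circle_mode (int N))
    = of_real (2 * pi * s * (real N + 2 * h' 1 / h 1))"
proof -
  let ?e = "circle_mode (int N)" and ?\<phi> = "\<lambda>\<theta>. of_real s * circle_mode (int N) \<theta>"
  let ?l = "real N + 2 * h' 1 / h 1"
  have ex: "is_DN (angular_coeff \<beta>) (\<lambda>\<theta>. of_real t * circle_mode (int N) \<theta>)
    (\<lambda>\<psi>. of_real (t * ?l) * (LINT \<theta>|lebesgue_on {0..2*pi}. cnj (\<psi> \<theta>) * circle_mode (int N) \<theta>))" for t
    using N \<beta> sol h by (rule is_DN_radial_solution)
  have T: "is_DN (angular_coeff \<beta>) ?\<phi> (DN_map (angular_coeff \<beta>) ?\<phi>)"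
    unfolding DN_map_def by (rule someI[of "is_DN (angular_coeff \<beta>) ?\<phi>", OF ex])
  have S: "is_DN (angular_coeff \<beta>) ?e (\<lambda>\<psi>. of_real ?l * (LINT \<theta>|lebesgue_on {0..2*pi}. cnj (\<psi> \<theta>) * ?e \<theta>))"
    using ex[of 1] by simp
  have "(LINT \<theta>|lebesgue_on {0..2*pi}. cnj (?\<phi> \<theta>) * ?e \<theta>) = of_real s * (LINT \<theta>|lebesgue_on {0..2*pi}. cnj (?e \<theta>) * ?e \<theta>)"
    unfolding integral_mult_right_zero[symmetric]
    by (rule Bochner_Integration.integral_cong[OF refl]) simp
  also have "\<dots> = of_real (2 * pi * s)" by (simp add: circle_mode_orthogonal)
  finally have e: "(LINT \<theta>|lebesgue_on {0..2*pi}. cnj (?\<phi> \<theta>) * ?e \<theta>) = of_real (2 * pi * s)" .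
  have "DN_map (angular_coeff \<beta>) ?\<phi> ?e = cnj (of_real ?l * (LINT \<theta>|lebesgue_on {0..2*pi}. cnj (?\<phi> \<theta>) * ?e \<theta>))"
    by (rule is_DN_reciprocal[OF transpose_angular_coeff T S])
  also have "\<dots> = of_real (2 * pi * s * ?l)"
    unfolding e of_real_mult[symmetric] complex_cnj_complex_of_real by (simp only: mult.commute)
  finally show ?thesis .
qed

lemma radial_solution_identity: "radial_solution N (\<lambda>_. 0) (\<lambda>_. 1) (\<lambda>_. 0)"
  unfolding radial_solution_def
proof (intro conjI exI[of _ "{}"] ballI allI impI)
  show "((\<lambda>r. real N * r ^ N * 1 + 2 * r ^ (N + 2) * 0) has_real_derivative (1 + 0) * ((real N)\<^sup>2 * r ^ (N - 1) * 1)) (at r)" for r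
    by (auto intro!: derivative_eq_intros simp: power2_eq_square)
qed auto

text \<open>
  The boundary values \<open>N\<^sup>-\<^sup>1\<^sup>/\<^sup>2 e\<^sup>i\<^sup>N\<^sup>\<theta>\<close> have norm \<open>1\<close> in \<open>H\<^sup>1\<^sup>/\<^sup>2\<close>, and the \<open>N\<close>-th coefficient of the image alone
  bounds its \<open>H\<^sup>-\<^sup>1\<^sup>/\<^sup>2\<close> norm from below.
\<close>

lemma half_operator_norm_ge:
  assumes N: "N \<ge> 1" and \<beta>: "\<beta> \<in> borel_measurable borel" "\<And>y. 0 \<le> y \<Longrightarrow> y \<le> 1 \<Longrightarrow> \<bar>\<beta> y\<bar> \<le> C"
    and sol: "radial_solution N \<beta> h h'" and h: "h 1 \<noteq> 0"
  shows "ereal \<bar>2 * h' 1 / (real N * h 1)\<bar> \<le>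
    half_operator_norm (\<lambda>\<phi> \<psi>. DN_map (angular_coeff \<beta>) \<phi> \<psi> - DN_map (\<lambda>_. mat 1) \<phi> \<psi>)"
proof -
  let ?s = "real N powr (- 1/2)"
  let ?e = "circle_mode (int N)" and ?\<phi> = "\<lambda>\<theta>. of_real ?s * circle_mode (int N) \<theta>"
  let ?A = "\<lambda>\<phi> \<psi>. DN_map (angular_coeff \<beta>) \<phi> \<psi> - DN_map (\<lambda>_. mat 1) \<phi> \<psi>"
  have N0: "int N \<noteq> 0" "0 < real N" using N by auto
  have half: "real N powr (1/2) * ?s = 1"
    using N0 by (simp flip: powr_add)
  have "?\<phi> \<in> L2_on {0..2*pi}"
    by (rule continuous_imp_L2_on_circle) (intro continuous_on_mult continuous_on_const continuous_on_circle_mode)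
  moreover have "Hs_norm (1/2) (fourier_coeff ?\<phi>) \<le> 1"
    unfolding fourier_coeff_circle_mode Hs_norm_single[OF N0(1)] using half by simp
  ultimately have mem: "?\<phi> \<in> {\<phi> \<in> L2_on {0..2*pi}. Hs_norm (1/2) (fourier_coeff \<phi>) \<le> 1}" by simp
  have id: "(\<lambda>_. mat 1) = angular_coeff (\<lambda>_. 0)"
    by (rule ext) (simp add: angular_coeff_eq_mat_1)
  have D0: "DN_map (\<lambda>_. mat 1) ?\<phi> ?e = of_real (2 * pi * ?s * (real N + 2 * 0 / 1))"
    unfolding id by (rule DN_map_circle_mode[OF N _ _ radial_solution_identity, of 0]) auto
  have D1: "DN_map (angular_coeff \<beta>) ?\<phi> ?e = of_real (2 * pi * ?s * (real N + 2 * h' 1 / h 1))"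
    using N \<beta> sol h by (rule DN_map_circle_mode)
  have "dual_fourier_coeff (?A ?\<phi>) (int N) = of_real (?s * (2 * h' 1 / h 1))"
    unfolding dual_fourier_coeff_def D0 D1 by (simp add: field_simps)
  then have "ereal (real_of_int \<bar>int N\<bar> powr (- 1/2) * norm (complex_of_real (?s * (2 * h' 1 / h 1))))
      \<le> Hs_norm (- 1/2) (dual_fourier_coeff (?A ?\<phi>))"
    using Hs_norm_ge[OF N0(1), of "- 1/2" "dual_fourier_coeff (?A ?\<phi>)"] by (simp only:)
  moreover have "real_of_int \<bar>int N\<bar> powr (- 1/2) * norm (complex_of_real (?s * (2 * h' 1 / h 1))) = \<bar>2 * h' 1 / (real N * h 1)\<bar>"
  proof -
    have "?s * ?s = 1 / real N" using N0 by (simp add: powr_minus_divide flip: powr_add)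
    moreover have "real_of_int \<bar>int N\<bar> powr (- 1/2) * norm (complex_of_real (?s * (2 * h' 1 / h 1))) = ?s * ?s * \<bar>2 * h' 1 / h 1\<bar>"
      unfolding norm_of_real by (simp add: abs_mult abs_divide)
    ultimately show ?thesis using N0 by (simp add: abs_divide abs_mult)
  qed
  ultimately have "ereal \<bar>2 * h' 1 / (real N * h 1)\<bar> \<le> Hs_norm (- 1/2) (dual_fourier_coeff (?A ?\<phi>))" by (simp only:)
  also have "\<dots> \<le> half_operator_norm ?A"
    unfolding half_operator_norm_def by (rule SUP_upper[OF mem])
  finally show ?thesis .
qed

section \<open>Ellipticity and the choice of the window\<close>

lemma angular_coeff_quadratic_form:
  "(angular_coeff \<beta> x *v \<xi>) \<bullet> \<xi> = (norm \<xi>)\<^sup>2 + \<beta> ((norm x)\<^sup>2) / (norm x)\<^sup>2 * (x $ 1 * \<xi> $ 2 - x $ 2 * \<xi> $ 1)\<^sup>2"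
proof -
  define c where "c = \<beta> ((norm x)\<^sup>2) / (norm x)\<^sup>2"
  show ?thesis
    unfolding matrix_vector_mult_def inner_vec_def sum_2 vec_lambda_beta angular_coeff_nth norm_plane_power2[of \<xi>] c_def[symmetric]
    by (simp add: power2_eq_square algebra_simps)
qed

lemma angular_coeff_M_class:
  assumes \<alpha>: "0 \<le> \<alpha>" and \<beta>: "\<beta> \<in> borel_measurable borel" "\<And>y. 0 \<le> y \<Longrightarrow> y \<le> 1 \<Longrightarrow> 0 \<le> \<beta> y \<and> \<beta> y \<le> \<alpha>"
  shows "angular_coeff \<beta> \<in> M_class (1 + \<alpha>) disc"
  unfolding M_class_def
proof (intro CollectI conjI ballI AE_I2 allI)
  show "angular_coeff \<beta> \<in> borel_measurable (lebesgue_on disc)"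
    by (rule measurable_lebesgue_on_disc[OF borel_measurable_angular_coeff[OF \<beta>(1)]])
  show "transpose (angular_coeff \<beta> x) = angular_coeff \<beta> x" for x by (rule transpose_angular_coeff)
  fix x \<xi> :: plane assume "x \<in> space (lebesgue_on disc)"
  then have x: "norm x < 1" by (simp add: disc_eq)
  let ?q = "(x $ 1 * \<xi> $ 2 - x $ 2 * \<xi> $ 1)\<^sup>2"
  have b: "0 \<le> \<beta> ((norm x)\<^sup>2)" "\<beta> ((norm x)\<^sup>2) \<le> \<alpha>" using \<beta>(2)[of "(norm x)\<^sup>2"] x by (auto simp: power_le_one)
  have q: "?q \<le> (norm x)\<^sup>2 * (norm \<xi>)\<^sup>2"
  proof -
    have "(norm x)\<^sup>2 * (norm \<xi>)\<^sup>2 - ?q = (x $ 1 * \<xi> $ 1 + x $ 2 * \<xi> $ 2)\<^sup>2"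
      unfolding norm_plane_power2 by (simp add: power2_eq_square algebra_simps)
    then show ?thesis using zero_le_power2[of "x $ 1 * \<xi> $ 1 + x $ 2 * \<xi> $ 2"] by linarith
  qed
  have up: "\<beta> ((norm x)\<^sup>2) / (norm x)\<^sup>2 * ?q \<le> \<alpha> * (norm \<xi>)\<^sup>2"
  proof (cases "x = 0")
    case False
    then have "?q / (norm x)\<^sup>2 \<le> (norm \<xi>)\<^sup>2" using q by (simp add: divide_simps mult.commute)
    then have "\<beta> ((norm x)\<^sup>2) * (?q / (norm x)\<^sup>2) \<le> \<alpha> * (norm \<xi>)\<^sup>2" using b by (intro mult_mono) auto
    then show ?thesis by simp
  qed (use \<alpha> in simp)
  have low: "0 \<le> \<beta> ((norm x)\<^sup>2) / (norm x)\<^sup>2 * ?q" using b by simp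
  have "1 / (1 + \<alpha>) * (norm \<xi>)\<^sup>2 \<le> 1 * (norm \<xi>)\<^sup>2" using \<alpha> by (intro mult_right_mono) auto
  then show "1 / (1 + \<alpha>) * (norm \<xi>)\<^sup>2 \<le> (angular_coeff \<beta> x *v \<xi>) \<bullet> \<xi>"
    unfolding angular_coeff_quadratic_form using low by linarith
  show "(angular_coeff \<beta> x *v \<xi>) \<bullet> \<xi> \<le> (1 + \<alpha>) * (norm \<xi>)\<^sup>2"
    unfolding angular_coeff_quadratic_form using up by (simp add: distrib_right)
qed

text \<open>The coefficients are bounded below by the identity, since \<open>\<beta>\<close> is nonnegative.\<close>

lemma angular_coeff_coercive:
  assumes "0 \<le> \<beta> ((norm x)\<^sup>2)"
  shows "(norm (g x))\<^sup>2 \<le> Re (\<Sum>i\<in>UNIV. flux (angular_coeff \<beta>) g x $ i * cnj (g x $ i))"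
proof -
  let ?c = "\<beta> ((norm x)\<^sup>2) / (norm x)\<^sup>2"
  let ?t = "of_real (x $ 1) * g x $ 2 - of_real (x $ 2) * g x $ 1"
  have "(\<Sum>i\<in>UNIV. flux (angular_coeff \<beta>) g x $ i * cnj (g x $ i))
      = g x $ 1 * cnj (g x $ 1) + g x $ 2 * cnj (g x $ 2) + of_real ?c * (?t * cnj ?t)"
    using flux_angular_coeff[of \<beta> g x "cnj_vec (g x)"] by (simp add: mult.assoc)
  also have "Re \<dots> = (norm (g x $ 1))\<^sup>2 + (norm (g x $ 2))\<^sup>2 + ?c * (norm ?t)\<^sup>2"
    unfolding complex_norm_square[symmetric] by simp
  moreover have "(norm (g x))\<^sup>2 = (norm (g x $ 1))\<^sup>2 + (norm (g x $ 2))\<^sup>2"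
    by (simp add: norm_vec_def L2_set_def sum_2)
  moreover have "0 \<le> ?c * (norm ?t)\<^sup>2" using assms by simp
  ultimately show ?thesis by simp
qed

text \<open>
  For mode \<open>N\<close> the window \<open>N/(N+1) < \<bar>x\<bar>\<^sup>2 < 1 - 1/(4N)\<close> has width of order \<open>1/N\<close>, the scale on which
  \<open>\<bar>z\<bar>\<^sup>2\<^sup>N\<close> varies near the circle.  Bernoulli's inequality bounds \<open>\<bar>z\<bar>\<^sup>2\<^sup>N\<close> by \<open>1/2\<close> at its inner
  end and from below by \<open>3/4\<close> at its outer end.
\<close>

lemma window_profile:
  fixes \<alpha> :: real
  assumes \<alpha>: "0 < \<alpha>" and N: "N \<ge> 1"
  obtains h h' \<beta> :: "real \<Rightarrow> real" where
    "radial_solution N \<beta> h h'" "\<beta> \<in> borel_measurable borel" "\<And>y. 0 \<le> y \<Longrightarrow> y \<le> 1 \<Longrightarrow> 0 \<le> \<beta> y \<and> \<beta> y \<le> \<alpha>"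
    "\<And>y. y \<notin> {real N / (real N + 1)<..<1 - 1 / (4 * real N)} \<Longrightarrow> \<beta> y = 0"
    "h 1 \<noteq> 0" "\<alpha> / (8 + 2 * \<alpha>) \<le> \<bar>2 * h' 1 / (real N * h 1)\<bar>"
proof -
  define n where "n = real N"
  define y0 where "y0 = n / (n + 1)"
  define y1 where "y1 = 1 - 1 / (4 * n)"
  have n: "1 \<le> n" using N by (simp add: n_def)
  have y: "0 < y0" "y0 < y1" "y1 < 1"
    using n by (auto simp: y0_def y1_def field_simps)
  show ?thesis
  proof (rule radial_profile[OF less_imp_le[OF \<alpha>] N y])
    fix h h' \<beta> :: "real \<Rightarrow> real"
    assume sol: "radial_solution N \<beta> h h'"
      and p: "\<beta> \<in> borel_measurable borel" "\<And>y. 0 \<le> y \<Longrightarrow> y \<le> 1 \<Longrightarrow> 0 \<le> \<beta> y \<and> \<beta> y \<le> \<alpha>"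
        "\<And>y. y \<notin> {y0<..<y1} \<Longrightarrow> \<beta> y = 0" "1 \<le> h 1" "h 1 \<le> 1 + \<alpha> * real N / 4 * (1 - y0) / y0"
        "h' 1 = \<alpha> * real N / 4 * (y1 ^ N - y0 ^ N)"
    have "1 + real N * (- 1 / (4 * n)) \<le> (1 + (- 1 / (4 * n))) ^ N"
      by (rule Bernoulli_inequality) (use n in \<open>simp add: field_simps\<close>)
    then have Y1: "3 / 4 \<le> y1 ^ N" using n by (simp add: y1_def n_def[symmetric] field_simps)
    have "1 + real N * (1 / n) \<le> (1 + 1 / n) ^ N"
      by (rule Bernoulli_inequality) (use n in \<open>auto intro: order_trans[of _ 0]\<close>)
    then have "2 \<le> (1 + 1 / n) ^ N" using n by (simp add: n_def)
    moreover have "y0 = 1 / (1 + 1 / n)" using n by (simp add: y0_def field_simps)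
    ultimately have Y0: "y0 ^ N \<le> 1 / 2" by (simp add: power_one_over frac_le power_divide)
    have y0n: "(1 - y0) / y0 = 1 / n" using n by (simp add: y0_def field_simps)
    have h1: "1 \<le> h 1" "h 1 \<le> 1 + \<alpha> / 4"
    proof -
      have "\<alpha> * real N / 4 * (1 - y0) / y0 = \<alpha> * n / 4 * ((1 - y0) / y0)" by (simp add: n_def)
      also have "\<dots> = \<alpha> / 4" unfolding y0n using n by simp
      finally show "h 1 \<le> 1 + \<alpha> / 4" using p(5) by linarith
      show "1 \<le> h 1" by (rule p(4))
    qed
    have "\<alpha> / (8 + 2 * \<alpha>) = (\<alpha> / 8) / (1 + \<alpha> / 4)" using \<alpha> by (simp add: field_simps)
    also have "\<dots> \<le> (\<alpha> / 8) / h 1" using h1 \<alpha> by (intro divide_left_mono) auto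
    also have "\<dots> \<le> (\<alpha> / 2 * (y1 ^ N - y0 ^ N)) / h 1"
      using h1 \<alpha> mult_left_mono[of "1/4" "y1 ^ N - y0 ^ N" "\<alpha> / 2"] Y1 Y0 by (intro divide_right_mono) auto
    also have "\<dots> = 2 * h' 1 / (real N * h 1)" using n h1 by (simp add: p(6) n_def[symmetric] field_simps)
    finally have "\<alpha> / (8 + 2 * \<alpha>) \<le> \<bar>2 * h' 1 / (real N * h 1)\<bar>"
      by (rule order_trans[OF _ abs_ge_self])
    then show ?thesis
      using that[OF sol p(1,2)] p(3) h1 by (simp add: y0_def y1_def n_def)
  qed
qed

lemma infdist_frontier_disc:
  assumes "x \<in> disc" shows "1 - norm x \<le> infdist x (frontier disc)"
proof -
  have fr: "frontier disc = sphere 0 1" by (simp add: disc_def)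
  have "closed (sphere 0 1 :: plane set)" "sphere 0 1 \<noteq> ({} :: plane set)" by auto
  then obtain y where y: "y \<in> sphere 0 1" "infdist x (sphere 0 1) = dist x y"
    using infdist_attains_inf by metis
  have "norm y \<le> norm x + dist x y"
    by (metis add.commute dist_norm norm_triangle_sub dist_commute)
  then show ?thesis using y by (simp add: fr)
qed

theorem theorem4p9:
  fixes \<alpha> :: real
  assumes "\<alpha> > 0"
  shows "\<exists>(\<sigma> :: nat \<Rightarrow> plane \<Rightarrow> real ^ 2 ^ 2) (\<delta> :: nat \<Rightarrow> real).
           (\<forall>n. \<sigma> n \<in> M_class (1 + \<alpha>) disc) \<and>
           (\<forall>n. \<delta> n > 0) \<and> \<delta> \<longlonglongrightarrow> 0 \<and>
           (\<forall>n. \<forall>x \<in> disc. infdist x (frontier disc) < \<delta> n \<longrightarrow> \<sigma> n x = mat 1) \<and>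
           G_converges (1 + \<alpha>) disc \<sigma> (\<lambda>_. mat 1) \<and>
           limsup (\<lambda>n. half_operator_norm
                          (\<lambda>\<phi> \<psi>. DN_map (\<sigma> n) \<phi> \<psi> - DN_map (\<lambda>_. mat 1) \<phi> \<psi>))
             > ereal (\<alpha> / (16 * (2 + \<alpha>)))"
proof -
  let ?W = "\<lambda>n. {real (Suc n) / (real (Suc n) + 1)<..<1 - 1 / (4 * real (Suc n))}"
  have "\<exists>h h' \<beta>. radial_solution (Suc n) \<beta> h h' \<and> \<beta> \<in> borel_measurable borel \<and>
      (\<forall>y. 0 \<le> y \<and> y \<le> 1 \<longrightarrow> 0 \<le> \<beta> y \<and> \<beta> y \<le> \<alpha>) \<and> (\<forall>y. y \<notin> ?W n \<longrightarrow> \<beta> y = 0) \<and>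
      h 1 \<noteq> 0 \<and> \<alpha> / (8 + 2 * \<alpha>) \<le> \<bar>2 * h' 1 / (real (Suc n) * h 1)\<bar>" for n
    by (rule window_profile[OF assms, of "Suc n"]) (simp, blast)
  then obtain h h' \<beta> where p: "\<forall>n. radial_solution (Suc n) (\<beta> n) (h n) (h' n) \<and> \<beta> n \<in> borel_measurable borel \<and>
      (\<forall>y. 0 \<le> y \<and> y \<le> 1 \<longrightarrow> 0 \<le> \<beta> n y \<and> \<beta> n y \<le> \<alpha>) \<and> (\<forall>y. y \<notin> ?W n \<longrightarrow> \<beta> n y = 0) \<and>
      h n 1 \<noteq> 0 \<and> \<alpha> / (8 + 2 * \<alpha>) \<le> \<bar>2 * h' n 1 / (real (Suc n) * h n 1)\<bar>"
    by metis
  have sol: "radial_solution (Suc n) (\<beta> n) (h n) (h' n)" and bm: "\<beta> n \<in> borel_measurable borel"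
    and off: "y \<notin> ?W n \<Longrightarrow> \<beta> n y = 0"
    and h1: "h n 1 \<noteq> 0" and ge: "\<alpha> / (8 + 2 * \<alpha>) \<le> \<bar>2 * h' n 1 / (real (Suc n) * h n 1)\<bar>" for n y
    using p by blast+
  have b: "0 \<le> \<beta> n y \<and> \<beta> n y \<le> \<alpha>" if "0 \<le> y" "y \<le> 1" for n y
    using p that by blast
  have babs: "\<bar>\<beta> n y\<bar> \<le> \<alpha>" if "0 \<le> y" "y \<le> 1" for n y
    using b[OF that, of n] by simp
  define \<sigma> where "\<sigma> n = angular_coeff (\<beta> n)" for n
  \<comment> \<open>\<open>(1 - \<delta>)\<^sup>2 \<ge> 1 - 2 \<delta>\<close>, and \<open>1 - 2 \<delta>\<close> is the outer end of the window\<close>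
  define \<delta> where "\<delta> n = 1 / 8 * inverse (real (Suc n))" for n
  have M: "\<sigma> n \<in> M_class (1 + \<alpha>) disc" for n
    unfolding \<sigma>_def by (rule angular_coeff_M_class) (use assms bm b in auto)
  have "(\<lambda>_. mat 1) = angular_coeff (\<lambda>_. 0)"
    by (rule ext) (simp add: angular_coeff_eq_mat_1)
  then have M1: "(\<lambda>_. mat 1) \<in> M_class (1 + \<alpha>) disc"
    using angular_coeff_M_class[of \<alpha> "\<lambda>_. 0"] assms by simp
  have \<delta>0: "\<delta> \<longlonglongrightarrow> 0"
    unfolding \<delta>_def[abs_def] by (rule tendsto_mult_right_zero[OF LIMSEQ_inverse_real_of_nat])
  have near: "\<sigma> n x = mat 1" if x: "x \<in> disc" and d: "infdist x (frontier disc) < \<delta> n" for n x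
  proof -
    have "1 - norm x < \<delta> n" using infdist_frontier_disc[OF x] d by linarith
    then have r: "1 - \<delta> n < norm x" by linarith
    have "\<delta> n \<le> 1" by (simp add: \<delta>_def field_simps)
    then have "(1 - \<delta> n)\<^sup>2 \<le> (norm x)\<^sup>2" using r by (intro power_mono) auto
    moreover have "(1 - \<delta> n)\<^sup>2 = 1 - 2 * \<delta> n + (\<delta> n)\<^sup>2" by (simp add: power2_diff)
    ultimately have "1 - 2 * \<delta> n \<le> (norm x)\<^sup>2" using zero_le_power2[of "\<delta> n"] by linarith
    moreover have "2 * \<delta> n = 1 / (4 * real (Suc n))" by (simp add: \<delta>_def field_simps)
    ultimately have "\<beta> n ((norm x)\<^sup>2) = 0" by (intro off) auto
    then show ?thesis unfolding \<sigma>_def by (rule angular_coeff_eq_mat_1)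
  qed
  have G: "G_converges (1 + \<alpha>) disc \<sigma> (\<lambda>_. mat 1)"
  proof (rule G_converges_pointwise[OF M M1])
    show "bounded_coeff (1 + \<alpha>) (\<sigma> n)" for n
      unfolding \<sigma>_def by (rule bounded_coeff_angular_coeff[OF bm babs])
    show "(norm (g x))\<^sup>2 \<le> Re (\<Sum>i\<in>UNIV. flux (\<sigma> n) g x $ i * cnj (g x $ i))" if "x \<in> disc" for n x g
      unfolding \<sigma>_def by (rule angular_coeff_coercive) (use b[of "(norm x)\<^sup>2" n] that in \<open>simp add: disc_eq power_le_one\<close>)
    fix x assume x: "x \<in> disc"
    then have "(norm x)\<^sup>2 < 1" by (simp add: disc_eq power_less_one_iff)
    moreover have "(\<lambda>n. real (Suc n) / (real (Suc n) + 1)) \<longlonglongrightarrow> 1"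
      using LIMSEQ_Suc[OF LIMSEQ_n_over_Suc_n] by (simp add: add.commute)
    ultimately have "\<forall>\<^sub>F n in sequentially. (norm x)\<^sup>2 < real (Suc n) / (real (Suc n) + 1)"
      by (rule order_tendstoD(1)[rotated])
    then show "\<forall>\<^sub>F n in sequentially. \<sigma> n x = mat 1"
    proof eventually_elim
      case (elim n)
      then have "\<beta> n ((norm x)\<^sup>2) = 0" by (intro off) auto
      then show ?case unfolding \<sigma>_def by (rule angular_coeff_eq_mat_1)
    qed
  qed
  let ?D = "\<lambda>n. half_operator_norm (\<lambda>\<phi> \<psi>. DN_map (\<sigma> n) \<phi> \<psi> - DN_map (\<lambda>_. mat 1) \<phi> \<psi>)"
  have "ereal (\<alpha> / (8 + 2 * \<alpha>)) \<le> ?D n" for n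
  proof -
    have "ereal \<bar>2 * h' n 1 / (real (Suc n) * h n 1)\<bar> \<le> ?D n"
      unfolding \<sigma>_def by (rule half_operator_norm_ge[OF _ bm babs sol h1]) auto
    then show ?thesis by (rule order_trans[rotated]) (use ge[of n] in simp)
  qed
  then have "ereal (\<alpha> / (8 + 2 * \<alpha>)) \<le> limsup ?D"
    by (intro le_Limsup) auto
  moreover have "\<alpha> / (16 * (2 + \<alpha>)) < \<alpha> / (8 + 2 * \<alpha>)"
    using assms by (intro divide_strict_left_mono) auto
  then have "ereal (\<alpha> / (16 * (2 + \<alpha>))) < ereal (\<alpha> / (8 + 2 * \<alpha>))" by simp
  ultimately have lim: "ereal (\<alpha> / (16 * (2 + \<alpha>))) < limsup ?D"
    by (rule less_le_trans[rotated])
  have "\<forall>n. \<delta> n > 0" by (simp add: \<delta>_def)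
  then show ?thesis
    using M \<delta>0 near G lim by (intro exI[of _ \<sigma>] exI[of _ \<delta>] conjI allI ballI impI) simp_all
qed

end
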